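(* Let $r\ge 1$ be an integer with $r\equiv 0\pmod 4$, let $m_1,m_2$ be nonnegative integers, not both zero, and let $\widehat{\mathfrak{spin}(r)}\subset\mathfrak{so}(d_rm_1+d_rm_2)$ be the image of $\mathfrak{spin}(r)$ acting on $$\mathbb{R}^{d_rm_1+d_rm_2}=\tilde\Delta_r^+\otimes\mathbb{R}^{m_1}\oplus\tilde\Delta_r^-\otimes\mathbb{R}^{m_2}$$ through the first tensor factors. Then the centralizer $C_{\mathfrak{so}(d_rm_1+d_rm_2)}(\widehat{\mathfrak{spin}(r)})$ of $\widehat{\mathfrak{spin}(r)}$ in $\mathfrak{so}(d_rm_1+d_rm_2)$ is isomorphic, as a Lie algebra, to \begin{itemize} \item $\mathfrak{so}(m_1)\oplus\mathfrak{so}(m_2)$ if $r\equiv 0\pmod 8$; \item $\mathfrak{sp}(m_1)\oplus\mathfrak{sp}(m_2)$ if $r\equiv 4\pmod 8$. \end{itemize}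
   Context: $Cl_r$ is the real Clifford algebra generated by an orthonormal basis $e_1,\dots,e_r$ of $\mathbb{R}^r$ (standard positive definite inner product) subject to $e_je_k+e_ke_j=-2\delta_{jk}$, and $Cl_r^0$ is its even subalgebra. $\mathfrak{spin}(r)=\mathrm{span}\{e_ie_j \mid 1\le i<j\le r\}\subset Cl_r^0$ with the commutator bracket. For $r\equiv 0\pmod 4$, $Cl_r^0$ has, up to isomorphism, exactly two irreducible real representations, denoted $\tilde\Delta_r^+$ and $\tilde\Delta_r^-$ (distinguished by $e_1e_2\cdots e_r$ acting as $+\mathrm{Id}$, respectively $-\mathrm{Id}$), both of real dimension $d_r$, where $d_r=2^{r/2}$ if $r\equiv 4\pmod 8$ and $d_r=2^{r/2-1}$ if $r\equiv 0\pmod 8$. Each is endowed with an inner product for which every $e_ie_j$ ($i<j$) acts as an antisymmetric endomorphism (squaring to $-\mathrm{Id}$). The space $\tilde\Delta_r^+\otimes\mathbb{R}^{m_1}\oplus\tilde\Delta_r^-\otimes\mathbb{R}^{m_2}$ carries the orthogonal direct sum of the tensor product inner products (with the standard ones on $\mathbb{R}^{m_i}$). An element $A\in\mathfrak{spin}(r)$ acts as $(A^+\otimes\mathrm{Id}_{m_1\times m_1})\oplus(A^-\otimes\mathrm{Id}_{m_2\times m_2})$, where $A^\pm$ is the image of $A$ in $\mathrm{End}(\tilde\Delta_r^\pm)$; the set of these endomorphisms is $\widehat{\mathfrak{spin}(r)}$. $\mathfrak{so}(m)$ and $\mathfrak{sp}(m)$ denote the real Lie algebras of $m\times m$ real antisymmetric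 and quaternionic anti-Hermitian matrices respectively (compact forms; both zero for $m=0$). $C_{\mathfrak{g}}(\mathfrak{k})=\{X\in\mathfrak{g}\mid [X,Y]=0 \ \forall\, Y\in\mathfrak{k}\}$. *)

theory Defs
  imports Complex_Main "Jordan_Normal_Form.Matrix" "Jordan_Normal_Form.VS_Connect"
begin

section \<open>Real Clifford algebras\<close>

text \<open>
  The type \<open>clifford\<close> is the real Clifford algebra on countably many anticommuting generators
  \<open>e i\<close> with \<open>e i * e i = -1\<close>. An element is the finitely supported family of its coefficients
  with respect to the basis of monomials \<open>e\<^sub>S = e i\<^sub>1 * \<dots> * e i\<^sub>k\<close>, one for each finite set
  \<open>S = {i\<^sub>1 < \<dots> < i\<^sub>k}\<close>. The algebra on \<open>r\<close> generators is the subalgebra generated by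
  \<open>e 1, \<dots>, e r\<close>; its monomials \<open>e\<^sub>S\<close>, \<open>S \<subseteq> {1..r}\<close>, are independent by construction, so it has
  dimension \<open>2 ^ r\<close>.
\<close>

typedef clifford = "{f :: nat set \<Rightarrow> real. finite {S. f S \<noteq> 0} \<and> (\<forall>S. f S \<noteq> 0 \<longrightarrow> finite S)}"
  morphisms cliff_coeff Abs_clifford
  by (rule exI[of _ "\<lambda>_. 0"]) simp

setup_lifting type_definition_clifford

text \<open>
  \<open>cliff_sign S T\<close> is the sign in \<open>e\<^sub>S * e\<^sub>T = \<plusminus> e\<^bsub>sym_diff S T\<^esub>\<close>: each factor \<open>e j\<close> of \<open>e\<^sub>T\<close> is moved
  to the left past every \<open>e i\<close> of \<open>e\<^sub>S\<close> with \<open>i > j\<close>, and a factor \<open>-1\<close> arises if it then meets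
  \<open>e j\<close> itself.
\<close>

definition cliff_sign :: "nat set \<Rightarrow> nat set \<Rightarrow> real" where
  "cliff_sign S T = (\<Prod>i\<in>S. \<Prod>j\<in>T. if j \<le> i then -1 else 1)"

lemma prod_sym_diff:
  fixes g :: "'a \<Rightarrow> real"
  assumes "finite A" "finite B" "\<And>i. g i * g i = 1"
  shows "prod g (sym_diff A B) = prod g A * prod g B"
proof -
  have 1: "prod g (sym_diff A B) = prod g (A - B) * prod g (B - A)"
    by (rule prod.union_disjoint) (use assms in auto)
  have 2: "prod g A = prod g (A - B) * prod g (A \<inter> B)"
    using assms by (subst prod.union_disjoint[symmetric]) (auto intro!: prod.cong)
  have 3: "prod g B = prod g (B - A) * prod g (A \<inter> B)"
    using assms by (subst prod.union_disjoint[symmetric]) (auto intro!: prod.cong)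
  have 4: "prod g (A \<inter> B) * prod g (A \<inter> B) = 1"
    by (simp add: prod.distrib[symmetric] assms)
  show ?thesis
    unfolding 1 2 3 using 4 by (simp add: mult.commute mult.left_commute)
qed

lemma cliff_sign_sym_diff_left:
  assumes "finite S" "finite T"
  shows "cliff_sign (sym_diff S T) U = cliff_sign S U * cliff_sign T U"
  unfolding cliff_sign_def
  by (rule prod_sym_diff) (use assms in \<open>auto simp: prod.distrib[symmetric] intro!: prod.neutral\<close>)

lemma cliff_sign_sym_diff_right:
  assumes "finite T" "finite U"
  shows "cliff_sign S (sym_diff T U) = cliff_sign S T * cliff_sign S U"
  unfolding cliff_sign_def prod.distrib[symmetric]
  by (rule prod.cong[OF refl], rule prod_sym_diff) (use assms in auto)

lemma cliff_sign_empty [simp]: "cliff_sign {} S = 1" "cliff_sign S {} = 1"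
  by (simp_all add: cliff_sign_def)

lemma sym_diff_simps [simp]:
  "sym_diff S (sym_diff S U) = U" "sym_diff S {} = S" "sym_diff {} S = S" "sym_diff S S = {}"
  by auto

instantiation clifford :: real_vector
begin

lift_definition zero_clifford :: clifford is "\<lambda>_. 0" by simp

lift_definition plus_clifford :: "clifford \<Rightarrow> clifford \<Rightarrow> clifford" is "\<lambda>f g S. f S + g S"
proof safe
  fix f g :: "nat set \<Rightarrow> real"
  assume "finite {S. f S \<noteq> 0}" "finite {S. g S \<noteq> 0}"
  then have "finite ({S. f S \<noteq> 0} \<union> {S. g S \<noteq> 0})" by simp
  then show "finite {S. f S + g S \<noteq> 0}" by (rule rev_finite_subset) auto
qed (metis add.right_neutral)

lift_definition uminus_clifford :: "clifford \<Rightarrow> clifford" is "\<lambda>f S. - f S" by simp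

definition minus_clifford :: "clifford \<Rightarrow> clifford \<Rightarrow> clifford" where
  "minus_clifford x y = x + (- y)"

lift_definition scaleR_clifford :: "real \<Rightarrow> clifford \<Rightarrow> clifford" is "\<lambda>c f S. c * f S" by simp

instance
  by standard (unfold minus_clifford_def, (transfer; simp add: fun_eq_iff algebra_simps)+)

end

lemma finite_cliff_support: "finite {S. cliff_coeff x S \<noteq> 0}"
  using cliff_coeff[of x] by simp

lemma cliff_coeff_infinite: "infinite S \<Longrightarrow> cliff_coeff x S = 0"
  using cliff_coeff[of x] by auto

lemma cliff_coeff_simps [simp]:
  "cliff_coeff 0 S = 0" "cliff_coeff (x + y) S = cliff_coeff x S + cliff_coeff y S"
  "cliff_coeff (- x) S = - cliff_coeff x S" "cliff_coeff (c *\<^sub>R x) S = c * cliff_coeff x S"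
  by (transfer; simp)+

lemma clifford_eqI: "(\<And>S. finite S \<Longrightarrow> cliff_coeff x S = cliff_coeff y S) \<Longrightarrow> x = y"
  by (metis cliff_coeff_infinite cliff_coeff_inject ext)

text \<open>The basis monomial \<open>e\<^sub>S\<close>.\<close>

lift_definition cliff_monom :: "nat set \<Rightarrow> clifford" is
  "\<lambda>S T. if finite S \<and> T = S then 1 else 0"
  by auto

instantiation clifford :: real_algebra_1
begin

definition one_clifford :: clifford where "one_clifford = cliff_monom {}"

text \<open>The coefficient of \<open>e\<^sub>U\<close> in a product collects the pairs \<open>(S, T)\<close> with \<open>sym_diff S T = U\<close>.\<close>

lift_definition times_clifford :: "clifford \<Rightarrow> clifford \<Rightarrow> clifford" is
  "\<lambda>f g U. \<Sum>S | f S \<noteq> 0. cliff_sign S (sym_diff S U) * f S * g (sym_diff S U)"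
proof (safe, goal_cases)
  case (1 f g)
  have "{U. (\<Sum>S | f S \<noteq> 0. cliff_sign S (sym_diff S U) * f S * g (sym_diff S U)) \<noteq> 0}
    \<subseteq> (\<lambda>(S, T). sym_diff S T) ` ({S. f S \<noteq> 0} \<times> {T. g T \<noteq> 0})"
  proof
    fix U assume "U \<in> {U. (\<Sum>S | f S \<noteq> 0. cliff_sign S (sym_diff S U) * f S * g (sym_diff S U)) \<noteq> 0}"
    then obtain S where "f S \<noteq> 0" "cliff_sign S (sym_diff S U) * f S * g (sym_diff S U) \<noteq> 0"
      by (metis (mono_tags, lifting) mem_Collect_eq sum.not_neutral_contains_not_neutral)
    then show "U \<in> (\<lambda>(S, T). sym_diff S T) ` ({S. f S \<noteq> 0} \<times> {T. g T \<noteq> 0})"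
      by (intro image_eqI[of _ _ "(S, sym_diff S U)"]) auto
  qed
  then show ?case using 1 by (meson finite_SigmaI finite_imageI finite_subset)
next
  case (2 f g U)
  then obtain S where S: "f S \<noteq> 0" "cliff_sign S (sym_diff S U) * f S * g (sym_diff S U) \<noteq> 0"
    by (metis (mono_tags, lifting) mem_Collect_eq sum.not_neutral_contains_not_neutral)
  then have "finite S" "finite (sym_diff S U)" using 2 by auto
  then have "finite (sym_diff S (sym_diff S U))" by blast
  then show ?case by simp
qed

lemma cliff_coeff_times:
  assumes "{S. cliff_coeff x S \<noteq> 0} \<subseteq> P" "finite P"
  shows "cliff_coeff (x * y) U =
    (\<Sum>S\<in>P. cliff_sign S (sym_diff S U) * cliff_coeff x S * cliff_coeff y (sym_diff S U))"
proof -
  have "cliff_coeff (x * y) U = (\<Sum>S | cliff_coeff x S \<noteq> 0.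
      cliff_sign S (sym_diff S U) * cliff_coeff x S * cliff_coeff y (sym_diff S U))"
    by transfer simp
  also have "\<dots> = (\<Sum>S\<in>P. cliff_sign S (sym_diff S U) * cliff_coeff x S * cliff_coeff y (sym_diff S U))"
    by (rule sum.mono_neutral_left) (use assms in auto)
  finally show ?thesis .
qed

lemma cliff_support_bound:
  obtains A where "finite A" "{S. cliff_coeff x S \<noteq> 0} \<subseteq> Pow A"
proof
  show "finite (\<Union>{S. cliff_coeff x S \<noteq> 0})"
    using finite_cliff_support[of x] cliff_coeff_infinite by blast
qed auto

lemma clifford_mult_assoc: "(x * y) * z = x * (y * z)" for x y z :: clifford
proof (rule clifford_eqI)
  fix U :: "nat set" assume U: "finite U"
  obtain A where A: "finite A" "{S. cliff_coeff x S \<noteq> 0} \<subseteq> Pow A" by (rule cliff_support_bound)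
  obtain B where B: "finite B" "{S. cliff_coeff y S \<noteq> 0} \<subseteq> Pow B" by (rule cliff_support_bound)
  define P where "P = Pow (A \<union> B)"
  have P: "finite P" unfolding P_def using A B by simp
  have fin: "finite S" if "S \<in> P" for S
    using that A(1) B(1) unfolding P_def by (meson PowD finite_UnI finite_subset)
  have xP: "{S. cliff_coeff x S \<noteq> 0} \<subseteq> P" and yP: "{S. cliff_coeff y S \<noteq> 0} \<subseteq> P"
    using A B unfolding P_def by auto
  have xyP: "{S. cliff_coeff (x * y) S \<noteq> 0} \<subseteq> P"
  proof
    fix S assume "S \<in> {S. cliff_coeff (x * y) S \<noteq> 0}"
    then have "(\<Sum>T\<in>P. cliff_sign T (sym_diff T S) * cliff_coeff x T * cliff_coeff y (sym_diff T S)) \<noteq> 0"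
      by (simp add: cliff_coeff_times[OF xP P])
    then obtain T where T: "T \<in> P"
      "cliff_sign T (sym_diff T S) * cliff_coeff x T * cliff_coeff y (sym_diff T S) \<noteq> 0"
      using sum.not_neutral_contains_not_neutral by blast
    then have "sym_diff T S \<in> P" using yP by auto
    with T(1) have "sym_diff T (sym_diff T S) \<in> P" unfolding P_def by blast
    then show "S \<in> P" by simp
  qed
  let ?x = "cliff_coeff x" and ?y = "cliff_coeff y" and ?z = "cliff_coeff z"
  have "cliff_coeff ((x * y) * z) U = (\<Sum>S\<in>P. \<Sum>T\<in>P. cliff_sign S (sym_diff S U) *
      (cliff_sign T (sym_diff T S) * ?x T * ?y (sym_diff T S)) * ?z (sym_diff S U))"
    by (simp add: cliff_coeff_times[OF xyP P] cliff_coeff_times[OF xP P]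
        sum_distrib_left sum_distrib_right)
  also have "\<dots> = (\<Sum>T\<in>P. \<Sum>S\<in>P. cliff_sign S (sym_diff S U) *
      (cliff_sign T (sym_diff T S) * ?x T * ?y (sym_diff T S)) * ?z (sym_diff S U))"
    by (rule sum.swap)
  also have "\<dots> = (\<Sum>T\<in>P. \<Sum>R\<in>P. cliff_sign T (sym_diff T U) * ?x T *
      (cliff_sign R (sym_diff R (sym_diff T U)) * ?y R * ?z (sym_diff R (sym_diff T U))))"
  proof (rule sum.cong[OF refl])
    fix T assume T: "T \<in> P"
    have "(\<Sum>S\<in>P. cliff_sign S (sym_diff S U) *
      (cliff_sign T (sym_diff T S) * ?x T * ?y (sym_diff T S)) * ?z (sym_diff S U)) =
      (\<Sum>R\<in>P. cliff_sign (sym_diff T R) (sym_diff (sym_diff T R) U) *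
      (cliff_sign T R * ?x T * ?y R) * ?z (sym_diff (sym_diff T R) U))"
      using T by (intro sum.reindex_bij_witness[of _ "sym_diff T" "sym_diff T"])
        (auto simp: P_def)
    also have "\<dots> = (\<Sum>R\<in>P. cliff_sign T (sym_diff T U) * ?x T *
      (cliff_sign R (sym_diff R (sym_diff T U)) * ?y R * ?z (sym_diff R (sym_diff T U))))"
    proof (rule sum.cong[OF refl])
      fix R assume R: "R \<in> P"
      define W where "W = sym_diff R (sym_diff T U)"
      have W: "sym_diff (sym_diff T R) U = W" "sym_diff T U = sym_diff R W"
        unfolding W_def by auto
      have "finite W" using fin[OF R] fin[OF T] U unfolding W_def by simp
      then have "cliff_sign (sym_diff T R) W * cliff_sign T R = cliff_sign T (sym_diff R W) * cliff_sign R W"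
        using fin[OF R] fin[OF T]
        by (simp add: cliff_sign_sym_diff_left cliff_sign_sym_diff_right del: sym_diff_simps)
      then have "(cliff_sign (sym_diff T R) W * cliff_sign T R) * (?x T * ?y R * ?z W) =
        (cliff_sign T (sym_diff R W) * cliff_sign R W) * (?x T * ?y R * ?z W)"
        by (rule arg_cong)
      then have "cliff_sign (sym_diff T R) W * (cliff_sign T R * ?x T * ?y R) * ?z W =
        cliff_sign T (sym_diff R W) * ?x T * (cliff_sign R W * ?y R * ?z W)"
        by (simp only: mult_ac)
      then show "cliff_sign (sym_diff T R) (sym_diff (sym_diff T R) U) *
        (cliff_sign T R * ?x T * ?y R) * ?z (sym_diff (sym_diff T R) U) =
        cliff_sign T (sym_diff T U) * ?x T *
        (cliff_sign R (sym_diff R (sym_diff T U)) * ?y R * ?z (sym_diff R (sym_diff T U)))"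
        unfolding W by (simp only: sym_diff_simps)
    qed
    finally show "(\<Sum>S\<in>P. cliff_sign S (sym_diff S U) *
      (cliff_sign T (sym_diff T S) * ?x T * ?y (sym_diff T S)) * ?z (sym_diff S U)) =
      (\<Sum>R\<in>P. cliff_sign T (sym_diff T U) * ?x T *
      (cliff_sign R (sym_diff R (sym_diff T U)) * ?y R * ?z (sym_diff R (sym_diff T U))))" .
  qed
  also have "\<dots> = cliff_coeff (x * (y * z)) U"
    by (simp add: cliff_coeff_times[OF yP P] cliff_coeff_times[OF xP P] sum_distrib_left)
  finally show "cliff_coeff ((x * y) * z) U = cliff_coeff (x * (y * z)) U" .
qed

instance
proof
  fix x y z :: clifford and c :: real
  show "x * y * z = x * (y * z)" by (rule clifford_mult_assoc)
  obtain A where A: "finite A" "{S. cliff_coeff x S \<noteq> 0} \<subseteq> Pow A" by (rule cliff_support_bound)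
  obtain B where B: "finite B" "{S. cliff_coeff y S \<noteq> 0} \<subseteq> Pow B" by (rule cliff_support_bound)
  define P where "P = Pow (A \<union> B)"
  have P: "finite P" unfolding P_def using A B by simp
  have xP: "{S. cliff_coeff x S \<noteq> 0} \<subseteq> P" and yP: "{S. cliff_coeff y S \<noteq> 0} \<subseteq> P"
    using A(2) B(2) unfolding P_def by blast+
  have "{S. cliff_coeff (x + y) S \<noteq> 0} \<subseteq> {S. cliff_coeff x S \<noteq> 0} \<union> {S. cliff_coeff y S \<noteq> 0}"
    by auto
  with xP yP have xyP: "{S. cliff_coeff (x + y) S \<noteq> 0} \<subseteq> P" by blast
  have "{S. cliff_coeff (c *\<^sub>R x) S \<noteq> 0} \<subseteq> {S. cliff_coeff x S \<noteq> 0}" by auto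
  with xP have cP: "{S. cliff_coeff (c *\<^sub>R x) S \<noteq> 0} \<subseteq> P" by blast
  note t = cliff_coeff_times[OF xP P] cliff_coeff_times[OF yP P] cliff_coeff_times[OF xyP P]
    cliff_coeff_times[OF cP P]
  show "(x + y) * z = x * z + y * z"
    by (rule clifford_eqI) (simp add: t algebra_simps sum.distrib)
  show "x * (y + z) = x * y + x * z"
    by (rule clifford_eqI) (simp add: t algebra_simps sum.distrib)
  show "c *\<^sub>R x * y = c *\<^sub>R (x * y)"
    by (rule clifford_eqI) (simp add: t sum_distrib_left mult_ac)
  show "x * c *\<^sub>R y = c *\<^sub>R (x * y)"
    by (rule clifford_eqI) (simp add: t sum_distrib_left mult_ac)
  have m: "cliff_coeff (cliff_monom {}) S = (if S = {} then 1 else 0)" for S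
    by transfer auto
  have 1: "{S. cliff_coeff 1 S \<noteq> 0} \<subseteq> {{}}" by (auto simp: one_clifford_def m)
  show "1 * x = x"
    by (rule clifford_eqI, subst cliff_coeff_times[OF 1]) (simp_all add: one_clifford_def m)
  show "x * 1 = x"
  proof (rule clifford_eqI)
    fix U :: "nat set"
    have "cliff_coeff (x * 1) U = (\<Sum>S\<in>insert U P.
      cliff_sign S (sym_diff S U) * cliff_coeff x S * (if S = U then 1 else 0))"
      using xP P by (subst cliff_coeff_times[where P = "insert U P"])
        (auto simp: one_clifford_def m intro!: sum.cong)
    also have "\<dots> = (\<Sum>S\<in>insert U P. if S = U then cliff_coeff x U else 0)"
      by (intro sum.cong) auto
    also have "\<dots> = cliff_coeff x U" using P by simp
    finally show "cliff_coeff (x * 1) U = cliff_coeff x U" .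
  qed
  show "(0 :: clifford) \<noteq> 1"
    using m[of "{}"] by (auto simp: one_clifford_def dest!: arg_cong[of _ _ "\<lambda>x. cliff_coeff x {}"])
qed

end

lemma cliff_coeff_monom:
  "cliff_coeff (cliff_monom S) T = (if finite S \<and> T = S then 1 else 0)"
  by transfer simp

lemma cliff_monom_mult:
  assumes "finite S" "finite T"
  shows "cliff_monom S * cliff_monom T = cliff_sign S T *\<^sub>R cliff_monom (sym_diff S T)"
proof (rule clifford_eqI)
  fix U :: "nat set"
  have "{R. cliff_coeff (cliff_monom S) R \<noteq> 0} \<subseteq> {S}" by (auto simp: cliff_coeff_monom)
  moreover have "sym_diff S U = T \<longleftrightarrow> U = sym_diff S T" by auto
  ultimately show "cliff_coeff (cliff_monom S * cliff_monom T) U =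
      cliff_coeff (cliff_sign S T *\<^sub>R cliff_monom (sym_diff S T)) U"
    using assms by (subst cliff_coeff_times[where P = "{S}"]) (auto simp: cliff_coeff_monom)
qed

definition cliff_e :: "nat \<Rightarrow> clifford" where
  "cliff_e i = cliff_monom {i}"

lemma clifford_relation:
  "cliff_e j * cliff_e k + cliff_e k * cliff_e j = (if j = k then -2 else 0)"
proof (cases "j = k")
  case True
  have "cliff_e k * cliff_e k = - 1"
    by (simp add: cliff_e_def cliff_monom_mult cliff_sign_def one_clifford_def)
  then have "cliff_e k * cliff_e k + cliff_e k * cliff_e k = - 1 + - 1" by (simp only:)
  also have "\<dots> = - (1 + 1 :: clifford)" by (simp only: minus_add_distrib)
  finally show ?thesis using True by (simp only: one_add_one simp_thms if_True)
next
  case False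
  then have sd: "sym_diff {j} {k} = {j, k}" "sym_diff {k} {j} = {j, k}" by auto
  have "cliff_sign {j} {k} + cliff_sign {k} {j} = 0"
    using False by (simp add: cliff_sign_def)
  then have "(cliff_sign {j} {k} + cliff_sign {k} {j}) *\<^sub>R cliff_monom {j, k} = 0" by simp
  then show ?thesis
    using False by (simp only: cliff_e_def cliff_monom_mult finite.intros sd scaleR_add_left if_False)
qed

lemma cliff_monom_eq_prod_list:
  "finite S \<Longrightarrow> cliff_monom S = prod_list (map cliff_e (sorted_list_of_set S))"
proof (induction "card S" arbitrary: S)
  case 0
  then show ?case by (simp add: one_clifford_def)
next
  case (Suc n)
  define i where "i = Min S"
  have ne: "S \<noteq> {}" using Suc by auto
  have i: "i \<in> S" "\<And>j. j \<in> S \<Longrightarrow> i \<le> j" unfolding i_def using Suc ne by auto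
  have "sorted_list_of_set S = i # sorted_list_of_set (S - {i})"
    unfolding i_def by (rule sorted_list_of_set_nonempty) (use Suc ne in auto)
  moreover have "cliff_monom (S - {i}) = prod_list (map cliff_e (sorted_list_of_set (S - {i})))"
    using Suc i by (intro Suc.hyps(1)) auto
  moreover have "cliff_e i * cliff_monom (S - {i}) = cliff_monom S"
  proof -
    have sd: "sym_diff {i} (S - {i}) = S" using i by auto
    have "\<not> j \<le> i" if "j \<in> S - {i}" for j
      using i(2)[of j] that by auto
    then have "cliff_sign {i} (S - {i}) = 1"
      by (simp add: cliff_sign_def)
    then show ?thesis
      using Suc.prems by (simp only: cliff_e_def cliff_monom_mult finite.intros finite_Diff sd scaleR_one)
  qed
  ultimately show ?case by simp
qed

text \<open>
  Generated subalgebras are written as the linear span of the words in the generators,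
  the even subalgebra as that of the words of even length.
\<close>

definition Cl :: "nat \<Rightarrow> clifford set" where
  "Cl r = span {prod_list (map cliff_e is) | is. set is \<subseteq> {1..r}}"

definition Cl0 :: "nat \<Rightarrow> clifford set" where
  "Cl0 r = span {prod_list (map cliff_e is) | is. set is \<subseteq> {1..r} \<and> even (length is)}"

definition spin :: "nat \<Rightarrow> clifford set" where
  "spin r = span {cliff_e i * cliff_e j | i j. 1 \<le> i \<and> i < j \<and> j \<le> r}"

definition cliff_volume :: "nat \<Rightarrow> clifford" where
  "cliff_volume r = prod_list (map cliff_e [1..<r+1])"

lemma spin_subset_Cl0: "spin r \<subseteq> Cl0 r"
  unfolding spin_def Cl0_def
proof (rule span_mono, safe)
  fix i j :: nat assume "1 \<le> i" "i < j" "j \<le> r"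
  then show "\<exists>is. cliff_e i * cliff_e j = prod_list (map cliff_e is) \<and> set is \<subseteq> {1..r} \<and> even (length is)"
    by (intro exI[of _ "[i, j]"]) auto
qed


section \<open>The half-spin representations\<close>

definition Cl0_representation :: "nat \<Rightarrow> nat \<Rightarrow> (clifford \<Rightarrow> real mat) \<Rightarrow> bool" where
  "Cl0_representation r n \<rho> \<longleftrightarrow>
    (\<forall>x\<in>Cl0 r. \<rho> x \<in> carrier_mat n n) \<and>
    \<rho> 1 = 1\<^sub>m n \<and>
    (\<forall>x\<in>Cl0 r. \<forall>y\<in>Cl0 r. \<rho> (x + y) = \<rho> x + \<rho> y) \<and>
    (\<forall>x\<in>Cl0 r. \<forall>y\<in>Cl0 r. \<rho> (x * y) = \<rho> x * \<rho> y) \<and>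
    (\<forall>x\<in>Cl0 r. \<forall>c. \<rho> (c *\<^sub>R x) = c \<cdot>\<^sub>m \<rho> x)"

definition irreducible_Cl0_representation :: "nat \<Rightarrow> nat \<Rightarrow> (clifford \<Rightarrow> real mat) \<Rightarrow> bool" where
  "irreducible_Cl0_representation r n \<rho> \<longleftrightarrow>
    Cl0_representation r n \<rho> \<and> 0 < n \<and>
    (\<forall>W. VectorSpace.subspace class_ring W (module_vec TYPE(real) n) \<and>
         (\<forall>x\<in>Cl0 r. \<forall>w\<in>W. \<rho> x *\<^sub>v w \<in> W)
      \<longrightarrow> W = {0\<^sub>v n} \<or> W = carrier_vec n)"

text \<open>Only meaningful for \<open>r\<close> a positive multiple of 4.\<close>

definition half_spin_dim :: "nat \<Rightarrow> nat" where
  "half_spin_dim r = (if r mod 8 = 4 then 2 ^ (r div 2) else 2 ^ (r div 2 - 1))"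

text \<open>
  \<open>half_spin_representation r s \<rho>\<close>, for \<open>s = 1\<close> or \<open>s = -1\<close>: the matrices \<open>\<rho> x\<close> describe the
  irreducible representation of \<open>Cl0 r\<close> on which \<open>e 1 * \<dots> * e r\<close> acts as \<open>s\<close> times the identity,
  in coordinates with respect to an orthonormal basis for an inner product that makes all
  \<open>e i * e j\<close> with \<open>i < j\<close> antisymmetric.
\<close>

definition half_spin_representation :: "nat \<Rightarrow> real \<Rightarrow> (clifford \<Rightarrow> real mat) \<Rightarrow> bool" where
  "half_spin_representation r s \<rho> \<longleftrightarrow>
    irreducible_Cl0_representation r (half_spin_dim r) \<rho> \<and>
    \<rho> (cliff_volume r) = s \<cdot>\<^sub>m 1\<^sub>m (half_spin_dim r) \<and>
    (\<forall>i j. 1 \<le> i \<and> i < j \<and> j \<le> r \<longrightarrow>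
      transpose_mat (\<rho> (cliff_e i * cliff_e j)) = - \<rho> (cliff_e i * cliff_e j))"

text \<open>
  The Kronecker product: the matrix of \<open>A \<otimes> B\<close> in the lexicographically ordered tensor product
  basis.
\<close>

definition kronecker :: "real mat \<Rightarrow> real mat \<Rightarrow> real mat" where
  "kronecker A B = mat (dim_row A * dim_row B) (dim_col A * dim_col B)
    (\<lambda>(i, j). A $$ (i div dim_row B, j div dim_col B) * B $$ (i mod dim_row B, j mod dim_col B))"

definition spin_hat ::
    "nat \<Rightarrow> nat \<Rightarrow> nat \<Rightarrow> (clifford \<Rightarrow> real mat) \<Rightarrow> (clifford \<Rightarrow> real mat) \<Rightarrow> real mat set" where
  "spin_hat r m1 m2 \<rho>p \<rho>m =
    (\<lambda>A. four_block_mat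
      (kronecker (\<rho>p A) (1\<^sub>m m1)) (0\<^sub>m (half_spin_dim r * m1) (half_spin_dim r * m2))
      (0\<^sub>m (half_spin_dim r * m2) (half_spin_dim r * m1)) (kronecker (\<rho>m A) (1\<^sub>m m2))) ` spin r"


section \<open>Quaternions\<close>

text \<open>\<open>Quat a b c d\<close> stands for \<open>a + b i + c j + d k\<close>.\<close>

datatype quaternion = Quat (qre: real) (qi: real) (qj: real) (qk: real)

instantiation quaternion :: real_algebra_1
begin

definition zero_quaternion where "0 = Quat 0 0 0 0"
definition one_quaternion where "1 = Quat 1 0 0 0"
definition plus_quaternion where
  "x + y = Quat (qre x + qre y) (qi x + qi y) (qj x + qj y) (qk x + qk y)"
definition minus_quaternion where
  "x - y = Quat (qre x - qre y) (qi x - qi y) (qj x - qj y) (qk x - qk y)"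
definition uminus_quaternion where
  "- x = Quat (- qre x) (- qi x) (- qj x) (- qk x)"
definition scaleR_quaternion where
  "c *\<^sub>R x = Quat (c * qre x) (c * qi x) (c * qj x) (c * qk x)"
definition times_quaternion where
  "x * y = Quat
    (qre x * qre y - qi x * qi y - qj x * qj y - qk x * qk y)
    (qre x * qi y + qi x * qre y + qj x * qk y - qk x * qj y)
    (qre x * qj y - qi x * qk y + qj x * qre y + qk x * qi y)
    (qre x * qk y + qi x * qj y - qj x * qi y + qk x * qre y)"

instance
  by standard
    (simp_all add: zero_quaternion_def one_quaternion_def plus_quaternion_def minus_quaternion_def
      uminus_quaternion_def scaleR_quaternion_def times_quaternion_def algebra_simps)

end

definition qcnj :: "quaternion \<Rightarrow> quaternion" where
  "qcnj x = Quat (qre x) (- qi x) (- qj x) (- qk x)"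


section \<open>Real Lie algebras\<close>

record 'a lie_algebra = "'a partial_object" +
  lie_zero :: 'a
  lie_add :: "'a \<Rightarrow> 'a \<Rightarrow> 'a"
  lie_scale :: "real \<Rightarrow> 'a \<Rightarrow> 'a"
  lie_bracket :: "'a \<Rightarrow> 'a \<Rightarrow> 'a"

definition lie_isomorphic :: "'a lie_algebra \<Rightarrow> 'b lie_algebra \<Rightarrow> bool" where
  "lie_isomorphic L M \<longleftrightarrow> (\<exists>f. bij_betw f (carrier L) (carrier M) \<and>
    (\<forall>x\<in>carrier L. \<forall>y\<in>carrier L. f (lie_add L x y) = lie_add M (f x) (f y)) \<and>
    (\<forall>c. \<forall>x\<in>carrier L. f (lie_scale L c x) = lie_scale M c (f x)) \<and>
    (\<forall>x\<in>carrier L. \<forall>y\<in>carrier L. f (lie_bracket L x y) = lie_bracket M (f x) (f y)))"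

definition lie_direct_sum :: "'a lie_algebra \<Rightarrow> 'b lie_algebra \<Rightarrow> ('a \<times> 'b) lie_algebra" where
  "lie_direct_sum L M = \<lparr>
    carrier = carrier L \<times> carrier M,
    lie_zero = (lie_zero L, lie_zero M),
    lie_add = (\<lambda>(x, y) (x', y'). (lie_add L x x', lie_add M y y')),
    lie_scale = (\<lambda>c (x, y). (lie_scale L c x, lie_scale M c y)),
    lie_bracket = (\<lambda>(x, y) (x', y'). (lie_bracket L x x', lie_bracket M y y'))\<rparr>"

definition lie_centralizer :: "'a lie_algebra \<Rightarrow> 'a set \<Rightarrow> 'a lie_algebra" where
  "lie_centralizer L K =
    L\<lparr>carrier := {X \<in> carrier L. \<forall>Y\<in>K. lie_bracket L X Y = lie_zero L}\<rparr>"

definition matrix_lie_algebra :: "nat \<Rightarrow> 'a :: real_algebra_1 mat set \<Rightarrow> 'a mat lie_algebra" where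
  "matrix_lie_algebra n S = \<lparr>
    carrier = S,
    lie_zero = 0\<^sub>m n n,
    lie_add = (+),
    lie_scale = (\<lambda>c. map_mat (scaleR c)),
    lie_bracket = (\<lambda>A B. A * B - B * A)\<rparr>"

definition so_lie :: "nat \<Rightarrow> real mat lie_algebra" where
  "so_lie m = matrix_lie_algebra m {A \<in> carrier_mat m m. transpose_mat A = - A}"

definition sp_lie :: "nat \<Rightarrow> quaternion mat lie_algebra" where
  "sp_lie m = matrix_lie_algebra m {A \<in> carrier_mat m m. map_mat qcnj (transpose_mat A) = - A}"

lemma kronecker_one_antisym:
  assumes A: "A \<in> carrier_mat n n" "transpose_mat A = - A"
  shows "kronecker A (1\<^sub>m m) \<in> carrier_mat (n * m) (n * m)"
    "transpose_mat (kronecker A (1\<^sub>m m)) = - kronecker A (1\<^sub>m m)"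
proof -
  show "kronecker A (1\<^sub>m m) \<in> carrier_mat (n * m) (n * m)"
    using A by (simp add: kronecker_def)
  have *: "A $$ (j, i) = - A $$ (i, j)" if "i < n" "j < n" for i j
  proof -
    have "transpose_mat A $$ (i, j) = (- A) $$ (i, j)" by (simp only: A(2))
    then show ?thesis using that A(1) by (subst (asm) index_transpose_mat(1)) auto
  qed
  show "transpose_mat (kronecker A (1\<^sub>m m)) = - kronecker A (1\<^sub>m m)"
  proof (rule eq_matI)
    fix i j assume "i < dim_row (- kronecker A (1\<^sub>m m))" "j < dim_col (- kronecker A (1\<^sub>m m))"
    then have ij: "i < n * m" "j < n * m" using A by (auto simp: kronecker_def)
    then have "0 < m" by (cases m) auto
    then have "i mod m < m" "j mod m < m" "i div m < n" "j div m < n"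
      using ij by (auto simp: less_mult_imp_div_less)
    then show "transpose_mat (kronecker A (1\<^sub>m m)) $$ (i, j) = (- kronecker A (1\<^sub>m m)) $$ (i, j)"
      using A ij *[of "i div m" "j div m"] by (auto simp: kronecker_def)
  qed (use A in \<open>auto simp: kronecker_def\<close>)
qed

lemma half_spin_antisym:
  assumes "half_spin_representation r s \<rho>" "A \<in> spin r"
  shows "\<rho> A \<in> carrier_mat (half_spin_dim r) (half_spin_dim r) \<and> transpose_mat (\<rho> A) = - \<rho> A"
proof -
  let ?n = "half_spin_dim r"
  have rep: "Cl0_representation r ?n \<rho>"
    and anti: "\<And>i j. 1 \<le> i \<Longrightarrow> i < j \<Longrightarrow> j \<le> r \<Longrightarrow>
      transpose_mat (\<rho> (cliff_e i * cliff_e j)) = - \<rho> (cliff_e i * cliff_e j)"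
    using assms by (auto simp: half_spin_representation_def irreducible_Cl0_representation_def)
  have car: "\<And>x. x \<in> Cl0 r \<Longrightarrow> \<rho> x \<in> carrier_mat ?n ?n"
    and add: "\<And>x y. x \<in> Cl0 r \<Longrightarrow> y \<in> Cl0 r \<Longrightarrow> \<rho> (x + y) = \<rho> x + \<rho> y"
    and scale: "\<And>x c. x \<in> Cl0 r \<Longrightarrow> \<rho> (c *\<^sub>R x) = c \<cdot>\<^sub>m \<rho> x"
    using rep by (auto simp: Cl0_representation_def)
  have 0: "0 \<in> Cl0 r" unfolding Cl0_def by (rule span_zero)
  have "transpose_mat (\<rho> A) = - \<rho> A \<and> A \<in> Cl0 r"
    using assms(2) unfolding spin_def
  proof (induction rule: span_induct_alt)
    case base
    have "0 \<cdot>\<^sub>m \<rho> 0 = 0\<^sub>m ?n ?n" using car[OF 0] by (intro eq_matI) auto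
    then have z: "\<rho> 0 = 0\<^sub>m ?n ?n" using scale[OF 0, of 0] by (simp only: scaleR_zero_left)
    have "transpose_mat (\<rho> 0) = - \<rho> 0" unfolding z by (intro eq_matI) auto
    with 0 show ?case by simp
  next
    case (step c x y)
    have "x \<in> spin r" unfolding spin_def using step(1) by (rule span_base)
    then have x: "x \<in> Cl0 r" using spin_subset_Cl0 by auto
    have y: "y \<in> Cl0 r" using step(2) by simp
    have xs: "c *\<^sub>R x \<in> Cl0 r" using x unfolding Cl0_def by (rule span_scale)
    have "transpose_mat (\<rho> x) = - \<rho> x" using step anti by auto
    have *: "- (M + N) = - M + - N" if "M \<in> carrier_mat ?n ?n" "N \<in> carrier_mat ?n ?n"
      for M N :: "real mat" using that by (intro eq_matI) auto
    have **: "transpose_mat (c \<cdot>\<^sub>m \<rho> x) = - (c \<cdot>\<^sub>m \<rho> x)"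
    proof -
      have "transpose_mat (c \<cdot>\<^sub>m \<rho> x) = c \<cdot>\<^sub>m transpose_mat (\<rho> x)" by (intro eq_matI) auto
      also have "\<dots> = - (c \<cdot>\<^sub>m \<rho> x)"
        unfolding \<open>transpose_mat (\<rho> x) = - \<rho> x\<close> by (intro eq_matI) auto
      finally show ?thesis .
    qed
    have "transpose_mat (\<rho> (c *\<^sub>R x + y)) = - \<rho> (c *\<^sub>R x + y)"
      unfolding add[OF xs y] scale[OF x]
      using car[OF x] car[OF y] step(2) ** by (simp add: transpose_add[of _ ?n ?n] *)
    moreover have "c *\<^sub>R x + y \<in> Cl0 r" using xs y unfolding Cl0_def by (rule span_add)
    ultimately show ?case by simp
  qed
  with car assms(2) spin_subset_Cl0 show ?thesis by auto
qed

lemma spin_hat_subset_so: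
  assumes "half_spin_representation r 1 \<rho>p" "half_spin_representation r (-1) \<rho>m"
  shows "spin_hat r m1 m2 \<rho>p \<rho>m \<subseteq> carrier (so_lie (half_spin_dim r * m1 + half_spin_dim r * m2))"
proof
  fix X assume "X \<in> spin_hat r m1 m2 \<rho>p \<rho>m"
  then obtain A where A: "A \<in> spin r"
    and X: "X = four_block_mat
      (kronecker (\<rho>p A) (1\<^sub>m m1)) (0\<^sub>m (half_spin_dim r * m1) (half_spin_dim r * m2))
      (0\<^sub>m (half_spin_dim r * m2) (half_spin_dim r * m1)) (kronecker (\<rho>m A) (1\<^sub>m m2))"
    by (auto simp: spin_hat_def)
  note p = kronecker_one_antisym[of "\<rho>p A" "half_spin_dim r" m1]
  note m = kronecker_one_antisym[of "\<rho>m A" "half_spin_dim r" m2]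
  note h = half_spin_antisym[OF assms(1) A] half_spin_antisym[OF assms(2) A]
  have "transpose_mat X = - X"
    unfolding X using p m h
    by (subst transpose_four_block_mat) (auto intro!: eq_matI)
  moreover have "X \<in> carrier_mat (half_spin_dim r * m1 + half_spin_dim r * m2)
      (half_spin_dim r * m1 + half_spin_dim r * m2)"
    unfolding X using p m h by (intro four_block_carrier_mat) auto
  ultimately show "X \<in> carrier (so_lie (half_spin_dim r * m1 + half_spin_dim r * m2))"
    by (simp add: so_lie_def matrix_lie_algebra_def)
qed

end

theory Submission
  imports Defs "Jordan_Normal_Form.Spectral_Radius"
begin

text \<open>
  Cut an endomorphism commuting with the spin action into \<open>d \<times> d\<close> slices. The off-diagonal slices
  intertwine two representations on which the volume element acts by different signs, so they vanish;
  the diagonal ones lie in the commutant \<open>D\<close> of a half-spin representation. By irreducibility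
  a symmetric element of \<open>D\<close> is scalar (its real eigenspaces are invariant), and Frobenius' argument
  leaves for \<open>D\<close> only \<open>\<real>\<close>, \<open>\<complex>\<close> or the quaternions, with transposition as conjugation. The cases are
  separated by a trace: averaging over the \<open>2 ^ (r - 1)\<close> even monomials \<open>e\<^sub>S\<close> projects the matrices onto \<open>D\<close>,
  and since only \<open>1\<close> and the volume element have non-zero trace, the dimension of \<open>D\<close> is
  \<open>2 d\<^sup>2 / 2 ^ (r - 1)\<close>, that is 1 for \<open>8 dvd r\<close> and 4 for \<open>r mod 8 = 4\<close>.
\<close>

section \<open>Representations of the even Clifford algebra\<close>

text \<open>Nothing assumed about the given representations names the type of their commutant, so
  the type has to be extracted from the number \<open>half_spin_dim r\<close>. The trace serves
  because the trace of a projection is the dimension of its range, and because conjugation by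
  \<open>e_S\<close>, as a linear map on matrices, has trace \<open>tr(e_S)^2\<close>. That vanishes
  as soon as there are \<open>i \<in> S\<close> and \<open>j \<notin> S\<close>: then
  \<open>e_i e_j\<close> anticommutes with \<open>e_S\<close>. The two monomials left contribute the
  square of the dimension each, whence the factor 2. The complex type would give
  \<open>2 * 2 ^ r = 4 * n^2\<close>, which fails in both residue classes.

  The inner product enters twice. It makes \<open>D\<close> stable under transposition, with
  \<open>X^T X\<close> a positive scalar for every nonzero \<open>X\<close>; and it turns
  antisymmetry of a large real matrix into the skew-Hermitian condition over \<open>D\<close>, which
  is how so(m) and sp(m) arise.\<close>

lemma cliff_e_sq: "cliff_e i * cliff_e i = - 1"
  by (simp add: cliff_e_def cliff_monom_mult cliff_sign_def one_clifford_def)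

lemma cliff_e_anticommute: "i \<noteq> j \<Longrightarrow> cliff_e j * cliff_e i = - (cliff_e i * cliff_e j)"
  using clifford_relation[of j i] by (simp add: eq_neg_iff_add_eq_0)

lemma Cl0_word: "set w \<subseteq> {1..r} \<Longrightarrow> even (length w) \<Longrightarrow> prod_list (map cliff_e w) \<in> Cl0 r"
  unfolding Cl0_def by (rule span_base) auto

lemma Cl0_pair: "1 \<le> i \<Longrightarrow> i \<le> r \<Longrightarrow> 1 \<le> j \<Longrightarrow> j \<le> r \<Longrightarrow> cliff_e i * cliff_e j \<in> Cl0 r"
  using Cl0_word[of "[i, j]" r] by simp

lemma Cl0_one: "1 \<in> Cl0 r"
  using Cl0_word[of "[]" r] by simp

lemma Cl0_monom:
  assumes "S \<subseteq> {1..r}" "even (card S)"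
  shows "cliff_monom S \<in> Cl0 r"
proof -
  have "finite S" using assms(1) finite_subset by auto
  then show ?thesis using assms Cl0_word[of "sorted_list_of_set S" r] by (simp add: cliff_monom_eq_prod_list)
qed

lemma spin_pair: "1 \<le> i \<Longrightarrow> i < j \<Longrightarrow> j \<le> r \<Longrightarrow> cliff_e i * cliff_e j \<in> spin r"
  unfolding spin_def by (rule span_base) auto

lemma cliff_volume_eq_monom: "cliff_volume r = cliff_monom {1..r}"
proof -
  have "sorted_list_of_set {1..<r+1} = [1..<r+1]" by (rule sorted_list_of_set_range)
  moreover have "{1..<r+1} = {1..r}" by auto
  ultimately show ?thesis by (simp only: cliff_volume_def cliff_monom_eq_prod_list finite_atLeastAtMost)
qed

text \<open>Two letters are split off at a time, so every intermediate word is even and lies in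
  \<open>Cl0 r\<close>; a representation is constrained nowhere else.\<close>

lemma Cl0_word_induct [consumes 2, case_names Nil Cons]:
  assumes "set w \<subseteq> {1..r}" "even (length w)"
    and "P 1"
    and "\<And>i j w. 1 \<le> i \<Longrightarrow> i \<le> r \<Longrightarrow> 1 \<le> j \<Longrightarrow> j \<le> r \<Longrightarrow> set w \<subseteq> {1..r} \<Longrightarrow> even (length w) \<Longrightarrow>
      P (prod_list (map cliff_e w)) \<Longrightarrow> P ((cliff_e i * cliff_e j) * prod_list (map cliff_e w))"
  shows "P (prod_list (map cliff_e w))"
  using assms(1,2)
proof (induction w rule: induct_list012)
  case (3 i j w)
  then have "P ((cliff_e i * cliff_e j) * prod_list (map cliff_e w))"
    by (intro assms(4)) auto
  then show ?case by (simp add: mult.assoc)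
qed (use assms(3) in auto)

locale Cl0_rep =
  fixes r n :: nat and \<rho> :: "clifford \<Rightarrow> real mat"
  assumes rep: "Cl0_representation r n \<rho>"
begin

lemma rho_carrier: "x \<in> Cl0 r \<Longrightarrow> \<rho> x \<in> carrier_mat n n"
  and rho_one [simp]: "\<rho> 1 = 1\<^sub>m n"
  and rho_add: "x \<in> Cl0 r \<Longrightarrow> y \<in> Cl0 r \<Longrightarrow> \<rho> (x + y) = \<rho> x + \<rho> y"
  and rho_mult: "x \<in> Cl0 r \<Longrightarrow> y \<in> Cl0 r \<Longrightarrow> \<rho> (x * y) = \<rho> x * \<rho> y"
  and rho_scale: "x \<in> Cl0 r \<Longrightarrow> \<rho> (c *\<^sub>R x) = c \<cdot>\<^sub>m \<rho> x"
  using rep by (auto simp: Cl0_representation_def)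

lemma rho_minus: "x \<in> Cl0 r \<Longrightarrow> \<rho> (- x) = (- 1) \<cdot>\<^sub>m \<rho> x"
  using rho_scale[of x "-1"] by simp

lemma rho_zero: "\<rho> 0 = 0\<^sub>m n n"
  using rho_scale[OF Cl0_one, of 0] by (auto intro!: eq_matI)

end

text \<open>An even word is a product of pairs \<open>e i * e j\<close>, and up to sign a pair is 1 or has \<open>i < j\<close>.\<close>

lemma intertwiner_Cl0:
  assumes \<rho>: "Cl0_rep r n \<rho>" and \<sigma>: "Cl0_rep r n \<sigma>" and X: "X \<in> carrier_mat n n"
    and pair: "\<And>i j. 1 \<le> i \<Longrightarrow> i < j \<Longrightarrow> j \<le> r \<Longrightarrow>
      X * \<rho> (cliff_e i * cliff_e j) = \<sigma> (cliff_e i * cliff_e j) * X"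
    and x: "x \<in> Cl0 r"
  shows "X * \<rho> x = \<sigma> x * X"
proof -
  interpret R: Cl0_rep r n \<rho> by fact
  interpret S: Cl0_rep r n \<sigma> by fact
  have neg: "X * \<rho> (- y) = \<sigma> (- y) * X" if "X * \<rho> y = \<sigma> y * X" "y \<in> Cl0 r" for y
    using that X R.rho_carrier[of y] S.rho_carrier[of y]
    by (simp add: R.rho_minus S.rho_minus mult_smult_distrib[of _ n n _ n] mult_smult_assoc_mat[of _ n n _ n])
  have all: "X * \<rho> (cliff_e i * cliff_e j) = \<sigma> (cliff_e i * cliff_e j) * X"
    if ij: "1 \<le> i" "i \<le> r" "1 \<le> j" "j \<le> r" for i j
  proof (cases i j rule: linorder_cases)
    case less then show ?thesis using pair that by simp
  next
    case equal
    then show ?thesis using neg[OF _ Cl0_one] X by (simp add: cliff_e_sq)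
  next
    case greater
    then show ?thesis
      using neg[OF pair[of j i] Cl0_pair[of j r i]] that by (simp add: cliff_e_anticommute[of j i])
  qed
  have word: "X * \<rho> (prod_list (map cliff_e w)) = \<sigma> (prod_list (map cliff_e w)) * X"
    if "set w \<subseteq> {1..r}" "even (length w)" for w
    using that
  proof (induction rule: Cl0_word_induct)
    case Nil then show ?case using X by simp
  next
    case (Cons i j w)
    note p = Cl0_pair[of i r j] Cl0_word[OF Cons(5,6)]
    let ?u = "cliff_e i * cliff_e j" and ?w = "prod_list (map cliff_e w)"
    have u: "?u \<in> Cl0 r" and w: "?w \<in> Cl0 r" using p Cons by auto
    note [simp] = assoc_mult_mat[of _ n n _ n _ n]
    note c = X R.rho_carrier[OF u] R.rho_carrier[OF w] S.rho_carrier[OF u] S.rho_carrier[OF w]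
    have "X * \<rho> (?u * ?w) = (X * \<rho> ?u) * \<rho> ?w" using c u w by (simp add: R.rho_mult)
    also have "\<dots> = \<sigma> ?u * (X * \<rho> ?w)"
      using c by (subst all) (use Cons in simp_all)
    also have "\<dots> = \<sigma> (?u * ?w) * X" using c u w Cons.IH by (simp add: S.rho_mult)
    finally show ?case .
  qed
  \<comment> \<open>Membership is carried through the induction because \<open>\<rho>\<close> and
    \<open>\<sigma>\<close> are additive and homogeneous only on \<open>Cl0 r\<close>.\<close>
  have "X * \<rho> x = \<sigma> x * X \<and> x \<in> Cl0 r" using x unfolding Cl0_def
  proof (induction rule: span_induct_alt)
    case base
    then show ?case using X span_zero by (simp add: R.rho_zero S.rho_zero)
  next
    case (step c x y)
    have x: "x \<in> Cl0 r" "c *\<^sub>R x \<in> Cl0 r" and y: "y \<in> Cl0 r"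
      using step unfolding Cl0_def by (auto intro: span_base span_scale)
    have "X * \<rho> x = \<sigma> x * X" using step word by auto
    then have "X * \<rho> (c *\<^sub>R x + y) = \<sigma> (c *\<^sub>R x + y) * X"
      using x y X step R.rho_carrier[of x] S.rho_carrier[of x] R.rho_carrier[of y] S.rho_carrier[of y]
      by (simp add: R.rho_add S.rho_add R.rho_scale S.rho_scale mult_add_distrib_mat[of _ n n _ n]
          add_mult_distrib_mat[of _ n n _ _ n] mult_smult_distrib[of _ n n _ n] mult_smult_assoc_mat[of _ n n _ n])
    moreover have "c *\<^sub>R x + y \<in> span {prod_list (map cliff_e w) |w. set w \<subseteq> {1..r} \<and> even (length w)}"
      using x y unfolding Cl0_def by (auto intro: span_add)
    ultimately show ?case by simp
  qed
  then show ?thesis by simp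
qed

section \<open>Signs and number of the even monomials\<close>

lemma card_sym_diff_even:
  assumes "finite S" "finite T"
  shows "even (card (sym_diff S T)) \<longleftrightarrow> even (card S + card T)"
proof -
  have "card (sym_diff S T) = card (S - T) + card (T - S)"
    by (rule card_Un_disjoint) (use assms in auto)
  moreover have "card S = card (S - T) + card (S \<inter> T)" "card T = card (T - S) + card (S \<inter> T)"
    using assms by (auto simp: card_Diff_subset_Int Int_commute card_mono)
  ultimately show ?thesis by presburger
qed

lemma cliff_sign_sq: "finite S \<Longrightarrow> finite T \<Longrightarrow> cliff_sign S T * cliff_sign S T = 1"
  unfolding cliff_sign_def by (simp add: prod.distrib[symmetric])

text \<open>Moving a single \<open>e_a\<close> past \<open>e_S\<close> collects a factor -1 for each
  \<open>k \<in> S\<close> other than \<open>a\<close>. As \<open>card S\<close> is even, the total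
  is -1 if \<open>a \<in> S\<close> and 1 otherwise, so exactly one member of the pair contributes a
  sign. This anticommutation kills the traces in \<open>trace_mon\<close>.\<close>

lemma cliff_sign_swap:
  assumes "finite S" "i \<in> S" "j \<notin> S" "even (card S)"
  shows "cliff_sign {i, j} S = - cliff_sign S {i, j}"
proof -
  have ij: "i \<noteq> j" using assms by auto
  have *: "(\<Prod>k\<in>S. if k \<le> a then - 1 else 1) * (\<Prod>k\<in>S. if a \<le> k then - 1 else 1)
    = (if a \<in> S then - 1 else 1 :: real)" for a :: nat
  proof -
    have "(\<Prod>k\<in>S. if k \<le> a then - 1 else 1) * (\<Prod>k\<in>S. if a \<le> k then - 1 else 1)
      = (\<Prod>k\<in>S. if k = a then 1 else - 1 :: real)"
      unfolding prod.distrib[symmetric] by (rule prod.cong) auto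
    \<comment> \<open>Pulling -1 out of every factor leaves \<open>(- 1) ^ card S = 1\<close> times
      a product in which only \<open>k = a\<close> counts.\<close>
    also have "\<dots> = (\<Prod>k\<in>S. - 1 * (if k = a then - 1 else 1 :: real))"
      by (rule prod.cong) auto
    also have "\<dots> = (if a \<in> S then - 1 else 1)"
      unfolding prod.distrib using assms by (simp add: prod.delta)
    finally show ?thesis .
  qed
  have "cliff_sign {i, j} S * cliff_sign S {i, j} = - 1"
    using *[of i] *[of j] assms(2,3) ij
    by (simp add: cliff_sign_def prod.distrib mult_ac)
  moreover have "cliff_sign S {i, j} * cliff_sign S {i, j} = 1" using assms by (simp add: cliff_sign_sq)
  ultimately show ?thesis by (smt (verit) mult.assoc mult_cancel_left2 mult_minus_left mult.right_neutral)
qed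

text \<open>A group under symmetric difference: the even monomials multiplied up to sign. The
  average runs over it.\<close>

definition even_subsets :: "nat \<Rightarrow> nat set set" where
  "even_subsets r = {S. S \<subseteq> {1..r} \<and> even (card S)}"

lemma finite_even_subsets [simp]: "finite (even_subsets r)"
  unfolding even_subsets_def by simp

lemma even_subsetsD: "S \<in> even_subsets r \<Longrightarrow> finite S \<and> S \<subseteq> {1..r} \<and> even (card S)"
  unfolding even_subsets_def using finite_subset by auto

lemma even_subsets_sym_diff:
  assumes "S \<in> even_subsets r" "T \<in> even_subsets r"
  shows "sym_diff S T \<in> even_subsets r"
  using even_subsetsD[OF assms(1)] even_subsetsD[OF assms(2)] card_sym_diff_even[of S T]
  by (auto simp: even_subsets_def)

lemma bij_even_subsets:
  assumes "T \<in> even_subsets r"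
  shows "bij_betw (sym_diff T) (even_subsets r) (even_subsets r)"
  by (rule bij_betw_byWitness[where f' = "sym_diff T"])
    (use even_subsets_sym_diff[OF assms] in blast)+

text \<open>Toggling the element 1 exchanges the even and the odd subsets, so each kind makes up
  half of the power set.\<close>

lemma card_even_subsets:
  assumes "1 \<le> r"
  shows "card (even_subsets r) = 2 ^ (r - 1)"
proof -
  let ?O = "{S. S \<subseteq> {1..r} \<and> odd (card S)}"
  have fin: "finite S" if "S \<subseteq> {1..r}" for S using that finite_subset by auto
  have "bij_betw (sym_diff {1}) (even_subsets r) ?O"
  proof (rule bij_betw_byWitness[where f' = "sym_diff {1}"])
    have "sym_diff {1} S \<subseteq> {1..r}" if "S \<subseteq> {1..r}" for S using that assms by auto
    moreover have "odd (card (sym_diff {1} S)) = even (card S)" if "S \<subseteq> {1..r}" for S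
      using fin[OF that] card_sym_diff_even[of "{1}" S] by simp
    ultimately show "sym_diff {1} ` even_subsets r \<subseteq> ?O" "sym_diff {1} ` ?O \<subseteq> even_subsets r"
      unfolding even_subsets_def by blast+
  qed simp_all
  then have "card (even_subsets r) = card ?O" by (rule bij_betw_same_card)
  moreover have "card (even_subsets r) + card ?O = card (even_subsets r \<union> ?O)"
    by (rule card_Un_disjoint[symmetric]) (auto simp: even_subsets_def)
  moreover have "even_subsets r \<union> ?O = Pow {1..r}" by (auto simp: even_subsets_def)
  ultimately have "2 * card (even_subsets r) = 2 ^ r" by (simp add: card_Pow)
  then show ?thesis using assms by (cases r) auto
qed

section \<open>Real matrix algebras closed under transposition\<close>

text \<open>The Frobenius inner product \<open>tr(A^T B)\<close>; pairing with the identity gives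
  the trace.\<close>

definition mat_inner :: "real mat \<Rightarrow> real mat \<Rightarrow> real" where
  "mat_inner A B = (\<Sum>i<dim_row A. \<Sum>j<dim_col A. A $$ (i, j) * B $$ (i, j))"

lemma mat_inner_mult_left:
  assumes "A \<in> carrier_mat n k" "X \<in> carrier_mat k m" "Y \<in> carrier_mat n m"
  shows "mat_inner (A * X) Y = mat_inner X (transpose_mat A * Y)"
proof -
  have "mat_inner (A * X) Y = (\<Sum>i<n. \<Sum>j<m. \<Sum>l<k. A $$ (i, l) * X $$ (l, j) * Y $$ (i, j))"
    using assms by (simp add: mat_inner_def scalar_prod_def sum_distrib_right atLeast0LessThan)
  also have "\<dots> = (\<Sum>i<n. \<Sum>l<k. \<Sum>j<m. A $$ (i, l) * X $$ (l, j) * Y $$ (i, j))"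
    by (intro sum.cong refl sum.swap)
  also have "\<dots> = (\<Sum>l<k. \<Sum>i<n. \<Sum>j<m. A $$ (i, l) * X $$ (l, j) * Y $$ (i, j))"
    by (rule sum.swap)
  also have "\<dots> = (\<Sum>l<k. \<Sum>j<m. \<Sum>i<n. A $$ (i, l) * X $$ (l, j) * Y $$ (i, j))"
    by (intro sum.cong refl sum.swap)
  also have "\<dots> = mat_inner X (transpose_mat A * Y)"
    using assms by (simp add: mat_inner_def scalar_prod_def sum_distrib_left mult_ac atLeast0LessThan)
  finally show ?thesis .
qed

lemma mat_inner_transpose:
  assumes "A \<in> carrier_mat n m" "B \<in> carrier_mat n m"
  shows "mat_inner (transpose_mat A) (transpose_mat B) = mat_inner A B"
proof -
  have "mat_inner (transpose_mat A) (transpose_mat B) = (\<Sum>j<m. \<Sum>i<n. A $$ (i, j) * B $$ (i, j))"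
    using assms by (simp add: mat_inner_def)
  also have "\<dots> = (\<Sum>i<n. \<Sum>j<m. A $$ (i, j) * B $$ (i, j))" by (rule sum.swap)
  finally show ?thesis using assms by (simp add: mat_inner_def)
qed

text \<open>Transposing both arguments exchanges left and right multiplication, so the adjoint is
  computed only once, in \<open>mat_inner_mult_left\<close>.\<close>

lemma mat_inner_mult_right:
  assumes "X \<in> carrier_mat n k" "B \<in> carrier_mat k m" "Y \<in> carrier_mat n m"
  shows "mat_inner (X * B) Y = mat_inner X (Y * transpose_mat B)"
proof -
  have "mat_inner (X * B) Y = mat_inner (transpose_mat (X * B)) (transpose_mat Y)"
    using assms by (intro mat_inner_transpose[symmetric, of _ n m]) auto
  also have "\<dots> = mat_inner (transpose_mat B * transpose_mat X) (transpose_mat Y)"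
    using assms by (simp add: transpose_mult)
  also have "\<dots> = mat_inner (transpose_mat X) (B * transpose_mat Y)"
    using assms by (subst mat_inner_mult_left[of _ m k _ n]) auto
  also have "B * transpose_mat Y = transpose_mat (Y * transpose_mat B)"
    using assms by (subst transpose_mult[of _ n m _ k]) auto
  also have "mat_inner (transpose_mat X) (transpose_mat (Y * transpose_mat B)) = mat_inner X (Y * transpose_mat B)"
    using assms by (intro mat_inner_transpose[of _ n k]) auto
  finally show ?thesis .
qed

lemma mat_inner_commute:
  "A \<in> carrier_mat n m \<Longrightarrow> B \<in> carrier_mat n m \<Longrightarrow> mat_inner A B = mat_inner B A"
  by (simp add: mat_inner_def mult.commute)

lemma mat_inner_smult_left:
  "A \<in> carrier_mat n m \<Longrightarrow> mat_inner (c \<cdot>\<^sub>m A) B = c * mat_inner A B"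
  by (simp add: mat_inner_def sum_distrib_left mult.assoc)

lemma mat_inner_smult_right:
  "A \<in> carrier_mat n m \<Longrightarrow> B \<in> carrier_mat n m \<Longrightarrow> mat_inner A (c \<cdot>\<^sub>m B) = c * mat_inner A B"
  by (simp add: mat_inner_def sum_distrib_left mult_ac)

lemma mat_inner_self_pos:
  assumes "A \<in> carrier_mat n m" "A \<noteq> 0\<^sub>m n m"
  shows "0 < mat_inner A A"
proof -
  obtain i j where ij: "i < n" "j < m" "A $$ (i, j) \<noteq> 0"
    using assms by (metis carrier_matD eq_matI index_zero_mat)
  have "0 < (\<Sum>j<m. A $$ (i, j) * A $$ (i, j))"
    by (rule sum_pos2[of _ j]) (use ij in \<open>auto simp: zero_less_mult_iff linorder_neq_iff\<close>)
  then have "0 < (\<Sum>i<n. \<Sum>j<m. A $$ (i, j) * A $$ (i, j))"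
    by (rule sum_pos2[of _ i, rotated 2]) (use ij in \<open>auto intro: sum_nonneg\<close>)
  then show ?thesis using assms by (simp add: mat_inner_def)
qed

lemma mat_inner_one_self: "mat_inner (1\<^sub>m n) (1\<^sub>m n) = real n"
  by (simp add: mat_inner_def if_distrib cong: if_cong)

text \<open>A complex eigenvector \<open>a + i b\<close> with eigenvalue \<open>z\<close> is split
  into real and imaginary parts. Symmetry of \<open>X\<close> forces \<open>Im z = 0\<close>, so
  whichever of \<open>a\<close>, \<open>b\<close> is nonzero is a real eigenvector.\<close>

lemma symmetric_real_eigenvector:
  fixes X :: "real mat"
  assumes X: "X \<in> carrier_mat n n" and sym: "transpose_mat X = X" and n: "0 < n"
  shows "\<exists>c v. v \<in> carrier_vec n \<and> v \<noteq> 0\<^sub>v n \<and> X *\<^sub>v v = c \<cdot>\<^sub>v v"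
proof -
  let ?Z = "map_mat complex_of_real X"
  have Z: "?Z \<in> carrier_mat n n" using X by simp
  obtain z where "eigenvalue ?Z z"
    using spectrum_non_empty[OF Z n] by (auto simp: spectrum_def)
  then obtain w where w: "w \<in> carrier_vec n" "w \<noteq> 0\<^sub>v n" "?Z *\<^sub>v w = z \<cdot>\<^sub>v w"
    using X by (auto simp: eigenvalue_def eigenvector_def)
  define a b where "a = map_vec Re w" and "b = map_vec Im w"
  have ab: "a \<in> carrier_vec n" "b \<in> carrier_vec n" using w by (auto simp: a_def b_def)
  have eq: "(\<Sum>j<n. complex_of_real (X $$ (i, j)) * w $ j) = z * w $ i" if "i < n" for i
    using arg_cong[OF w(3), of "\<lambda>v. v $ i"] that w(1) X
    by (simp add: scalar_prod_def atLeast0LessThan)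
  have re: "X *\<^sub>v a = Re z \<cdot>\<^sub>v a - Im z \<cdot>\<^sub>v b"
  proof (rule eq_vecI)
    fix i assume "i < dim_vec (Re z \<cdot>\<^sub>v a - Im z \<cdot>\<^sub>v b)"
    then have i: "i < n" using ab by simp
    show "(X *\<^sub>v a) $ i = (Re z \<cdot>\<^sub>v a - Im z \<cdot>\<^sub>v b) $ i"
      using arg_cong[OF eq[OF i], of Re] i X w ab
      by (simp add: scalar_prod_def atLeast0LessThan a_def b_def)
  qed (use X ab in simp)
  have im: "X *\<^sub>v b = Re z \<cdot>\<^sub>v b + Im z \<cdot>\<^sub>v a"
  proof (rule eq_vecI)
    fix i assume "i < dim_vec (Re z \<cdot>\<^sub>v b + Im z \<cdot>\<^sub>v a)"
    then have i: "i < n" using ab by simp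
    show "(X *\<^sub>v b) $ i = (Re z \<cdot>\<^sub>v b + Im z \<cdot>\<^sub>v a) $ i"
      using arg_cong[OF eq[OF i], of Im] i X w ab
      by (simp add: scalar_prod_def atLeast0LessThan a_def b_def)
  qed (use X ab in simp)
  \<comment> \<open>Beyond the common term \<open>Re z * (a \<bullet> b)\<close>, the two sides are
    \<open>- Im z * (b \<bullet> b)\<close> and \<open>Im z * (a \<bullet> a)\<close>.\<close>
  have "(X *\<^sub>v a) \<bullet> b = a \<bullet> (X *\<^sub>v b)"
    using transpose_vec_mult_scalar[OF X ab(2) ab(1)] sym X ab
    by (metis comm_scalar_prod mult_mat_vec_carrier)
  then have "Im z * (a \<bullet> a + b \<bullet> b) = 0"
    unfolding re im using ab comm_scalar_prod[OF ab]
    by (simp add: minus_scalar_prod_distrib[of _ n] scalar_prod_add_distrib[of _ n] algebra_simps)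
  moreover have "a \<noteq> 0\<^sub>v n \<or> b \<noteq> 0\<^sub>v n"
  proof (rule ccontr)
    assume "\<not> ?thesis"
    then have "w = 0\<^sub>v n"
      using w by (intro eq_vecI) (auto simp: a_def b_def complex_eq_iff dest!: arg_cong[of _ _ "\<lambda>v. v $ _"] simp: vec_eq_iff)
    then show False using w by simp
  qed
  moreover have nn: "0 \<le> x \<bullet> x" "x \<bullet> x = 0 \<Longrightarrow> x = 0\<^sub>v n" if "x \<in> carrier_vec n" for x :: "real vec"
    using that by (auto simp: scalar_prod_def sum_nonneg sum_nonneg_eq_0_iff intro!: eq_vecI)
  ultimately have "Im z = 0"
    using nn(1)[OF ab(1)] nn(1)[OF ab(2)] nn(2)[OF ab(1)] nn(2)[OF ab(2)]
    by (metis add_nonneg_eq_0_iff mult_eq_0_iff)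
  then have "X *\<^sub>v a = Re z \<cdot>\<^sub>v a" "X *\<^sub>v b = Re z \<cdot>\<^sub>v b"
    unfolding re im using ab by (auto intro!: eq_vecI)
  with ab \<open>a \<noteq> 0\<^sub>v n \<or> b \<noteq> 0\<^sub>v n\<close> show ?thesis by blast
qed

text \<open>\<open>symmetric_scalar\<close> stands in for Schur's lemma. Applied to
  \<open>X^T X\<close> it shows that every nonzero element is a positive multiple of an orthogonal
  matrix, so \<open>D\<close> is a division algebra, and Frobenius' classification reduces to
  Gram-Schmidt steps.\<close>

locale real_star_algebra =
  fixes n :: nat and D :: "real mat set"
  assumes dim_pos: "0 < n"
    and D_carrier: "X \<in> D \<Longrightarrow> X \<in> carrier_mat n n"
    and one_D: "1\<^sub>m n \<in> D"
    and add_D: "X \<in> D \<Longrightarrow> Y \<in> D \<Longrightarrow> X + Y \<in> D"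
    and smult_D: "X \<in> D \<Longrightarrow> c \<cdot>\<^sub>m X \<in> D"
    and mult_D: "X \<in> D \<Longrightarrow> Y \<in> D \<Longrightarrow> X * Y \<in> D"
    and transpose_D: "X \<in> D \<Longrightarrow> transpose_mat X \<in> D"
    and symmetric_scalar: "X \<in> D \<Longrightarrow> transpose_mat X = X \<Longrightarrow> \<exists>c. X = c \<cdot>\<^sub>m 1\<^sub>m n"
begin

text \<open>The imaginary elements of \<open>D\<close>, transposition being conjugation.\<close>

definition anti :: "real mat \<Rightarrow> bool" where
  "anti X \<longleftrightarrow> X \<in> D \<and> transpose_mat X = - X"

definition quaternion_units :: "real mat \<Rightarrow> real mat \<Rightarrow> bool" where
  "quaternion_units I J \<longleftrightarrow> anti I \<and> anti J \<and> I * I = - 1\<^sub>m n \<and> J * J = - 1\<^sub>m n \<and> J * I = - (I * J)"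

lemma anti_D: "anti X \<Longrightarrow> X \<in> D"
  and anti_carrier: "anti X \<Longrightarrow> X \<in> carrier_mat n n"
  and anti_transpose: "anti X \<Longrightarrow> transpose_mat X = - X"
  using D_carrier by (auto simp: anti_def)

lemma uminus_D: "X \<in> D \<Longrightarrow> - X \<in> D"
proof -
  assume "X \<in> D"
  moreover have "- X = (- 1) \<cdot>\<^sub>m X" by (auto intro!: eq_matI)
  ultimately show ?thesis using smult_D by metis
qed

lemma anti_smult: "anti X \<Longrightarrow> anti (c \<cdot>\<^sub>m X)"
proof -
  assume X: "anti X"
  have "transpose_mat (c \<cdot>\<^sub>m X) = c \<cdot>\<^sub>m transpose_mat X" by (auto intro!: eq_matI)
  also have "\<dots> = - (c \<cdot>\<^sub>m X)" unfolding anti_transpose[OF X] by (auto intro!: eq_matI)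
  finally show ?thesis using X smult_D by (simp add: anti_def)
qed

lemma anti_add: "anti X \<Longrightarrow> anti Y \<Longrightarrow> anti (X + Y)"
proof -
  assume XY: "anti X" "anti Y"
  note car = anti_carrier[OF XY(1)] anti_carrier[OF XY(2)]
  have "transpose_mat (X + Y) = transpose_mat X + transpose_mat Y"
    using car by (simp add: transpose_add[of _ n n])
  also have "\<dots> = - (X + Y)"
    unfolding anti_transpose[OF XY(1)] anti_transpose[OF XY(2)] using car by (intro eq_matI) auto
  finally show ?thesis using XY add_D by (simp add: anti_def)
qed

text \<open>\<open>X * X\<close> is symmetric, hence a scalar \<open>k\<close>. Its sign follows
  from positivity: \<open>- k * n\<close> is the squared norm of \<open>X\<close>.\<close>

lemma anti_square:
  assumes "anti X" "X \<noteq> 0\<^sub>m n n"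
  shows "\<exists>c. c \<noteq> 0 \<and> (c \<cdot>\<^sub>m X) * (c \<cdot>\<^sub>m X) = - 1\<^sub>m n"
proof -
  note X = anti_carrier[OF assms(1)]
  have "transpose_mat (X * X) = X * X"
    using X anti_transpose[OF assms(1)] by (simp add: transpose_mult[of _ n n _ n])
  then obtain k where k: "X * X = k \<cdot>\<^sub>m 1\<^sub>m n"
    using symmetric_scalar mult_D anti_D[OF assms(1)] by blast
  have "mat_inner X X = mat_inner (X * 1\<^sub>m n) X" using X by simp
  also have "\<dots> = mat_inner (1\<^sub>m n) (transpose_mat X * X)"
    using X by (intro mat_inner_mult_left) auto
  also have "transpose_mat X * X = (- k) \<cdot>\<^sub>m 1\<^sub>m n"
    using X k anti_transpose[OF assms(1)] by (auto intro!: eq_matI)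
  also have "mat_inner (1\<^sub>m n) ((- k) \<cdot>\<^sub>m 1\<^sub>m n) = - k * n"
    by (subst mat_inner_smult_right[of _ n n]) (auto simp: mat_inner_one_self)
  finally have "k < 0"
    using mat_inner_self_pos[OF X assms(2)] dim_pos by (simp add: mult_less_0_iff)
  define c where "c = 1 / sqrt (- k)"
  have "c * c * k = - 1" using \<open>k < 0\<close> by (simp add: c_def)
  moreover have "(c \<cdot>\<^sub>m X) * (c \<cdot>\<^sub>m X) = (c * c * k) \<cdot>\<^sub>m 1\<^sub>m n"
    using X k by (simp add: mult_smult_distrib[of _ n n _ n] mult_smult_assoc_mat[of _ n n _ n]) (auto intro!: eq_matI)
  moreover have "c \<noteq> 0" using \<open>k < 0\<close> by (simp add: c_def)
  ultimately show ?thesis by (intro exI[of _ c]) (auto intro!: eq_matI)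
qed

lemma anti_decomposition:
  assumes "X \<in> D"
  obtains a Y where "anti Y" "X = a \<cdot>\<^sub>m 1\<^sub>m n + Y"
proof -
  note X = D_carrier[OF assms]
  let ?S = "(1/2) \<cdot>\<^sub>m (X + transpose_mat X)" and ?Y = "(1/2) \<cdot>\<^sub>m (X + - transpose_mat X)"
  have "transpose_mat ?S = ?S" using X by (auto intro!: eq_matI)
  then obtain a where a: "?S = a \<cdot>\<^sub>m 1\<^sub>m n"
    using symmetric_scalar smult_D add_D transpose_D assms by meson
  have "transpose_mat ?Y = - ?Y" using X by (auto intro!: eq_matI simp: algebra_simps)
  then have "anti ?Y" unfolding anti_def using smult_D add_D transpose_D uminus_D assms by blast
  moreover have "X = ?S + ?Y" using X by (auto intro!: eq_matI simp: field_simps)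
  ultimately show ?thesis using that unfolding a by blast
qed

lemma anticommutator_scalar:
  assumes "anti X" "anti Y"
  shows "\<exists>c. X * Y + Y * X = c \<cdot>\<^sub>m 1\<^sub>m n"
proof (rule symmetric_scalar)
  show "X * Y + Y * X \<in> D" using assms anti_D add_D mult_D by blast
  show "transpose_mat (X * Y + Y * X) = X * Y + Y * X"
    using anti_carrier[OF assms(1)] anti_carrier[OF assms(2)] anti_transpose[OF assms(1)] anti_transpose[OF assms(2)]
    by (simp add: transpose_add[of _ n n] transpose_mult[of _ n n _ n] comm_add_mat[of _ n n])
qed

text \<open>A Gram-Schmidt step: the anticommutator with \<open>I\<close> is a scalar that measures
  the component along \<open>I\<close>, and the imaginary elements orthogonal to \<open>I\<close>
  are those that anticommute with it.\<close>

lemma anti_project: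
  assumes "anti I" "I * I = - 1\<^sub>m n" "anti Y"
  obtains b Z where "anti Z" "Y = b \<cdot>\<^sub>m I + Z" "Z * I = - (I * Z)"
proof -
  note I = anti_carrier[OF assms(1)] and Y = anti_carrier[OF assms(3)]
  obtain c where c: "I * Y + Y * I = c \<cdot>\<^sub>m 1\<^sub>m n" using anticommutator_scalar[OF assms(1,3)] by blast
  \<comment> \<open>As \<open>I * I = - 1\<close>, adding \<open>(c / 2) I\<close> changes the
    anticommutator with \<open>I\<close> by \<open>- c\<close>.\<close>
  define Z where "Z = Y + (c / 2) \<cdot>\<^sub>m I"
  have Z: "anti Z" unfolding Z_def using anti_add anti_smult assms by blast
  have 1: "Z * I = Y * I + (c / 2) \<cdot>\<^sub>m (- 1\<^sub>m n)" and 2: "I * Z = I * Y + (c / 2) \<cdot>\<^sub>m (- 1\<^sub>m n)"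
    unfolding Z_def using I Y assms(2)
    by (simp_all add: add_mult_distrib_mat[of _ n n _ _ n] mult_add_distrib_mat[of _ n n _ n]
        mult_smult_distrib[of _ n n _ n] mult_smult_assoc_mat[of _ n n _ n])
  have "Z * I = - (I * Z)"
  proof (rule eq_matI)
    fix i j assume ij: "i < dim_row (- (I * Z))" "j < dim_col (- (I * Z))"
    have ij: "i < n" "j < n" using ij I anti_carrier[OF Z] by auto
    have "(I * Y + Y * I) $$ (i, j) = (c \<cdot>\<^sub>m 1\<^sub>m n) $$ (i, j)" by (simp only: c)
    then have "(I * Y) $$ (i, j) + (Y * I) $$ (i, j) = c * 1\<^sub>m n $$ (i, j)"
      using ij I Y by (simp del: index_one_mat(1) index_mult_mat(1))
    then show "(Z * I) $$ (i, j) = (- (I * Z)) $$ (i, j)"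
      unfolding 1 2 using ij I Y by (simp add: field_simps del: index_one_mat(1) index_mult_mat(1))
  qed (use I anti_carrier[OF Z] in auto)
  moreover have "Y = (- c / 2) \<cdot>\<^sub>m I + Z" unfolding Z_def using I Y by (auto intro!: eq_matI)
  ultimately show ?thesis using that Z by blast
qed

text \<open>Once the components along \<open>1\<close>, \<open>I\<close> and \<open>J\<close> are
  removed, the remainder \<open>W\<close> anticommutes with \<open>I\<close> and \<open>J\<close>,
  hence commutes with \<open>K = I J\<close>. A product of commuting antisymmetric matrices is
  symmetric, so \<open>W K\<close> is a scalar and \<open>W\<close> a multiple of \<open>K\<close>:
  there is no room for a further unit.\<close>

lemma quaternion_units_span:
  assumes q: "quaternion_units I J" and X: "X \<in> D"
  shows "\<exists>a b c e. X = a \<cdot>\<^sub>m 1\<^sub>m n + b \<cdot>\<^sub>m I + c \<cdot>\<^sub>m J + e \<cdot>\<^sub>m (I * J)"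
proof -
  have I: "anti I" "I * I = - 1\<^sub>m n" and J: "anti J" "J * J = - 1\<^sub>m n" and JI: "J * I = - (I * J)"
    using q by (auto simp: quaternion_units_def)
  obtain a Y where Y: "anti Y" "X = a \<cdot>\<^sub>m 1\<^sub>m n + Y" using anti_decomposition[OF X] .
  obtain b Z where Z: "anti Z" "Y = b \<cdot>\<^sub>m I + Z" "Z * I = - (I * Z)" using anti_project[OF I Y(1)] .
  obtain c W where W: "anti W" "Z = c \<cdot>\<^sub>m J + W" "W * J = - (J * W)" using anti_project[OF J Z(1)] .
  note car = anti_carrier[OF I(1)] anti_carrier[OF J(1)] anti_carrier[OF Z(1)] anti_carrier[OF W(1)]
  note [simp] = assoc_mult_mat[of _ n n _ n _ n]
  \<comment> \<open>Removing the \<open>J\<close> component preserves anticommutation with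
    \<open>I\<close>, because \<open>J\<close> itself anticommutes with \<open>I\<close>.\<close>
  have "W = Z + (- c) \<cdot>\<^sub>m J" unfolding W(2) using car by (auto intro!: eq_matI)
  then have WI: "W * I = - (I * W)"
    using car Z(3) JI
    by (simp add: add_mult_distrib_mat[of _ n n _ _ n] mult_add_distrib_mat[of _ n n _ n]
        mult_smult_distrib[of _ n n _ n] mult_smult_assoc_mat[of _ n n _ n]) (auto intro!: eq_matI)
  let ?K = "I * J"
  have WK: "W * ?K = ?K * W"
  proof -
    have "W * ?K = (W * I) * J" using car by simp
    also have "\<dots> = - (I * (W * J))" unfolding WI using car by simp
    also have "\<dots> = ?K * W" unfolding W(3) using car by simp
    finally show ?thesis .
  qed
  have KT: "transpose_mat ?K = - ?K"
    using car anti_transpose[OF I(1)] anti_transpose[OF J(1)] JI by (simp add: transpose_mult[of _ n n _ n])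
  have KK: "?K * ?K = - 1\<^sub>m n"
  proof -
    have "?K * ?K = I * ((J * I) * J)" using car by simp
    also have "\<dots> = - ((I * I) * (J * J))" unfolding JI using car by simp
    also have "\<dots> = - 1\<^sub>m n" unfolding I(2) J(2) by simp
    finally show ?thesis .
  qed
  have "transpose_mat (W * ?K) = W * ?K"
  proof -
    have "transpose_mat (W * ?K) = (- ?K) * (- W)"
      unfolding KT[symmetric] anti_transpose[OF W(1), symmetric] using car by (intro transpose_mult) auto
    then show ?thesis unfolding WK using car by simp
  qed
  moreover have "W * ?K \<in> D" using mult_D anti_D I J W by blast
  ultimately obtain k where k: "W * ?K = k \<cdot>\<^sub>m 1\<^sub>m n" using symmetric_scalar by blast
  \<comment> \<open>\<open>K\<close> is its own inverse up to sign, so \<open>W\<close> can be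
    recovered from the scalar \<open>W K\<close>.\<close>
  have "W = - ((W * ?K) * ?K)"
  proof -
    have "(W * ?K) * ?K = W * (?K * ?K)" using car by (intro assoc_mult_mat) auto
    then show ?thesis unfolding KK using car by simp
  qed
  also have "\<dots> = (- k) \<cdot>\<^sub>m ?K"
    unfolding k using car by (subst mult_smult_assoc_mat[of _ n n _ n]) (auto intro!: eq_matI)
  finally have "X = a \<cdot>\<^sub>m 1\<^sub>m n + b \<cdot>\<^sub>m I + c \<cdot>\<^sub>m J + (- k) \<cdot>\<^sub>m ?K"
    unfolding Y(2) Z(2) W(2) using car by (auto intro!: eq_matI)
  then show ?thesis by blast
qed

text \<open>The branching asks for a nonzero imaginary element and then for one that anticommutes
  with the first; \<open>anti_square\<close> normalises both. The complex case is genuine at this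
  level of generality; only the dimension count excludes it.\<close>

lemma structure_cases:
  obtains (real) "\<And>X. X \<in> D \<Longrightarrow> \<exists>a. X = a \<cdot>\<^sub>m 1\<^sub>m n"
  | (complex) I where "anti I" "\<And>X. X \<in> D \<Longrightarrow> \<exists>a b. X = a \<cdot>\<^sub>m 1\<^sub>m n + b \<cdot>\<^sub>m I"
      "I * I = - 1\<^sub>m n"
  | (quaternionic) I J where "quaternion_units I J"
proof (cases "\<forall>X. anti X \<longrightarrow> X = 0\<^sub>m n n")
  case True
  have "\<exists>a. X = a \<cdot>\<^sub>m 1\<^sub>m n" if X: "X \<in> D" for X
  proof -
    obtain a Y where "anti Y" "X = a \<cdot>\<^sub>m 1\<^sub>m n + Y" using anti_decomposition[OF X] .
    then show ?thesis using True by (intro exI[of _ a]) (auto intro!: eq_matI)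
  qed
  then show ?thesis using real by blast
next
  case False
  then obtain X where X: "anti X" "X \<noteq> 0\<^sub>m n n" by blast
  then obtain I where I: "anti I" "I * I = - 1\<^sub>m n" using anti_square anti_smult by blast
  show ?thesis
  proof (cases "\<forall>Z. anti Z \<and> Z * I = - (I * Z) \<longrightarrow> Z = 0\<^sub>m n n")
    case True
    have "\<exists>a b. X = a \<cdot>\<^sub>m 1\<^sub>m n + b \<cdot>\<^sub>m I" if X: "X \<in> D" for X
    proof -
      obtain a Y where Y: "anti Y" "X = a \<cdot>\<^sub>m 1\<^sub>m n + Y" using anti_decomposition[OF X] .
      obtain b Z where Z: "anti Z" "Y = b \<cdot>\<^sub>m I + Z" "Z * I = - (I * Z)" using anti_project[OF I Y(1)] .
      then have "Z = 0\<^sub>m n n" using True by blast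
      then show ?thesis using Y Z anti_carrier[OF I(1)]
        by (intro exI[of _ a] exI[of _ b]) (auto intro!: eq_matI)
    qed
    then show ?thesis using complex I by blast
  next
    case False
    then obtain Z where Z: "anti Z" "Z * I = - (I * Z)" "Z \<noteq> 0\<^sub>m n n" by blast
    then obtain c where c: "(c \<cdot>\<^sub>m Z) * (c \<cdot>\<^sub>m Z) = - 1\<^sub>m n" using anti_square by blast
    have "(c \<cdot>\<^sub>m Z) * I = - (I * (c \<cdot>\<^sub>m Z))"
      using Z(2) anti_carrier[OF I(1)] anti_carrier[OF Z(1)]
      by (simp add: mult_smult_distrib[of _ n n _ n] mult_smult_assoc_mat[of _ n n _ n]) (auto intro!: eq_matI)
    then have "quaternion_units I (c \<cdot>\<^sub>m Z)"
      unfolding quaternion_units_def using I c anti_smult Z by blast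
    then show ?thesis using quaternionic by blast
  qed
qed

lemma quaternion_units_products:
  assumes "quaternion_units I J"
  shows "I * (I * J) = - J" "(I * J) * I = J" "J * (I * J) = I" "(I * J) * J = - I"
    "(I * J) * (I * J) = - 1\<^sub>m n" "transpose_mat (I * J) = - (I * J)"
proof -
  have I: "anti I" "I * I = - 1\<^sub>m n" and J: "anti J" "J * J = - 1\<^sub>m n" and JI: "J * I = - (I * J)"
    using assms by (auto simp: quaternion_units_def)
  note car = anti_carrier[OF I(1)] anti_carrier[OF J(1)]
  have a: "X * (Y * Z) = X * Y * Z" "X * Y \<in> carrier_mat n n"
    if "X \<in> carrier_mat n n" "Y \<in> carrier_mat n n" "Z \<in> carrier_mat n n" for X Y Z :: "real mat"
    using that assoc_mult_mat[OF that] by auto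
  have 1: "I * (I * J) = - J" using car I(2) by (simp add: a)
  have 2: "(I * J) * J = - I" using car J(2) a(1)[of I J J] by simp
  have 3: "(I * J) * I = J" using car JI 1 a(1)[of I J I] by simp
  have 4: "J * (I * J) = I" using car JI 2 a(1)[of J I J] by simp
  have 5: "(I * J) * (I * J) = - 1\<^sub>m n" using car J(2) 3 a(1)[of "I * J" I J] by simp
  have 6: "transpose_mat (I * J) = - (I * J)"
    using car anti_transpose[OF I(1)] anti_transpose[OF J(1)] JI by (simp add: transpose_mult[of _ n n _ n])
  show "I * (I * J) = - J" "(I * J) * I = J" "J * (I * J) = I" "(I * J) * J = - I"
    "(I * J) * (I * J) = - 1\<^sub>m n" "transpose_mat (I * J) = - (I * J)"
    by (fact 1 2 3 4 5 6)+
qed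

end

section \<open>The commutant of a half-spin representation\<close>

lemma scalar_matI:
  fixes X :: "real mat"
  assumes X: "X \<in> carrier_mat n n" and v: "\<And>w. w \<in> carrier_vec n \<Longrightarrow> X *\<^sub>v w = c \<cdot>\<^sub>v w"
  shows "X = c \<cdot>\<^sub>m 1\<^sub>m n"
proof (rule eq_matI)
  fix i j assume "i < dim_row (c \<cdot>\<^sub>m 1\<^sub>m n)" "j < dim_col (c \<cdot>\<^sub>m 1\<^sub>m n)"
  then have ij: "i < n" "j < n" by auto
  then have "(X *\<^sub>v unit_vec n j) $ i = (c \<cdot>\<^sub>v unit_vec n j) $ i" using v by simp
  moreover have "(X *\<^sub>v unit_vec n j) $ i = X $$ (i, j)"
    using ij X by simp
  ultimately show "X $$ (i, j) = (c \<cdot>\<^sub>m 1\<^sub>m n) $$ (i, j)"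
    using ij by simp
qed (use X in auto)

lemma eigenspace_subspace:
  assumes X: "X \<in> carrier_mat n n"
  shows "VectorSpace.subspace class_ring {w \<in> carrier_vec n. X *\<^sub>v w = (c::real) \<cdot>\<^sub>v w} (module_vec TYPE(real) n)"
proof -
  interpret vec_space "TYPE(real)" n .
  show ?thesis
    unfolding VectorSpace.subspace_def
  proof (intro conjI)
    show "vectorspace class_ring V" by (rule vec_vs)
    show "submodule class_ring {w \<in> carrier_vec n. X *\<^sub>v w = c \<cdot>\<^sub>v w} V"
    proof (rule submodule.intro, goal_cases)
      case 1
      show ?case by (rule vectorspace.axioms(1)[OF vec_vs])
    next
      case (3 v w)
      then show ?case using X by (auto simp: module_vec_simps mult_add_distrib_mat_vec[of _ n n] smult_add_distrib_vec)
    next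
      case (5 a v)
      then show ?case
        using X by (auto simp: module_vec_simps mult_mat_vec[of _ n n] smult_smult_assoc mult.commute)
    qed (use X in \<open>auto simp: module_vec_simps intro!: eq_vecI\<close>)
  qed
qed

text \<open>For a representation, commuting with \<open>spin r\<close> amounts to commuting with all
  of \<open>Cl0 r\<close>, by \<open>intertwiner_Cl0\<close>.\<close>

definition commutant :: "nat \<Rightarrow> nat \<Rightarrow> (clifford \<Rightarrow> real mat) \<Rightarrow> real mat set" where
  "commutant r n \<rho> = {X \<in> carrier_mat n n. \<forall>x\<in>spin r. X * \<rho> x = \<rho> x * X}"

text \<open>Keeping \<open>s\<close> general with \<open>s * s = 1\<close> makes both half-spin
  representations instances. Evenness of \<open>r\<close> puts the volume element into
  \<open>Cl0 r\<close>.\<close>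

locale half_spin =
  fixes r :: nat and s :: real and \<rho> :: "clifford \<Rightarrow> real mat"
  assumes half_spin: "half_spin_representation r s \<rho>"
    and r_pos: "1 \<le> r" and r_even: "even r" and sign: "s * s = 1"
begin

abbreviation n where "n \<equiv> half_spin_dim r"
abbreviation D where "D \<equiv> commutant r n \<rho>"

lemma n_pos: "0 < n"
  by (simp add: half_spin_dim_def)

sublocale Cl0_rep r n \<rho>
  by unfold_locales (use half_spin in \<open>simp add: half_spin_representation_def irreducible_Cl0_representation_def\<close>)

lemma commutant_Cl0: "X \<in> D \<Longrightarrow> x \<in> Cl0 r \<Longrightarrow> X * \<rho> x = \<rho> x * X"
  by (rule intertwiner_Cl0) (auto simp: commutant_def spin_pair Cl0_rep_axioms)

lemma commutantI:
  assumes "X \<in> carrier_mat n n"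
    and "\<And>i j. 1 \<le> i \<Longrightarrow> i < j \<Longrightarrow> j \<le> r \<Longrightarrow> X * \<rho> (cliff_e i * cliff_e j) = \<rho> (cliff_e i * cliff_e j) * X"
  shows "X \<in> D"
  unfolding commutant_def
  using intertwiner_Cl0[OF Cl0_rep_axioms Cl0_rep_axioms assms] assms(1) spin_subset_Cl0 by auto

lemma commutant_carrier: "X \<in> D \<Longrightarrow> X \<in> carrier_mat n n"
  by (simp add: commutant_def)

lemma volume: "\<rho> (cliff_volume r) = s \<cdot>\<^sub>m 1\<^sub>m n"
  using half_spin by (simp add: half_spin_representation_def)

lemma spin_carrier: "x \<in> spin r \<Longrightarrow> \<rho> x \<in> carrier_mat n n"
  and spin_transpose: "x \<in> spin r \<Longrightarrow> transpose_mat (\<rho> x) = - \<rho> x"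
  using half_spin_antisym[OF half_spin] by auto

text \<open>The spin action is antisymmetric: transposing the commutation relation gives it for the
  transpose, with two signs that cancel.\<close>

lemma commutant_transpose:
  assumes "X \<in> D"
  shows "transpose_mat X \<in> D"
  unfolding commutant_def
proof (intro CollectI conjI ballI)
  note X = commutant_carrier[OF assms]
  then show "transpose_mat X \<in> carrier_mat n n" by simp
  fix x assume x: "x \<in> spin r"
  note c = spin_carrier[OF x]
  have "transpose_mat (X * \<rho> x) = transpose_mat (\<rho> x * X)" using assms x by (simp add: commutant_def)
  then have "- (\<rho> x * transpose_mat X) = - (transpose_mat X * \<rho> x)"
    using X c by (simp add: transpose_mult[of _ n n _ n] spin_transpose[OF x])
  then have "- (- (transpose_mat X * \<rho> x)) = - (- (\<rho> x * transpose_mat X))" by simp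
  then show "transpose_mat X * \<rho> x = \<rho> x * transpose_mat X" by simp
qed

lemma commutant_symmetric_scalar:
  assumes "X \<in> D" "transpose_mat X = X"
  shows "\<exists>c. X = c \<cdot>\<^sub>m 1\<^sub>m n"
proof -
  note X = commutant_carrier[OF assms(1)]
  obtain c v where v: "v \<in> carrier_vec n" "v \<noteq> 0\<^sub>v n" "X *\<^sub>v v = c \<cdot>\<^sub>v v"
    using symmetric_real_eigenvector[OF X assms(2) n_pos] by blast
  let ?W = "{w \<in> carrier_vec n. X *\<^sub>v w = c \<cdot>\<^sub>v w}"
  have "\<rho> x *\<^sub>v w \<in> ?W" if x: "x \<in> Cl0 r" and w: "w \<in> ?W" for x w
  proof -
    have "X *\<^sub>v (\<rho> x *\<^sub>v w) = (\<rho> x * X) *\<^sub>v w"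
      using x w X rho_carrier[OF x] by (simp add: commutant_Cl0[OF assms(1) x, symmetric] assoc_mult_mat_vec[of _ n n _ n])
    also have "\<dots> = c \<cdot>\<^sub>v (\<rho> x *\<^sub>v w)"
      using x w X rho_carrier[OF x] by (simp add: assoc_mult_mat_vec[of _ n n _ n] mult_mat_vec[of _ n n])
    finally show ?thesis using rho_carrier[OF x] w by simp
  qed
  then have "?W = {0\<^sub>v n} \<or> ?W = carrier_vec n"
    using half_spin eigenspace_subspace[OF X]
    unfolding half_spin_representation_def irreducible_Cl0_representation_def by blast
  moreover have "v \<in> ?W" using v by simp
  ultimately have "?W = carrier_vec n" using v(2) by blast
  then show ?thesis using scalar_matI[OF X] by blast
qed

sublocale real_star_algebra n D
proof
  show "X * Y \<in> D" if "X \<in> D" "Y \<in> D" for X Y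
    unfolding commutant_def
  proof (intro CollectI conjI ballI)
    note car = commutant_carrier[OF that(1)] commutant_carrier[OF that(2)]
    then show "X * Y \<in> carrier_mat n n" by simp
    fix x assume x: "x \<in> spin r"
    note car = car spin_carrier[OF x]
    have "X * Y * \<rho> x = X * (Y * \<rho> x)" using car by (simp add: assoc_mult_mat[of _ n n _ n _ n])
    also have "Y * \<rho> x = \<rho> x * Y" using x that by (simp add: commutant_def)
    also have "X * (\<rho> x * Y) = X * \<rho> x * Y" using car by (simp add: assoc_mult_mat[of _ n n _ n _ n])
    also have "X * \<rho> x = \<rho> x * X" using x that by (simp add: commutant_def)
    also have "\<rho> x * X * Y = \<rho> x * (X * Y)" using car by (simp add: assoc_mult_mat[of _ n n _ n _ n])
    finally show "X * Y * \<rho> x = \<rho> x * (X * Y)" .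
  qed
  show "1\<^sub>m n \<in> D" 
    using left_mult_one_mat[OF spin_carrier] right_mult_one_mat[OF spin_carrier] by (auto simp: commutant_def)
qed (use n_pos commutant_transpose commutant_symmetric_scalar spin_carrier in
    \<open>auto simp: commutant_def add_mult_distrib_mat[of _ n n _ _ n] mult_add_distrib_mat[of _ n n _ n]
        mult_smult_distrib[of _ n n _ n] mult_smult_assoc_mat[of _ n n _ n]\<close>)

end

section \<open>Sums of matrices and elementary matrices\<close>

definition mat_sum :: "nat \<Rightarrow> ('a \<Rightarrow> real mat) \<Rightarrow> 'a set \<Rightarrow> real mat" where
  "mat_sum n F A = mat n n (\<lambda>ij. \<Sum>S\<in>A. F S $$ ij)"

lemma mat_sum_carrier [simp]: "mat_sum n F A \<in> carrier_mat n n"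
  and mat_sum_index: "i < n \<Longrightarrow> j < n \<Longrightarrow> mat_sum n F A $$ (i, j) = (\<Sum>S\<in>A. F S $$ (i, j))"
  by (simp_all add: mat_sum_def)

lemma mat_sum_mult_right:
  assumes "U \<in> carrier_mat n n" "\<And>S. S \<in> A \<Longrightarrow> F S \<in> carrier_mat n n"
  shows "mat_sum n F A * U = mat_sum n (\<lambda>S. F S * U) A"
proof (rule eq_matI)
  fix i j assume "i < dim_row (mat_sum n (\<lambda>S. F S * U) A)" "j < dim_col (mat_sum n (\<lambda>S. F S * U) A)"
  then have ij: "i < n" "j < n" by (auto simp: mat_sum_def)
  have "(mat_sum n F A * U) $$ (i, j) = (\<Sum>k<n. \<Sum>S\<in>A. F S $$ (i, k) * U $$ (k, j))"
    using ij assms(1) by (simp add: mat_sum_def scalar_prod_def atLeast0LessThan sum_distrib_right)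
  also have "\<dots> = (\<Sum>S\<in>A. \<Sum>k<n. F S $$ (i, k) * U $$ (k, j))" by (rule sum.swap)
  also have "\<dots> = (\<Sum>S\<in>A. (F S * U) $$ (i, j))"
    using ij assms(1) assms(2)[THEN carrier_matD(1)] assms(2)[THEN carrier_matD(2)]
    by (intro sum.cong) (auto simp: scalar_prod_def atLeast0LessThan)
  finally show "(mat_sum n F A * U) $$ (i, j) = mat_sum n (\<lambda>S. F S * U) A $$ (i, j)"
    using ij by (simp add: mat_sum_index)
qed (use assms(1) in \<open>auto simp: mat_sum_def\<close>)

lemma mat_sum_mult_left:
  assumes "U \<in> carrier_mat n n" "\<And>S. S \<in> A \<Longrightarrow> F S \<in> carrier_mat n n"
  shows "U * mat_sum n F A = mat_sum n (\<lambda>S. U * F S) A"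
proof (rule eq_matI)
  fix i j assume "i < dim_row (mat_sum n (\<lambda>S. U * F S) A)" "j < dim_col (mat_sum n (\<lambda>S. U * F S) A)"
  then have ij: "i < n" "j < n" by (auto simp: mat_sum_def)
  have "(U * mat_sum n F A) $$ (i, j) = (\<Sum>k<n. \<Sum>S\<in>A. U $$ (i, k) * F S $$ (k, j))"
    using ij assms(1) by (simp add: mat_sum_def scalar_prod_def atLeast0LessThan sum_distrib_left)
  also have "\<dots> = (\<Sum>S\<in>A. \<Sum>k<n. U $$ (i, k) * F S $$ (k, j))" by (rule sum.swap)
  also have "\<dots> = (\<Sum>S\<in>A. (U * F S) $$ (i, j))"
    using ij assms(1) assms(2)[THEN carrier_matD(1)] assms(2)[THEN carrier_matD(2)]
    by (intro sum.cong) (auto simp: scalar_prod_def atLeast0LessThan)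
  finally show "(U * mat_sum n F A) $$ (i, j) = mat_sum n (\<lambda>S. U * F S) A $$ (i, j)"
    using ij by (simp add: mat_sum_index)
qed (use assms(1) in \<open>auto simp: mat_sum_def\<close>)

text \<open>\<open>F S\<close> is tabulated anew at size \<open>n\<close>, which spares a carrier
  premise; an \<open>n\<close> by \<open>n\<close> matrix is unchanged by this.\<close>

lemma mat_inner_mat_sum:
  "mat_inner (mat_sum n F A) Y = (\<Sum>S\<in>A. mat_inner (mat n n (($$) (F S))) Y)"
proof -
  have "mat_inner (mat_sum n F A) Y = (\<Sum>i<n. \<Sum>j<n. \<Sum>S\<in>A. F S $$ (i, j) * Y $$ (i, j))"
    by (simp add: mat_inner_def mat_sum_def sum_distrib_right)
  also have "\<dots> = (\<Sum>i<n. \<Sum>S\<in>A. \<Sum>j<n. F S $$ (i, j) * Y $$ (i, j))"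
    by (intro sum.cong refl sum.swap)
  also have "\<dots> = (\<Sum>S\<in>A. \<Sum>i<n. \<Sum>j<n. F S $$ (i, j) * Y $$ (i, j))"
    by (rule sum.swap)
  finally show ?thesis by (simp add: mat_inner_def)
qed

definition elementary_mat :: "nat \<Rightarrow> nat \<Rightarrow> nat \<Rightarrow> real mat" where
  "elementary_mat n a b = mat n n (\<lambda>(i, j). if i = a \<and> j = b then 1 else 0)"

lemma elementary_mat_carrier [simp]: "elementary_mat n a b \<in> carrier_mat n n"
  by (simp add: elementary_mat_def)

lemma mat_inner_elementary:
  assumes "a < n" "b < n"
  shows "mat_inner (elementary_mat n a b) Y = Y $$ (a, b)"
proof -
  have "mat_inner (elementary_mat n a b) Y = (\<Sum>i<n. if i = a then (\<Sum>j<n. if j = b then Y $$ (i, j) else 0) else 0)"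
    unfolding mat_inner_def
  proof (simp only: carrier_matD[OF elementary_mat_carrier], intro sum.cong refl)
    fix i assume "i \<in> {..<n}"
    then show "(\<Sum>j<n. elementary_mat n a b $$ (i, j) * Y $$ (i, j))
      = (if i = a then \<Sum>j<n. if j = b then Y $$ (i, j) else 0 else 0)"
      by (cases "i = a") (simp_all add: elementary_mat_def if_distrib[of "\<lambda>x. x * _"] cong: if_cong)
  qed
  then show ?thesis using assms by simp
qed

text \<open>This is a diagonal coefficient of the linear map \<open>X \<mapsto> M X M^T\<close> in
  the basis of elementary matrices. Summed over \<open>a\<close> and \<open>b\<close>, these
  coefficients give its trace \<open>(tr M)^2\<close>.\<close>

lemma mult_elementary_transpose_index:
  assumes "M \<in> carrier_mat n n" "a < n" "b < n"
  shows "(M * elementary_mat n a b * transpose_mat M) $$ (a, b) = M $$ (a, a) * M $$ (b, b)"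
proof -
  have "(M * elementary_mat n a b) $$ (a, k) = (if k = b then M $$ (a, a) else 0)" if "k < n" for k
  proof -
    have "(M * elementary_mat n a b) $$ (a, k) = (\<Sum>l<n. if l = a then (if k = b then M $$ (a, l) else 0) else 0)"
      using that assms
      by (auto simp: elementary_mat_def scalar_prod_def atLeast0LessThan if_distrib[of "(*) _"] cong: if_cong)
    then show ?thesis using assms by simp
  qed
  moreover have "(M * elementary_mat n a b * transpose_mat M) $$ (a, b)
    = (\<Sum>k<n. (M * elementary_mat n a b) $$ (a, k) * M $$ (b, k))"
    using assms by (simp add: scalar_prod_def atLeast0LessThan elementary_mat_def)
  ultimately have "(M * elementary_mat n a b * transpose_mat M) $$ (a, b)
    = (\<Sum>k<n. if k = b then M $$ (a, a) * M $$ (b, k) else 0)"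
    by (simp add: if_distrib[of "\<lambda>x. x * _"] cong: if_cong)
  then show ?thesis using assms by simp
qed

section \<open>Averaging over the even monomials\<close>

context half_spin
begin

definition mon :: "nat set \<Rightarrow> real mat" where
  "mon S = \<rho> (cliff_monom S)"

lemma monom_Cl0: "S \<in> even_subsets r \<Longrightarrow> cliff_monom S \<in> Cl0 r"
  using Cl0_monom by (simp add: even_subsets_def)

lemma mon_carrier: "S \<in> even_subsets r \<Longrightarrow> mon S \<in> carrier_mat n n"
  unfolding mon_def by (intro rho_carrier monom_Cl0)

lemma mon_mult:
  assumes "S \<in> even_subsets r" "T \<in> even_subsets r"
  shows "mon S * mon T = cliff_sign S T \<cdot>\<^sub>m mon (sym_diff S T)"
  using assms monom_Cl0 even_subsetsD[OF assms(1)] even_subsetsD[OF assms(2)]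
    rho_scale[OF monom_Cl0[OF even_subsets_sym_diff[OF assms]], of "cliff_sign S T"]
  by (simp add: mon_def rho_mult[symmetric] cliff_monom_mult)

lemma pair_eq_monom: "i < j \<Longrightarrow> cliff_e i * cliff_e j = cliff_monom {i, j}"
proof -
  assume "i < j"
  then have "sym_diff {i} {j} = {i, j}" by auto
  then show ?thesis
    using \<open>i < j\<close> unfolding cliff_e_def by (subst cliff_monom_mult) (simp_all add: cliff_sign_def)
qed

lemma pair_even_subset: "1 \<le> i \<Longrightarrow> i \<le> r \<Longrightarrow> 1 \<le> j \<Longrightarrow> j \<le> r \<Longrightarrow> i \<noteq> j \<Longrightarrow> {i, j} \<in> even_subsets r"
  by (simp add: even_subsets_def)

text \<open>For \<open>i < j\<close> this is antisymmetry together with square -1. The cases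
  \<open>i = j\<close> and \<open>i > j\<close> are included because \<open>Cl0_word_induct\<close>
  hands over pairs in any order.\<close>

lemma pair_orthogonal:
  assumes ij: "1 \<le> i" "i \<le> r" "1 \<le> j" "j \<le> r"
  shows "\<rho> (cliff_e i * cliff_e j) * transpose_mat (\<rho> (cliff_e i * cliff_e j)) = 1\<^sub>m n"
proof -
  have neg: "\<rho> (- x) * transpose_mat (\<rho> (- x)) = \<rho> x * transpose_mat (\<rho> x)" if "x \<in> Cl0 r" for x
  proof -
    have "\<rho> (- x) = - \<rho> x" using that rho_minus[of x] by (auto intro!: eq_matI)
    moreover have "transpose_mat (- \<rho> x) = - transpose_mat (\<rho> x)" by (auto intro!: eq_matI)
    ultimately show ?thesis using rho_carrier[OF that] by simp
  qed
  have less: "\<rho> (cliff_e i * cliff_e j) * transpose_mat (\<rho> (cliff_e i * cliff_e j)) = 1\<^sub>m n"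
    if "1 \<le> i" "i < j" "j \<le> r" for i j
  proof -
    let ?u = "cliff_e i * cliff_e j"
    have u: "?u \<in> spin r" "?u \<in> Cl0 r" using that spin_pair Cl0_pair by auto
    have "?u * ?u = cliff_e i * (cliff_e j * cliff_e i) * cliff_e j" by (simp add: mult.assoc)
    also have "\<dots> = - ((cliff_e i * cliff_e i) * (cliff_e j * cliff_e j))"
      using that by (subst cliff_e_anticommute) (auto simp: mult.assoc)
    also have "\<dots> = - 1" by (simp add: cliff_e_sq)
    finally have "\<rho> ?u * \<rho> ?u = (- 1) \<cdot>\<^sub>m 1\<^sub>m n"
      using rho_mult[OF u(2) u(2)] rho_minus[OF Cl0_one] by simp
    then show ?thesis using spin_transpose[OF u(1)] rho_carrier[OF u(2)] by (auto intro!: eq_matI)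
  qed
  show ?thesis
  proof (cases i j rule: linorder_cases)
    case l: less
    show ?thesis by (rule less) (use l ij in auto)
  next
    case equal
    then show ?thesis using neg[OF Cl0_one] by (simp add: cliff_e_sq)
  next
    case greater
    then show ?thesis
      using neg[OF Cl0_pair[of j r i]] less[of j i] ij by (simp add: cliff_e_anticommute[of j i])
  qed
qed

lemma mon_orthogonal:
  assumes S: "S \<in> even_subsets r"
  shows "mon S * transpose_mat (mon S) = 1\<^sub>m n" "transpose_mat (mon S) * mon S = 1\<^sub>m n"
proof -
  have *: "\<rho> (prod_list (map cliff_e w)) * transpose_mat (\<rho> (prod_list (map cliff_e w))) = 1\<^sub>m n"
    if "set w \<subseteq> {1..r}" "even (length w)" for w
    using that
  proof (induction rule: Cl0_word_induct)
    case Nil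
    then show ?case by simp
  next
    case (Cons i j w)
    let ?u = "cliff_e i * cliff_e j" and ?w = "prod_list (map cliff_e w)"
    have uw: "?u \<in> Cl0 r" "?w \<in> Cl0 r" using Cons Cl0_pair Cl0_word by auto
    note c = rho_carrier[OF uw(1)] rho_carrier[OF uw(2)]
    have "\<rho> (?u * ?w) * transpose_mat (\<rho> (?u * ?w))
      = \<rho> ?u * (\<rho> ?w * transpose_mat (\<rho> ?w)) * transpose_mat (\<rho> ?u)"
      using c by (simp add: rho_mult uw transpose_mult[of _ n n _ n] assoc_mult_mat[of _ n n _ n _ n])
    then show ?case using Cons c by (simp add: pair_orthogonal)
  qed
  have "finite S" using S even_subsetsD by blast
  then show 1: "mon S * transpose_mat (mon S) = 1\<^sub>m n"
    using even_subsetsD[OF S] *[of "sorted_list_of_set S"] by (simp add: mon_def cliff_monom_eq_prod_list)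
  show "transpose_mat (mon S) * mon S = 1\<^sub>m n"
    by (rule mat_mult_left_right_inverse[OF _ _ 1]) (use mon_carrier[OF S] in auto)
qed

definition conj_mon :: "real mat \<Rightarrow> nat set \<Rightarrow> real mat" where
  "conj_mon X S = mon S * X * transpose_mat (mon S)"

lemma conj_mon_carrier: "X \<in> carrier_mat n n \<Longrightarrow> S \<in> even_subsets r \<Longrightarrow> conj_mon X S \<in> carrier_mat n n"
  using mon_carrier[of S] unfolding conj_mon_def by auto

text \<open>\<open>e_T e_S\<close> and the monomial of \<open>sym_diff T S\<close> differ by a sign,
  which enters the conjugation twice. So conjugation is an honest action of the group of even
  subsets, although the monomials multiply only up to sign.\<close>

lemma conj_mon_sym_diff:
  assumes X: "X \<in> carrier_mat n n" and T: "T \<in> even_subsets r" and S: "S \<in> even_subsets r"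
  shows "conj_mon X (sym_diff T S) * mon T = mon T * conj_mon X S"
proof -
  let ?c = "cliff_sign T S" and ?U = "sym_diff T S"
  note U = even_subsets_sym_diff[OF T S]
  note car = X mon_carrier[OF T] mon_carrier[OF S] mon_carrier[OF U]
  have c: "?c * ?c = 1" using cliff_sign_sq even_subsetsD[OF T] even_subsetsD[OF S] by blast
  have mU: "mon ?U = ?c \<cdot>\<^sub>m (mon T * mon S)"
    unfolding mon_mult[OF T S] using c car by (auto intro!: eq_matI)
  have "conj_mon X ?U = (?c * ?c) \<cdot>\<^sub>m (mon T * mon S * X * transpose_mat (mon T * mon S))"
  proof -
    have "transpose_mat (?c \<cdot>\<^sub>m (mon T * mon S)) = ?c \<cdot>\<^sub>m transpose_mat (mon T * mon S)"
      by (auto intro!: eq_matI)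
    then have "conj_mon X ?U = (?c \<cdot>\<^sub>m (mon T * mon S)) * X * (?c \<cdot>\<^sub>m transpose_mat (mon T * mon S))"
      unfolding conj_mon_def mU by simp
    also have "\<dots> = ?c \<cdot>\<^sub>m (?c \<cdot>\<^sub>m (mon T * mon S * X * transpose_mat (mon T * mon S)))"
      using car by (simp add: mult_smult_distrib[of _ n n _ n] mult_smult_assoc_mat[of _ n n _ n])
    finally show ?thesis by (auto intro!: eq_matI)
  qed
  also have "\<dots> = mon T * mon S * X * transpose_mat (mon T * mon S)"
    unfolding c by (auto intro!: eq_matI)
  also have "\<dots> = mon T * conj_mon X S * transpose_mat (mon T)"
    unfolding conj_mon_def using car
    by (simp add: transpose_mult[of _ n n _ n] assoc_mult_mat[of _ n n _ n _ n]) 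
  finally have "conj_mon X ?U * mon T = mon T * conj_mon X S * (transpose_mat (mon T) * mon T)"
    using car conj_mon_carrier[OF X S] by (simp add: assoc_mult_mat[of _ n n _ n _ n])
  then show ?thesis
    unfolding mon_orthogonal[OF T] using car conj_mon_carrier[OF X S] by simp
qed

text \<open>Left unnormalised: \<open>2 ^ (r - 1)\<close> times the projection onto
  \<open>D\<close>.\<close>

definition avg :: "real mat \<Rightarrow> real mat" where
  "avg X = mat_sum n (conj_mon X) (even_subsets r)"

text \<open>Moving \<open>e_T\<close> across the sum only permutes the summands by
  \<open>S \<mapsto> sym_diff T S\<close>. By \<open>commutantI\<close> it is enough to take pairs
  \<open>T = {i, j}\<close>.\<close>

lemma avg_commutant:
  assumes X: "X \<in> carrier_mat n n"
  shows "avg X \<in> D"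
proof (rule commutantI)
  show "avg X \<in> carrier_mat n n" by (simp add: avg_def)
  fix i j assume ij: "1 \<le> i" "i < j" "j \<le> r"
  define T where "T = {i, j}"
  have T: "T \<in> even_subsets r" unfolding T_def by (rule pair_even_subset) (use ij in auto)
  let ?E = "even_subsets r"
  note c = conj_mon_carrier[OF X]
  have "avg X * mon T = mat_sum n (\<lambda>S. conj_mon X S * mon T) ?E"
    unfolding avg_def using mon_carrier[OF T] c by (intro mat_sum_mult_right) auto
  also have "\<dots> = mat_sum n (\<lambda>S. mon T * conj_mon X S) ?E"
    unfolding mat_sum_def
  proof (intro cong_mat refl, goal_cases)
    case (1 i j)
    have "(\<Sum>S\<in>?E. (conj_mon X S * mon T) $$ (i, j)) = (\<Sum>S\<in>?E. (conj_mon X (sym_diff T S) * mon T) $$ (i, j))"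
      by (rule sum.reindex_bij_betw[OF bij_even_subsets[OF T], symmetric])
    also have "\<dots> = (\<Sum>S\<in>?E. (mon T * conj_mon X S) $$ (i, j))"
      by (intro sum.cong refl arg_cong[of _ _ "\<lambda>M. M $$ (i, j)"] conj_mon_sym_diff[OF X T])
    finally show ?case .
  qed
  also have "\<dots> = mon T * avg X"
    unfolding avg_def using mon_carrier[OF T] c by (intro mat_sum_mult_left[symmetric]) auto
  finally show "avg X * \<rho> (cliff_e i * cliff_e j) = \<rho> (cliff_e i * cliff_e j) * avg X"
    using ij by (simp add: pair_eq_monom mon_def T_def)
qed

text \<open>Each \<open>e_S\<close> is orthogonal and commutes with \<open>Y\<close>, so every
  summand pairs with \<open>Y\<close> as \<open>X\<close> does. With \<open>avg_commutant\<close>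
  this makes \<open>avg\<close> a multiple of the orthogonal projection onto
  \<open>D\<close>.\<close>

lemma mat_inner_avg:
  assumes X: "X \<in> carrier_mat n n" and Y: "Y \<in> D"
  shows "mat_inner (avg X) Y = 2 ^ (r - 1) * mat_inner X Y"
proof -
  note Yc = commutant_carrier[OF Y]
  have "mat_inner (mat n n (($$) (conj_mon X S))) Y = mat_inner X Y" if S: "S \<in> even_subsets r" for S
  proof -
    note M = mon_carrier[OF S]
    have "mat n n (($$) (conj_mon X S)) = conj_mon X S"
      using conj_mon_carrier[OF X S] by (auto intro!: eq_matI)
    then have "mat_inner (mat n n (($$) (conj_mon X S))) Y = mat_inner (mon S * X * transpose_mat (mon S)) Y"
      by (simp add: conj_mon_def)
    also have "\<dots> = mat_inner (mon S * X) (Y * mon S)"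
      using M X Yc by (subst mat_inner_mult_right[of _ n n _ n]) auto
    also have "\<dots> = mat_inner X (transpose_mat (mon S) * (Y * mon S))"
      using M X Yc by (subst mat_inner_mult_left[of _ n n _ n]) auto
    also have "Y * mon S = mon S * Y"
      unfolding mon_def by (rule commutant_Cl0[OF Y monom_Cl0[OF S]])
    also have "transpose_mat (mon S) * (mon S * Y) = (transpose_mat (mon S) * mon S) * Y"
      using M Yc by (intro assoc_mult_mat[symmetric]) auto
    also have "\<dots> = Y" using Yc by (simp add: mon_orthogonal[OF S])
    finally show ?thesis .
  qed
  then show ?thesis unfolding avg_def mat_inner_mat_sum by (simp add: card_even_subsets[OF r_pos])
qed

text \<open>Squaring removes the sign \<open>s\<close> of the volume element. For any other nonempty
  \<open>S\<close>, some \<open>e_i e_j\<close> anticommutes with \<open>e_S\<close>, so conjugation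
  by it negates \<open>e_S\<close> while preserving the trace.\<close>

lemma trace_mon:
  assumes S: "S \<in> even_subsets r"
  shows "mat_inner (1\<^sub>m n) (mon S) ^ 2 = (if S = {} \<or> S = {1..r} then (real n)\<^sup>2 else 0)"
proof -
  consider "S = {}" | "S = {1..r}" | i j where "i \<in> S" "j \<in> {1..r}" "j \<notin> S"
    using even_subsetsD[OF S] by blast
  then show ?thesis
  proof cases
    case 1
    then show ?thesis by (simp add: mon_def one_clifford_def[symmetric] mat_inner_one_self)
  next
    case 2
    have "mon S = s \<cdot>\<^sub>m 1\<^sub>m n"
      using volume by (simp only: mon_def 2 cliff_volume_eq_monom)
    then have "mat_inner (1\<^sub>m n) (mon S) = s * n"
      using mat_inner_smult_right[of "1\<^sub>m n" n n "1\<^sub>m n" s] by (simp add: mat_inner_one_self)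
    then show ?thesis using 2 sign by (simp add: power2_eq_square)
  next
    case 3
    have ij: "i \<noteq> j" "1 \<le> i" "i \<le> r" "1 \<le> j" "j \<le> r" using 3 even_subsetsD[OF S] by auto
    define T where "T = {i, j}"
    have T: "T \<in> even_subsets r" unfolding T_def by (rule pair_even_subset) (use ij in auto)
    note M = mon_carrier[OF S] mon_carrier[OF T]
    have "mon T * mon S = - (mon S * mon T)"
    proof -
      have "sym_diff T S = sym_diff S T" by auto
      moreover have "cliff_sign T S = - cliff_sign S T"
        unfolding T_def using even_subsetsD[OF S] 3 by (intro cliff_sign_swap) auto
      ultimately have "mon T * mon S = - cliff_sign S T \<cdot>\<^sub>m mon (sym_diff S T)"
        using mon_mult[OF T S] by simp
      also have "\<dots> = - (mon S * mon T)" unfolding mon_mult[OF S T] by (auto intro!: eq_matI)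
      finally show ?thesis .
    qed
    \<comment> \<open>Since \<open>mon T\<close> is orthogonal, its pairings with
      \<open>mon T * mon S\<close> and with \<open>mon S * mon T\<close> both equal the trace of
      \<open>mon S\<close>; anticommutation makes them opposite.\<close>
    then have "mat_inner (mon T) (mon T * mon S) = mat_inner (mon T) (- (mon S * mon T))" by simp
    moreover have "mat_inner (mon T) (mon T * mon S) = mat_inner (1\<^sub>m n) (mon S)"
      using M mat_inner_mult_left[of "transpose_mat (mon T)" n n "mon T" n "mon S"] mon_orthogonal(2)[OF T] by simp
    moreover have "mat_inner (mon T) (mon S * mon T) = mat_inner (1\<^sub>m n) (mon S)"
      using M mat_inner_mult_right[of "mon T" n n "transpose_mat (mon T)" n "mon S"] mon_orthogonal(1)[OF T] by simp
    moreover have "mat_inner (mon T) (- (mon S * mon T)) = - mat_inner (mon T) (mon S * mon T)"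
      using M by (simp add: mat_inner_def sum_negf)
    ultimately have "mat_inner (1\<^sub>m n) (mon S) = 0" by simp
    moreover have "S \<noteq> {}" "S \<noteq> {1..r}" using 3 by auto
    ultimately show ?thesis by simp
  qed
qed

text \<open>The left side is the trace of the linear map \<open>avg\<close> on the space of
  matrices, computed in the basis of elementary matrices.\<close>

lemma trace_avg:
  "(\<Sum>a<n. \<Sum>b<n. avg (elementary_mat n a b) $$ (a, b)) = 2 * (real n)\<^sup>2"
proof -
  let ?E = "even_subsets r"
  have "(\<Sum>a<n. \<Sum>b<n. avg (elementary_mat n a b) $$ (a, b))
    = (\<Sum>a<n. \<Sum>b<n. \<Sum>S\<in>?E. mon S $$ (a, a) * mon S $$ (b, b))"
  proof (intro sum.cong refl)
    fix a b assume ab: "a \<in> {..<n}" "b \<in> {..<n}"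
    have "avg (elementary_mat n a b) $$ (a, b) = (\<Sum>S\<in>?E. conj_mon (elementary_mat n a b) S $$ (a, b))"
      using ab by (simp add: avg_def mat_sum_index)
    also have "\<dots> = (\<Sum>S\<in>?E. mon S $$ (a, a) * mon S $$ (b, b))"
      unfolding conj_mon_def using ab
      by (intro sum.cong refl mult_elementary_transpose_index) (auto intro: mon_carrier)
    finally show "avg (elementary_mat n a b) $$ (a, b) = (\<Sum>S\<in>?E. mon S $$ (a, a) * mon S $$ (b, b))" .
  qed
  also have "\<dots> = (\<Sum>a<n. \<Sum>S\<in>?E. \<Sum>b<n. mon S $$ (a, a) * mon S $$ (b, b))"
    by (intro sum.cong refl sum.swap)
  also have "\<dots> = (\<Sum>S\<in>?E. \<Sum>a<n. \<Sum>b<n. mon S $$ (a, a) * mon S $$ (b, b))"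
    by (rule sum.swap)
  also have "\<dots> = (\<Sum>S\<in>?E. (mat_inner (1\<^sub>m n) (mon S))\<^sup>2)"
  proof (intro sum.cong refl)
    fix S assume S: "S \<in> ?E"
    have "mat_inner (1\<^sub>m n) (mon S) = (\<Sum>a<n. mon S $$ (a, a))"
      by (simp add: mat_inner_def if_distrib[of "\<lambda>x. x * _"] cong: if_cong)
    then show "(\<Sum>a<n. \<Sum>b<n. mon S $$ (a, a) * mon S $$ (b, b)) = (mat_inner (1\<^sub>m n) (mon S))\<^sup>2"
      by (simp add: power2_eq_square sum_product)
  qed
  also have "\<dots> = (\<Sum>S\<in>?E. if S \<in> {{}, {1..r}} then (real n)\<^sup>2 else 0)"
    by (intro sum.cong refl) (simp add: trace_mon)
  also have "\<dots> = (\<Sum>S\<in>?E \<inter> {{}, {1..r}}. (real n)\<^sup>2)"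
    by (rule sum.inter_restrict[symmetric]) simp
  also have "?E \<inter> {{}, {1..r}} = {{}, {1..r}}"
    using r_even by (auto simp: even_subsets_def)
  also have "(\<Sum>S\<in>{{}, {1..r}}. (real n)\<^sup>2) = 2 * (real n)\<^sup>2"
    using r_pos by simp
  finally show ?thesis .
qed

text \<open>The trace of \<open>avg\<close> is computed a second time, through an orthogonal basis
  of \<open>D\<close>; comparison with \<open>trace_avg\<close> determines the number of basis
  elements. The squared norm \<open>n\<close> is that of every orthogonal matrix, so of the identity
  and the imaginary units.\<close>

lemma orthogonal_basis_length:
  assumes D: "set Bs \<subseteq> D"
    and orth: "\<And>a b. a < length Bs \<Longrightarrow> b < length Bs \<Longrightarrow> mat_inner (Bs ! a) (Bs ! b) = (if a = b then real n else 0)"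
    and span: "\<And>X. X \<in> D \<Longrightarrow> \<exists>c. X = mat_sum n (\<lambda>a. c a \<cdot>\<^sub>m Bs ! a) {..<length Bs}"
  shows "length Bs * 2 ^ r = 4 * n\<^sup>2"
proof -
  let ?k = "length Bs" and ?N = "2 ^ (r - 1) :: real"
  have car: "Bs ! a \<in> carrier_mat n n" if "a < ?k" for a
    using D that commutant_carrier nth_mem by blast
  have entry: "real n * avg (elementary_mat n i j) $$ (i, j) = ?N * (\<Sum>a<?k. Bs ! a $$ (i, j) * Bs ! a $$ (i, j))"
    if ij: "i < n" "j < n" for i j
  proof -
    let ?P = "avg (elementary_mat n i j)"
    have "?P \<in> D" by (rule avg_commutant) simp
    then obtain c where c: "?P = mat_sum n (\<lambda>a. c a \<cdot>\<^sub>m Bs ! a) {..<?k}" using span by blast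
    \<comment> \<open>Projecting an elementary matrix yields the corresponding entries of the basis
      matrices as coefficients, up to the factors \<open>n\<close> and
      \<open>2 ^ (r - 1)\<close>.\<close>
    have coeff: "real n * c b = ?N * Bs ! b $$ (i, j)" if b: "b < ?k" for b
    proof -
      have "mat_inner ?P (Bs ! b) = ?N * mat_inner (elementary_mat n i j) (Bs ! b)"
        by (rule mat_inner_avg) (use D b in auto)
      moreover have "mat_inner ?P (Bs ! b) = (\<Sum>a<?k. mat_inner (c a \<cdot>\<^sub>m Bs ! a) (Bs ! b))"
      proof -
        have "mat n n (($$) (c a \<cdot>\<^sub>m Bs ! a)) = c a \<cdot>\<^sub>m Bs ! a" if "a < ?k" for a
          using car[OF that] by (auto intro!: eq_matI)
        then show ?thesis unfolding c mat_inner_mat_sum by simp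
      qed
      moreover have "\<dots> = (\<Sum>a<?k. if a = b then c b * real n else 0)"
        by (intro sum.cong refl) (auto simp: mat_inner_smult_left[OF car] orth b)
      ultimately show ?thesis using b by (simp add: mat_inner_elementary[OF ij] mult.commute)
    qed
    have "real n * ?P $$ (i, j) = (\<Sum>a<?k. real n * c a * Bs ! a $$ (i, j))"
      unfolding c mat_sum_index[OF ij] sum_distrib_left
      by (intro sum.cong refl) (use ij car[THEN carrier_matD(1)] car[THEN carrier_matD(2)] in auto)
    also have "\<dots> = (\<Sum>a<?k. ?N * (Bs ! a $$ (i, j) * Bs ! a $$ (i, j)))"
      by (intro sum.cong refl) (simp add: coeff)
    finally show ?thesis by (simp add: sum_distrib_left)
  qed
  have "real n * (2 * (real n)\<^sup>2) = (\<Sum>i<n. \<Sum>j<n. ?N * (\<Sum>a<?k. Bs ! a $$ (i, j) * Bs ! a $$ (i, j)))"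
    unfolding trace_avg[symmetric] by (simp add: sum_distrib_left entry)
  also have "\<dots> = ?N * (\<Sum>i<n. \<Sum>j<n. \<Sum>a<?k. Bs ! a $$ (i, j) * Bs ! a $$ (i, j))"
    by (simp add: sum_distrib_left)
  also have "(\<Sum>i<n. \<Sum>j<n. \<Sum>a<?k. Bs ! a $$ (i, j) * Bs ! a $$ (i, j))
    = (\<Sum>i<n. \<Sum>a<?k. \<Sum>j<n. Bs ! a $$ (i, j) * Bs ! a $$ (i, j))"
    by (intro sum.cong refl sum.swap)
  also have "\<dots> = (\<Sum>a<?k. \<Sum>i<n. \<Sum>j<n. Bs ! a $$ (i, j) * Bs ! a $$ (i, j))"
    by (rule sum.swap)
  also have "\<dots> = (\<Sum>a<?k. mat_inner (Bs ! a) (Bs ! a))"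
    by (intro sum.cong refl) (simp add: mat_inner_def car[THEN carrier_matD(1)] car[THEN carrier_matD(2)])
  also have "\<dots> = real ?k * real n" by (simp add: orth)
  finally have "real (length Bs * 2 ^ (r - 1)) = real (2 * n\<^sup>2)" using n_pos by (simp add: mult_ac)
  then have "length Bs * 2 ^ (r - 1) = 2 * n\<^sup>2" by (simp only: of_nat_eq_iff)
  then show ?thesis using r_pos by (cases r) auto
qed

end

section \<open>Amplification\<close>

lemma sum_lessThan_mult:
  fixes f :: "nat \<Rightarrow> nat \<Rightarrow> 'a::comm_monoid_add"
  shows "(\<Sum>t<d * m. f (t div m) (t mod m)) = (\<Sum>k<d. \<Sum>c<m. f k c)"
proof -
  have "(\<Sum>k<d. \<Sum>c<m. f k c) = (\<Sum>(k, c)\<in>{..<d} \<times> {..<m}. f k c)"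
    by (rule sum.cartesian_product)
  also have "\<dots> = (\<Sum>t<d * m. f (t div m) (t mod m))"
  proof (rule sum.reindex_bij_witness[of _ "\<lambda>t. (t div m, t mod m)" "\<lambda>(k, c). k * m + c"])
    fix t assume t: "t \<in> {..<d * m}"
    then have "0 < m" by (cases m) auto
    then show "(t div m, t mod m) \<in> {..<d} \<times> {..<m}"
      using t by (auto simp: less_mult_imp_div_less)
  next
    fix p assume "p \<in> {..<d} \<times> {..<m}"
    then obtain k c where p: "p = (k, c)" "k < d" "c < m" by auto
    have "k * m + c < Suc k * m" using p by simp
    also have "\<dots> \<le> d * m" using p by (intro mult_le_mono1) simp
    finally show "(case p of (k, c) \<Rightarrow> k * m + c) \<in> {..<d * m}" using p by simp
  qed auto
  finally show ?thesis by simp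
qed

lemma kron_index_less: "i < d \<Longrightarrow> a < m \<Longrightarrow> i * m + a < d * (m::nat)"
proof -
  assume "i < d" "a < m"
  then have "i * m + a < Suc i * m" by simp
  also have "\<dots> \<le> d * m" using \<open>i < d\<close> by (intro mult_le_mono1) simp
  finally show ?thesis .
qed

text \<open>Via \<open>slice\<close>, a \<open>d m \<times> d m'\<close> matrix becomes an \<open>m \<times> m'\<close> matrix of \<open>d \<times> d\<close> matrices; the index
  \<open>i * m + a\<close> matches the lexicographic order in \<open>kronecker\<close>.\<close>

definition slice :: "nat \<Rightarrow> nat \<Rightarrow> nat \<Rightarrow> real mat \<Rightarrow> nat \<Rightarrow> nat \<Rightarrow> real mat" where
  "slice d m m' M a b = mat d d (\<lambda>(i, j). M $$ (i * m + a, j * m' + b))"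

lemma slice_carrier [simp]: "slice d m m' M a b \<in> carrier_mat d d"
  by (simp add: slice_def)

lemma slice_dim [simp]: "dim_row (slice d m m' M a b) = d" "dim_col (slice d m m' M a b) = d"
  by (simp_all add: slice_def)

lemma slice_index [simp]:
  "i < d \<Longrightarrow> j < d \<Longrightarrow> slice d m m' M a b $$ (i, j) = M $$ (i * m + a, j * m' + b)"
  by (simp add: slice_def)

lemma slice_eqI:
  assumes M: "M \<in> carrier_mat (d * m) (d * m')" and N: "N \<in> carrier_mat (d * m) (d * m')"
    and eq: "\<And>a b. a < m \<Longrightarrow> b < m' \<Longrightarrow> slice d m m' M a b = slice d m m' N a b"
  shows "M = N"
proof (rule eq_matI)
  fix p q assume "p < dim_row N" "q < dim_col N"
  then have pq: "p < d * m" "q < d * m'" using N by auto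
  then have "0 < m" "0 < m'" by (auto intro: gr0I)
  then have r: "p div m < d" "p mod m < m" "q div m' < d" "q mod m' < m'"
    using pq by (auto simp: less_mult_imp_div_less)
  have "slice d m m' M (p mod m) (q mod m') $$ (p div m, q div m')
    = slice d m m' N (p mod m) (q mod m') $$ (p div m, q div m')" using eq r by simp
  then show "M $$ (p, q) = N $$ (p, q)" using r by simp
qed (use M N in auto)

text \<open>Slices multiply like the entries of a matrix over \<open>d\<close> by \<open>d\<close>
  matrices. Entrywise, the sum over \<open>c\<close> becomes a sum of reals.\<close>

lemma slice_mult_index:
  assumes M: "M \<in> carrier_mat (d * m) (d * l)" and N: "N \<in> carrier_mat (d * l) (d * m')"
    and ab: "a < m" "b < m'" and ij: "i < d" "j < d"
  shows "slice d m m' (M * N) a b $$ (i, j) =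
    (\<Sum>c<l. (slice d m l M a c * slice d l m' N c b) $$ (i, j))"
proof -
  have "slice d m m' (M * N) a b $$ (i, j)
    = (\<Sum>t<d * l. M $$ (i * m + a, (t div l) * l + t mod l) * N $$ ((t div l) * l + t mod l, j * m' + b))"
    using M N ij kron_index_less[OF ij(1) ab(1)] kron_index_less[OF ij(2) ab(2)]
    by (simp add: scalar_prod_def atLeast0LessThan)
  also have "\<dots> = (\<Sum>k<d. \<Sum>c<l. M $$ (i * m + a, k * l + c) * N $$ (k * l + c, j * m' + b))"
    by (rule sum_lessThan_mult)
  also have "\<dots> = (\<Sum>c<l. \<Sum>k<d. M $$ (i * m + a, k * l + c) * N $$ (k * l + c, j * m' + b))"
    by (rule sum.swap)
  also have "\<dots> = (\<Sum>c<l. (slice d m l M a c * slice d l m' N c b) $$ (i, j))"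
    using ij by (intro sum.cong) (auto simp: scalar_prod_def atLeast0LessThan slice_def)
  finally show ?thesis .
qed

lemma kronecker_one_carrier: "A \<in> carrier_mat d d \<Longrightarrow> kronecker A (1\<^sub>m m) \<in> carrier_mat (d * m) (d * m)"
  by (simp add: kronecker_def)

lemma slice_kronecker_one:
  assumes "A \<in> carrier_mat d d" "a < m" "b < m"
  shows "slice d m m (kronecker A (1\<^sub>m m)) a b = (if a = b then A else 0\<^sub>m d d)"
  using assms kron_index_less by (intro eq_matI) (auto simp: kronecker_def slice_def)

lemma slice_mult_kronecker_one:
  assumes M: "M \<in> carrier_mat (d * m) (d * m')" and A: "A \<in> carrier_mat d d" and ab: "a < m" "b < m'"
  shows "slice d m m' (M * kronecker A (1\<^sub>m m')) a b = slice d m m' M a b * A"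
proof (rule eq_matI)
  fix i j assume "i < dim_row (slice d m m' M a b * A)" "j < dim_col (slice d m m' M a b * A)"
  then have ij: "i < d" "j < d" using A by (auto simp: slice_def)
  have "slice d m m' (M * kronecker A (1\<^sub>m m')) a b $$ (i, j)
    = (\<Sum>c<m'. (slice d m m' M a c * (if c = b then A else 0\<^sub>m d d)) $$ (i, j))"
    using M A ab ij
    by (subst slice_mult_index[where l = m']) (auto simp: slice_kronecker_one kronecker_one_carrier simp del: index_mult_mat)
  also have "\<dots> = (\<Sum>c<m'. if c = b then (slice d m m' M a b * A) $$ (i, j) else 0)"
    using ij by (intro sum.cong) (auto simp del: index_mult_mat(1) simp: right_mult_zero_mat[OF slice_carrier])
  finally show "slice d m m' (M * kronecker A (1\<^sub>m m')) a b $$ (i, j) = (slice d m m' M a b * A) $$ (i, j)"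
    using ab by simp
qed (use A in \<open>auto simp: slice_def\<close>)

lemma slice_kronecker_one_mult:
  assumes M: "M \<in> carrier_mat (d * m) (d * m')" and A: "A \<in> carrier_mat d d" and ab: "a < m" "b < m'"
  shows "slice d m m' (kronecker A (1\<^sub>m m) * M) a b = A * slice d m m' M a b"
proof (rule eq_matI)
  fix i j assume "i < dim_row (A * slice d m m' M a b)" "j < dim_col (A * slice d m m' M a b)"
  then have ij: "i < d" "j < d" using A by (auto simp: slice_def)
  have "slice d m m' (kronecker A (1\<^sub>m m) * M) a b $$ (i, j)
    = (\<Sum>c<m. ((if a = c then A else 0\<^sub>m d d) * slice d m m' M c b) $$ (i, j))"
    using M A ab ij
    by (subst slice_mult_index[where l = m]) (auto simp: slice_kronecker_one kronecker_one_carrier simp del: index_mult_mat)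
  also have "\<dots> = (\<Sum>c<m. if c = a then (A * slice d m m' M a b) $$ (i, j) else 0)"
    using ij by (intro sum.cong) (auto simp del: index_mult_mat(1) simp: left_mult_zero_mat[OF slice_carrier])
  finally show "slice d m m' (kronecker A (1\<^sub>m m) * M) a b $$ (i, j) = (A * slice d m m' M a b) $$ (i, j)"
    using ab by simp
qed (use A in \<open>auto simp: slice_def\<close>)

text \<open>A Kronecker product with an identity multiplies every slice separately. The sizes
  \<open>m\<close>, \<open>m'\<close> and the actions \<open>A\<close>, \<open>B\<close> may differ,
  so that off-diagonal blocks are covered too.\<close>

lemma kronecker_one_intertwiner_iff:
  assumes M: "M \<in> carrier_mat (d * m) (d * m')" and A: "A \<in> carrier_mat d d" and B: "B \<in> carrier_mat d d"
  shows "M * kronecker A (1\<^sub>m m') = kronecker B (1\<^sub>m m) * M \<longleftrightarrow>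
    (\<forall>a<m. \<forall>b<m'. slice d m m' M a b * A = B * slice d m m' M a b)" (is "?l = ?r \<longleftrightarrow> _")
proof -
  have c: "?l \<in> carrier_mat (d * m) (d * m')" "?r \<in> carrier_mat (d * m) (d * m')"
    using M A B kronecker_one_carrier by (meson mult_carrier_mat)+
  have "?l = ?r \<longleftrightarrow> (\<forall>a<m. \<forall>b<m'. slice d m m' ?l a b = slice d m m' ?r a b)"
    using slice_eqI[OF c] by auto
  then show ?thesis
    by (simp add: slice_mult_kronecker_one[OF M A] slice_kronecker_one_mult[OF M B])
qed

text \<open>Treats at once the real numbers with trivial conjugation and the quaternions with
  \<open>qcnj\<close>. Through \<open>phi_cj\<close>, conjugation becomes transposition.\<close>

locale matrix_star_embedding =
  fixes d :: nat and \<phi> :: "'k::real_algebra_1 \<Rightarrow> real mat" and cj :: "'k \<Rightarrow> 'k"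
  assumes phi_carrier [simp]: "\<phi> x \<in> carrier_mat d d"
    and phi_add: "\<phi> (x + y) = \<phi> x + \<phi> y"
    and phi_scale: "\<phi> (c *\<^sub>R x) = c \<cdot>\<^sub>m \<phi> x"
    and phi_mult: "\<phi> (x * y) = \<phi> x * \<phi> y"
    and phi_cj: "\<phi> (cj x) = transpose_mat (\<phi> x)"
    and phi_inj: "\<phi> x = \<phi> y \<Longrightarrow> x = y"
begin

lemma phi_dim [simp]: "dim_row (\<phi> x) = d" "dim_col (\<phi> x) = d"
  by (rule carrier_matD[OF phi_carrier])+

text \<open>The remainder modulo \<open>m\<close> selects the entry of \<open>C\<close> and the
  quotient the position inside its image, as in \<open>slice\<close>; so the slices of
  \<open>amp m C\<close> are the images of the entries of \<open>C\<close>.\<close>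

definition amp :: "nat \<Rightarrow> 'k mat \<Rightarrow> real mat" where
  "amp m C = mat (d * m) (d * m) (\<lambda>(p, q). \<phi> (C $$ (p mod m, q mod m)) $$ (p div m, q div m))"

lemma phi_zero: "\<phi> 0 = 0\<^sub>m d d"
proof -
  have "\<phi> 0 $$ (i, j) = 0" if "i < d" "j < d" for i j
    using arg_cong[OF phi_scale[of 0 0], of "\<lambda>M. M $$ (i, j)"] that by simp
  then show ?thesis by (auto intro!: eq_matI)
qed

lemma phi_sum_index:
  assumes "i < d" "j < d"
  shows "\<phi> (\<Sum>c\<in>A. f c) $$ (i, j) = (\<Sum>c\<in>A. \<phi> (f c) $$ (i, j))"
  by (induction A rule: infinite_finite_induct)
    (use assms phi_carrier[THEN carrier_matD(1)] phi_carrier[THEN carrier_matD(2)] in \<open>simp_all add: phi_zero phi_add\<close>)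

lemma amp_carrier [simp]: "amp m C \<in> carrier_mat (d * m) (d * m)"
  by (simp add: amp_def)

lemma amp_dim [simp]: "dim_row (amp m C) = d * m" "dim_col (amp m C) = d * m"
  by (simp_all add: amp_def)

lemma slice_amp: "a < m \<Longrightarrow> b < m \<Longrightarrow> slice d m m (amp m C) a b = \<phi> (C $$ (a, b))"
  using kron_index_less[of _ d a m] kron_index_less[of _ d b m]
  by (intro eq_matI) (auto simp: amp_def slice_def)

lemma amp_eqI:
  assumes "M \<in> carrier_mat (d * m) (d * m)" "\<And>a b. a < m \<Longrightarrow> b < m \<Longrightarrow> slice d m m M a b = \<phi> (C $$ (a, b))"
  shows "amp m C = M"
  by (rule slice_eqI[OF amp_carrier assms(1)]) (simp add: slice_amp assms(2))

lemma amp_inj: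
  assumes "C \<in> carrier_mat m m" "C' \<in> carrier_mat m m" "amp m C = amp m C'"
  shows "C = C'"
proof (rule eq_matI)
  fix a b assume "a < dim_row C'" "b < dim_col C'"
  then have ab: "a < m" "b < m" using assms by auto
  then have "\<phi> (C $$ (a, b)) = \<phi> (C' $$ (a, b))" using assms(3) slice_amp by metis
  then show "C $$ (a, b) = C' $$ (a, b)" by (rule phi_inj)
qed (use assms in auto)

lemma amp_add:
  assumes "C \<in> carrier_mat m m" "C' \<in> carrier_mat m m"
  shows "amp m (C + C') = amp m C + amp m C'"
proof (rule amp_eqI)
  fix a b assume ab: "a < m" "b < m"
  have "slice d m m (amp m C + amp m C') a b = slice d m m (amp m C) a b + slice d m m (amp m C') a b"
    using ab kron_index_less[of _ d a m] kron_index_less[of _ d b m] amp_carrier[of m C']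
    by (intro eq_matI) (auto simp: slice_def)
  then show "slice d m m (amp m C + amp m C') a b = \<phi> ((C + C') $$ (a, b))"
    using ab assms by (simp add: slice_amp phi_add)
qed simp

lemma amp_scale:
  assumes "C \<in> carrier_mat m m"
  shows "amp m (map_mat (scaleR c) C) = map_mat (scaleR c) (amp m C)"
proof (rule amp_eqI)
  fix a b assume ab: "a < m" "b < m"
  have "slice d m m (map_mat (scaleR c) (amp m C)) a b = c \<cdot>\<^sub>m slice d m m (amp m C) a b"
    using ab kron_index_less[of _ d a m] kron_index_less[of _ d b m] amp_carrier[of m C]
    by (intro eq_matI) (auto simp: slice_def)
  then show "slice d m m (map_mat (scaleR c) (amp m C)) a b = \<phi> ((map_mat (scaleR c) C) $$ (a, b))"
    using ab assms by (simp add: slice_amp phi_scale)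
qed simp

lemma amp_uminus: "C \<in> carrier_mat m m \<Longrightarrow> amp m (- C) = - amp m C"
proof -
  assume C: "C \<in> carrier_mat m m"
  have "- C = map_mat (scaleR (- 1)) C" by (auto intro!: eq_matI)
  then have "amp m (- C) = map_mat (scaleR (- 1)) (amp m C)" using amp_scale[OF C] by simp
  then show ?thesis by (auto intro!: eq_matI)
qed

lemma amp_mult:
  assumes "C \<in> carrier_mat m m" "C' \<in> carrier_mat m m"
  shows "amp m (C * C') = amp m C * amp m C'"
proof (rule amp_eqI)
  fix a b assume ab: "a < m" "b < m"
  show "slice d m m (amp m C * amp m C') a b = \<phi> ((C * C') $$ (a, b))"
  proof (rule eq_matI)
    fix i j assume "i < dim_row (\<phi> ((C * C') $$ (a, b)))" "j < dim_col (\<phi> ((C * C') $$ (a, b)))"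
    then have ij: "i < d" "j < d" using phi_carrier[of "(C * C') $$ (a, b)"] by auto
    have "slice d m m (amp m C * amp m C') a b $$ (i, j)
      = (\<Sum>c<m. (slice d m m (amp m C) a c * slice d m m (amp m C') c b) $$ (i, j))"
      by (rule slice_mult_index) (use ab ij in auto)
    also have "\<dots> = (\<Sum>c<m. \<phi> (C $$ (a, c) * C' $$ (c, b)) $$ (i, j))"
      using ab by (intro sum.cong) (simp_all add: slice_amp phi_mult)
    also have "\<dots> = \<phi> (\<Sum>c<m. C $$ (a, c) * C' $$ (c, b)) $$ (i, j)"
      using ij by (simp add: phi_sum_index)
    also have "(\<Sum>c<m. C $$ (a, c) * C' $$ (c, b)) = (C * C') $$ (a, b)"
      using assms ab by (simp add: scalar_prod_def atLeast0LessThan)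
    finally show "slice d m m (amp m C * amp m C') a b $$ (i, j) = \<phi> ((C * C') $$ (a, b)) $$ (i, j)" .
  qed (use phi_carrier[of "(C * C') $$ (a, b)"] in \<open>auto simp: slice_def\<close>)
qed (meson amp_carrier mult_carrier_mat)

lemma amp_transpose:
  assumes "C \<in> carrier_mat m m"
  shows "amp m (map_mat cj (transpose_mat C)) = transpose_mat (amp m C)"
proof (rule amp_eqI)
  fix a b assume ab: "a < m" "b < m"
  have "slice d m m (transpose_mat (amp m C)) a b = transpose_mat (slice d m m (amp m C) b a)"
    using ab kron_index_less[of _ d a m] kron_index_less[of _ d b m] amp_carrier[of m C]
    by (intro eq_matI) (auto simp: slice_def)
  then show "slice d m m (transpose_mat (amp m C)) a b = \<phi> ((map_mat cj (transpose_mat C)) $$ (a, b))"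
    using ab assms by (simp add: slice_amp phi_cj)
qed simp

lemma amp_surj:
  assumes M: "M \<in> carrier_mat (d * m) (d * m)" and r: "\<And>a b. a < m \<Longrightarrow> b < m \<Longrightarrow> slice d m m M a b \<in> range \<phi>"
  obtains C where "C \<in> carrier_mat m m" "amp m C = M"
proof
  show "mat m m (\<lambda>(a, b). inv_into UNIV \<phi> (slice d m m M a b)) \<in> carrier_mat m m" by simp
  show "amp m (mat m m (\<lambda>(a, b). inv_into UNIV \<phi> (slice d m m M a b))) = M"
    by (rule amp_eqI[OF M]) (use r in \<open>simp add: f_inv_into_f\<close>)
qed

text \<open>This is where the real condition defining so(dm) becomes the skew-Hermitian condition
  over \<open>'k\<close>: amplification turns conjugate transposition into transposition and is
  injective.\<close>

lemma amp_antisymmetric_iff: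
  assumes "C \<in> carrier_mat m m"
  shows "transpose_mat (amp m C) = - amp m C \<longleftrightarrow> map_mat cj (transpose_mat C) = - C"
  unfolding amp_transpose[OF assms, symmetric] amp_uminus[OF assms, symmetric]
  using assms by (auto dest: amp_inj[rotated 2])

end

section \<open>Determination of the commutant\<close>

lemma (in half_spin) anti_inner:
  assumes "anti X"
  shows "mat_inner (1\<^sub>m n) X = 0"
proof -
  note X = anti_carrier[OF assms]
  have "mat_inner (1\<^sub>m n) X = mat_inner (transpose_mat (1\<^sub>m n)) (transpose_mat X)"
    using X by (intro mat_inner_transpose[symmetric, of _ n n]) auto
  also have "\<dots> = - mat_inner (1\<^sub>m n) X"
    using X anti_transpose[OF assms] by (simp add: mat_inner_def sum_negf)
  finally show ?thesis by simp
qed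

text \<open>Reduces pairings of imaginary units to traces of their products, which are up to sign
  again units or the identity.\<close>

lemma (in half_spin) mat_inner_as_trace:
  assumes "X \<in> carrier_mat n n" "Y \<in> carrier_mat n n"
  shows "mat_inner X Y = mat_inner (1\<^sub>m n) (transpose_mat X * Y)"
  using mat_inner_mult_left[of X n n "1\<^sub>m n" n Y] assms by simp

lemma half_spin_dim_sq:
  assumes "1 \<le> r"
  shows "r mod 8 = 0 \<Longrightarrow> 4 * (half_spin_dim r)\<^sup>2 = 2 ^ r" "r mod 8 = 4 \<Longrightarrow> (half_spin_dim r)\<^sup>2 = 2 ^ r"
proof -
  show "4 * (half_spin_dim r)\<^sup>2 = 2 ^ r" if "r mod 8 = 0"
  proof -
    have "8 dvd r" using that by presburger
    then obtain k where k: "r = 8 * k" by (rule dvdE)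
    \<comment> \<open>Positivity of \<open>r\<close> keeps \<open>r div 2 - 1\<close> from being
      truncated; at \<open>r = 0\<close> the identity fails.\<close>
    then obtain l where l: "k = Suc l" using assms by (cases k) auto
    have "half_spin_dim r = 2 ^ (4 * l + 3)" using that by (simp add: half_spin_dim_def k l)
    then show ?thesis by (simp add: k l power_mult[symmetric] power_add algebra_simps)
  qed
  show "(half_spin_dim r)\<^sup>2 = 2 ^ r" if "r mod 8 = 4"
  proof -
    have "even r" using that by presburger
    then show ?thesis using that by (auto simp: half_spin_dim_def power_mult[symmetric] elim!: evenE)
  qed
qed

context half_spin
begin

lemma real_length:
  assumes "\<And>X. X \<in> D \<Longrightarrow> \<exists>a. X = a \<cdot>\<^sub>m 1\<^sub>m n"
  shows "2 ^ r = 4 * n\<^sup>2"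
proof -
  have "length [1\<^sub>m n :: real mat] * 2 ^ r = 4 * n\<^sup>2"
  proof (rule orthogonal_basis_length)
    fix X assume "X \<in> D"
    then obtain a where a: "X = a \<cdot>\<^sub>m 1\<^sub>m n" using assms by blast
    show "\<exists>c. X = mat_sum n (\<lambda>k. c k \<cdot>\<^sub>m [1\<^sub>m n] ! k) {..<length [1\<^sub>m n :: real mat]}"
      by (rule exI[of _ "\<lambda>_. a"]) (auto simp: a mat_sum_def intro!: eq_matI)
  qed (use one_D in \<open>auto simp: mat_inner_one_self\<close>)
  then show ?thesis by simp
qed

text \<open>Serves to refute the complex case: the conclusion contradicts both
  \<open>4 * n\<^sup>2 = 2 ^ r\<close> and \<open>n\<^sup>2 = 2 ^ r\<close>.\<close>

lemma complex_length:
  assumes I: "anti I" "I * I = - 1\<^sub>m n" and span: "\<And>X. X \<in> D \<Longrightarrow> \<exists>a b. X = a \<cdot>\<^sub>m 1\<^sub>m n + b \<cdot>\<^sub>m I"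
  shows "2 * 2 ^ r = 4 * n\<^sup>2"
proof -
  note Ic = anti_carrier[OF I(1)]
  have "length [1\<^sub>m n, I] * 2 ^ r = 4 * n\<^sup>2"
  proof (rule orthogonal_basis_length)
    fix X assume "X \<in> D"
    then obtain a b where ab: "X = a \<cdot>\<^sub>m 1\<^sub>m n + b \<cdot>\<^sub>m I" using span by blast
    show "\<exists>c. X = mat_sum n (\<lambda>k. c k \<cdot>\<^sub>m [1\<^sub>m n, I] ! k) {..<length [1\<^sub>m n, I]}"
      by (rule exI[of _ "\<lambda>k. [a, b] ! k"]) (use Ic in \<open>auto simp: ab mat_sum_def lessThan_Suc intro!: eq_matI\<close>)
  next
    have "mat_inner I I = real n"
      using Ic I anti_transpose[OF I(1)] by (simp add: mat_inner_as_trace[of I I] mat_inner_one_self)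
    moreover have "mat_inner I (1\<^sub>m n) = 0"
      using anti_inner[OF I(1)] mat_inner_commute[OF Ic, of "1\<^sub>m n"] by simp
    ultimately show "mat_inner ([1\<^sub>m n, I] ! a) ([1\<^sub>m n, I] ! b) = (if a = b then real n else 0)"
      if "a < length [1\<^sub>m n, I]" "b < length [1\<^sub>m n, I]" for a b
      using that by (auto simp: less_Suc_eq mat_inner_one_self anti_inner[OF I(1)])
  qed (use one_D anti_D[OF I(1)] in auto)
  then show ?thesis by simp
qed

lemma quaternionic_length:
  assumes q: "quaternion_units I J"
  shows "4 * 2 ^ r = 4 * n\<^sup>2"
proof -
  have I: "anti I" "I * I = - 1\<^sub>m n" and J: "anti J" "J * J = - 1\<^sub>m n"
    using q by (auto simp: quaternion_units_def)
  define K where "K = I * J"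
  note prods = quaternion_units_products[OF q, folded K_def]
  have K: "anti K"
    unfolding anti_def K_def using prods(6) anti_D[OF I(1)] anti_D[OF J(1)] mult_D by (simp add: K_def)
  note car = anti_carrier[OF I(1)] anti_carrier[OF J(1)] anti_carrier[OF K]
  note tr = anti_transpose[OF I(1)] anti_transpose[OF J(1)] anti_transpose[OF K]
  let ?Bs = "[1\<^sub>m n, I, J, K]"
  have "length ?Bs * 2 ^ r = 4 * n\<^sup>2"
  proof (rule orthogonal_basis_length)
    fix X assume "X \<in> D"
    then obtain a b c e where X: "X = a \<cdot>\<^sub>m 1\<^sub>m n + b \<cdot>\<^sub>m I + c \<cdot>\<^sub>m J + e \<cdot>\<^sub>m K"
      using quaternion_units_span[OF q] unfolding K_def by blast
    show "\<exists>c. X = mat_sum n (\<lambda>k. c k \<cdot>\<^sub>m ?Bs ! k) {..<length ?Bs}"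
      by (rule exI[of _ "\<lambda>k. [a, b, c, e] ! k"]) (use car in \<open>auto simp: X mat_sum_def lessThan_Suc intro!: eq_matI\<close>)
  next
    have neg: "mat_inner (1\<^sub>m n) (- X) = - mat_inner (1\<^sub>m n) X" if "X \<in> carrier_mat n n" for X
      using that by (simp add: mat_inner_def sum_negf)
    have self: "mat_inner I I = real n" "mat_inner J J = real n" "mat_inner K K = real n"
      using car tr I(2) J(2) prods(5) by (simp_all add: mat_inner_as_trace[of I I] mat_inner_as_trace[of J J]
          mat_inner_as_trace[of K K] mat_inner_one_self)
    have diff: "mat_inner I J = 0" "mat_inner I K = 0" "mat_inner J K = 0"
      using car tr prods anti_inner[OF I(1)] anti_inner[OF J(1)] anti_inner[OF K]
      by (simp_all add: mat_inner_as_trace[of I J] mat_inner_as_trace[of I K] mat_inner_as_trace[of J K]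
          neg K_def[symmetric])
    have diff': "mat_inner J I = 0" "mat_inner K I = 0" "mat_inner K J = 0"
      using diff mat_inner_commute car by metis+
    have one: "mat_inner I (1\<^sub>m n) = 0" "mat_inner J (1\<^sub>m n) = 0" "mat_inner K (1\<^sub>m n) = 0"
      using car anti_inner I J K mat_inner_commute one_carrier_mat by metis+
    show "mat_inner (?Bs ! a) (?Bs ! b) = (if a = b then real n else 0)"
      if "a < length ?Bs" "b < length ?Bs" for a b
      using that self diff diff' one
      by (auto simp: less_Suc_eq mat_inner_one_self anti_inner[OF I(1)] anti_inner[OF J(1)] anti_inner[OF K])
  qed (use one_D anti_D[OF I(1)] anti_D[OF J(1)] anti_D[OF K] in auto)
  then show ?thesis by simp
qed

lemma commutant_real:
  assumes "r mod 8 = 0" "X \<in> D"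
  shows "\<exists>a. X = a \<cdot>\<^sub>m 1\<^sub>m n"
proof (cases rule: structure_cases)
  case real
  then show ?thesis using assms by blast
next
  case (complex I)
  then show ?thesis using complex_length[of I] half_spin_dim_sq(1)[OF r_pos assms(1)] by simp
next
  case (quaternionic I J)
  then show ?thesis using quaternionic_length[of I J] half_spin_dim_sq(1)[OF r_pos assms(1)] by simp
qed

lemma commutant_quaternionic:
  assumes "r mod 8 = 4"
  obtains I J where "quaternion_units I J"
proof (cases rule: structure_cases)
  case real
  then show ?thesis using real_length half_spin_dim_sq(2)[OF r_pos assms(1)] by simp
next
  case (complex I)
  then show ?thesis using complex_length[of I] half_spin_dim_sq(2)[OF r_pos assms(1)] by simp
qed

lemma real_embedding:
  assumes "r mod 8 = 0"
  shows "matrix_star_embedding n (\<lambda>a :: real. a \<cdot>\<^sub>m 1\<^sub>m n) (\<lambda>x. x)" "range (\<lambda>a :: real. a \<cdot>\<^sub>m 1\<^sub>m n) = D"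
proof -
  show "matrix_star_embedding n (\<lambda>a :: real. a \<cdot>\<^sub>m 1\<^sub>m n) (\<lambda>x. x)"
  proof
    fix x y :: real assume "x \<cdot>\<^sub>m 1\<^sub>m n = y \<cdot>\<^sub>m 1\<^sub>m n"
    then have "(x \<cdot>\<^sub>m 1\<^sub>m n) $$ (0, 0) = (y \<cdot>\<^sub>m 1\<^sub>m n) $$ (0, 0)" by simp
    then show "x = y" using n_pos by simp
  next
    fix x y :: real
    show "(x * y) \<cdot>\<^sub>m 1\<^sub>m n = (x \<cdot>\<^sub>m 1\<^sub>m n) * (y \<cdot>\<^sub>m 1\<^sub>m n)"
      by (simp add: mult_smult_distrib[of _ n n _ n] mult_smult_assoc_mat[of _ n n _ n]) (auto intro!: eq_matI)
  qed (auto intro!: eq_matI simp: algebra_simps)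
  show "range (\<lambda>a :: real. a \<cdot>\<^sub>m 1\<^sub>m n) = D"
    using commutant_real[OF assms] one_D smult_D by blast
qed

lemma quaternion_embedding:
  assumes q: "quaternion_units I J"
  defines "\<phi> \<equiv> \<lambda>x. qre x \<cdot>\<^sub>m 1\<^sub>m n + qi x \<cdot>\<^sub>m I + qj x \<cdot>\<^sub>m J + qk x \<cdot>\<^sub>m (I * J)"
  shows "matrix_star_embedding n \<phi> qcnj" "range \<phi> = D"
proof -
  have I: "anti I" "I * I = - 1\<^sub>m n" and J: "anti J" "J * J = - 1\<^sub>m n" and JI: "J * I = - (I * J)"
    using q by (auto simp: quaternion_units_def)
  define K where "K = I * J"
  note prods = quaternion_units_products[OF q, folded K_def] I(2) J(2) K_def[symmetric] JI[folded K_def]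
  have K: "anti K"
    unfolding anti_def K_def using prods(6) anti_D[OF I(1)] anti_D[OF J(1)] mult_D by (simp add: K_def)
  note car = anti_carrier[OF I(1)] anti_carrier[OF J(1)] anti_carrier[OF K]
  note tr = anti_transpose[OF I(1)] anti_transpose[OF J(1)] anti_transpose[OF K]
  have phi: "\<phi> x = qre x \<cdot>\<^sub>m 1\<^sub>m n + qi x \<cdot>\<^sub>m I + qj x \<cdot>\<^sub>m J + qk x \<cdot>\<^sub>m K" for x
    by (simp add: \<phi>_def K_def)
  have carrier: "\<phi> x \<in> carrier_mat n n" for x using car by (simp add: phi)
  have add: "\<phi> (x + y) = \<phi> x + \<phi> y" for x y
    using car by (intro eq_matI) (auto simp: phi plus_quaternion_def algebra_simps)
  have scale: "\<phi> (c *\<^sub>R x) = c \<cdot>\<^sub>m \<phi> x" for c x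
    using car by (intro eq_matI) (auto simp: phi scaleR_quaternion_def algebra_simps)
  have mult: "\<phi> (x * y) = \<phi> x * \<phi> y" for x y
  proof -
    \<comment> \<open>Expanded along the components of \<open>y\<close>, with every product of units
      evaluated by \<open>prods\<close>; the comparison with \<open>\<phi> (x * y)\<close> is then
      an identity of reals in each entry.\<close>
    have "\<phi> x * \<phi> y =
      qre y \<cdot>\<^sub>m (qre x \<cdot>\<^sub>m 1\<^sub>m n + qi x \<cdot>\<^sub>m I + qj x \<cdot>\<^sub>m J + qk x \<cdot>\<^sub>m K) +
      qi y \<cdot>\<^sub>m (qre x \<cdot>\<^sub>m I + qi x \<cdot>\<^sub>m - 1\<^sub>m n + qj x \<cdot>\<^sub>m - K + qk x \<cdot>\<^sub>m J) +
      qj y \<cdot>\<^sub>m (qre x \<cdot>\<^sub>m J + qi x \<cdot>\<^sub>m K + qj x \<cdot>\<^sub>m - 1\<^sub>m n + qk x \<cdot>\<^sub>m - I) +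
      qk y \<cdot>\<^sub>m (qre x \<cdot>\<^sub>m K + qi x \<cdot>\<^sub>m - J + qj x \<cdot>\<^sub>m I + qk x \<cdot>\<^sub>m - 1\<^sub>m n)"
      unfolding phi using car
      by (simp add: mult_add_distrib_mat[of _ n n _ n] add_mult_distrib_mat[of _ n n _ _ n]
          mult_smult_distrib[of _ n n _ n] mult_smult_assoc_mat[of _ n n _ n] prods)
    also have "\<dots> = \<phi> (x * y)"
      unfolding phi using car by (intro eq_matI) (auto simp: times_quaternion_def algebra_simps)
    finally show ?thesis by simp
  qed
  have cnj: "\<phi> (qcnj x) = transpose_mat (\<phi> x)" for x
  proof -
    have smult: "transpose_mat (c \<cdot>\<^sub>m X) = c \<cdot>\<^sub>m transpose_mat X" for c and X :: "real mat"
      by (auto intro!: eq_matI)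
    have "transpose_mat (\<phi> x) = qre x \<cdot>\<^sub>m 1\<^sub>m n + qi x \<cdot>\<^sub>m - I + qj x \<cdot>\<^sub>m - J + qk x \<cdot>\<^sub>m - K"
      unfolding phi using car tr by (simp add: transpose_add[of _ n n] smult)
    also have "\<dots> = \<phi> (qcnj x)"
      unfolding phi using car by (intro eq_matI) (auto simp: qcnj_def)
    finally show ?thesis by simp
  qed
  \<comment> \<open>By linearity only the kernel matters. \<open>qcnj z * z\<close> is the real
    quaternion given by the squared norm of \<open>z\<close>, so \<open>\<phi> z = 0\<close> forces
    that norm to vanish.\<close>
  have inj: "x = y" if eq: "\<phi> x = \<phi> y" for x y
  proof -
    define z where "z = x + (- 1) *\<^sub>R y"
    have "\<phi> z = 0\<^sub>m n n" unfolding z_def add scale eq using carrier[of y] by (auto intro!: eq_matI)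
    then have 0: "\<phi> (qcnj z * z) = 0\<^sub>m n n" unfolding mult using carrier[of "qcnj z"] by simp
    have "qcnj z * z = Quat ((qre z)\<^sup>2 + (qi z)\<^sup>2 + (qj z)\<^sup>2 + (qk z)\<^sup>2) 0 0 0"
      by (simp add: times_quaternion_def qcnj_def power2_eq_square)
    then have "\<phi> (qcnj z * z) $$ (0, 0) = (qre z)\<^sup>2 + (qi z)\<^sup>2 + (qj z)\<^sup>2 + (qk z)\<^sup>2"
      using car n_pos by (simp add: phi)
    then have "(qre z)\<^sup>2 + (qi z)\<^sup>2 + (qj z)\<^sup>2 + (qk z)\<^sup>2 = 0" using 0 n_pos by simp
    then have "qre z = 0 \<and> qi z = 0 \<and> qj z = 0 \<and> qk z = 0"
      by (smt (verit) zero_le_power2 power2_eq_iff_nonneg power_zero_numeral zero_eq_power2)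
    then show ?thesis
      by (cases x, cases y) (simp add: z_def plus_quaternion_def scaleR_quaternion_def)
  qed
  show "matrix_star_embedding n \<phi> qcnj"
    using carrier add scale mult cnj inj by (intro matrix_star_embedding.intro)
  show "range \<phi> = D"
  proof
    show "range \<phi> \<subseteq> D"
      unfolding phi
      by (intro image_subsetI add_D smult_D one_D anti_D[OF I(1)] anti_D[OF J(1)] anti_D[OF K])
    show "D \<subseteq> range \<phi>"
    proof
      fix X assume "X \<in> D"
      then obtain a b c e where "X = a \<cdot>\<^sub>m 1\<^sub>m n + b \<cdot>\<^sub>m I + c \<cdot>\<^sub>m J + e \<cdot>\<^sub>m (I * J)"
        using quaternion_units_span[OF q] by blast
      then have "X = \<phi> (Quat a b c e)" by (simp add: \<phi>_def)
      then show "X \<in> range \<phi>" by blast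
    qed
  qed
qed

end

section \<open>The centralizer\<close>

text \<open>The map with an explicit formula goes from matrices over the reals or quaternions into
  the centralizer, opposite to the direction required. Closure of \<open>M\<close> under its
  operations lets the laws pass to the inverse.\<close>

lemma lie_isomorphic_inverse:
  assumes g: "bij_betw g (carrier M) (carrier L)"
    and closed: "\<And>x y. x \<in> carrier M \<Longrightarrow> y \<in> carrier M \<Longrightarrow> lie_add M x y \<in> carrier M"
      "\<And>c x. x \<in> carrier M \<Longrightarrow> lie_scale M c x \<in> carrier M"
      "\<And>x y. x \<in> carrier M \<Longrightarrow> y \<in> carrier M \<Longrightarrow> lie_bracket M x y \<in> carrier M"
    and hom: "\<And>x y. x \<in> carrier M \<Longrightarrow> y \<in> carrier M \<Longrightarrow> g (lie_add M x y) = lie_add L (g x) (g y)"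
      "\<And>c x. x \<in> carrier M \<Longrightarrow> g (lie_scale M c x) = lie_scale L c (g x)"
      "\<And>x y. x \<in> carrier M \<Longrightarrow> y \<in> carrier M \<Longrightarrow> g (lie_bracket M x y) = lie_bracket L (g x) (g y)"
  shows "lie_isomorphic L M"
proof -
  define f where "f = inv_into (carrier M) g"
  have fg: "f (g x) = x" if "x \<in> carrier M" for x
    unfolding f_def using bij_betw_inv_into_left[OF g that] .
  have ex: "\<exists>a\<in>carrier M. x = g a" if "x \<in> carrier L" for x
    using g that by (auto simp: bij_betw_def)
  show ?thesis
    unfolding lie_isomorphic_def
  proof (intro exI[of _ f] conjI ballI allI)
    show "bij_betw f (carrier L) (carrier M)" unfolding f_def by (rule bij_betw_inv_into[OF g])
    fix x assume "x \<in> carrier L"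
    then obtain a where a: "a \<in> carrier M" "x = g a" using ex by blast
    show "f (lie_scale L c x) = lie_scale M c (f x)" for c
      using a closed(2)[of a c] by (simp add: hom(2)[symmetric] fg)
    fix y assume "y \<in> carrier L"
    then obtain b where b: "b \<in> carrier M" "y = g b" using ex by blast
    show "f (lie_add L x y) = lie_add M (f x) (f y)" "f (lie_bracket L x y) = lie_bracket M (f x) (f y)"
      using a b closed by (simp_all add: hom[symmetric] fg)
  qed
qed

section \<open>Block diagonal matrices\<close>

definition block_diag :: "real mat \<Rightarrow> real mat \<Rightarrow> real mat" where
  "block_diag A B = four_block_mat A (0\<^sub>m (dim_row A) (dim_col B)) (0\<^sub>m (dim_row B) (dim_col A)) B"

lemma four_block_mat_inj:
  assumes "A \<in> carrier_mat p p" "B \<in> carrier_mat p q" "C \<in> carrier_mat q p" "D \<in> carrier_mat q q"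
    and "A' \<in> carrier_mat p p" "B' \<in> carrier_mat p q" "C' \<in> carrier_mat q p" "D' \<in> carrier_mat q q"
    and eq: "four_block_mat A B C D = four_block_mat A' B' C' D'"
  shows "A = A'" "B = B'" "C = C'" "D = D'"
proof -
  have e: "four_block_mat A B C D $$ (i, j) = four_block_mat A' B' C' D' $$ (i, j)" for i j
    by (simp only: eq)
  show "A = A'"
  proof (rule eq_matI)
    fix i j assume "i < dim_row A'" "j < dim_col A'"
    then show "A $$ (i, j) = A' $$ (i, j)" using e[of i j] assms(1-8) by auto
  qed (use assms in auto)
  show "B = B'"
  proof (rule eq_matI)
    fix i j assume "i < dim_row B'" "j < dim_col B'"
    then show "B $$ (i, j) = B' $$ (i, j)" using e[of i "p + j"] assms(1-8) by auto
  qed (use assms in auto)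
  show "C = C'"
  proof (rule eq_matI)
    fix i j assume "i < dim_row C'" "j < dim_col C'"
    then show "C $$ (i, j) = C' $$ (i, j)" using e[of "p + i" j] assms(1-8) by auto
  qed (use assms in auto)
  show "D = D'"
  proof (rule eq_matI)
    fix i j assume "i < dim_row D'" "j < dim_col D'"
    then show "D $$ (i, j) = D' $$ (i, j)" using e[of "p + i" "p + j"] assms(1-8) by auto
  qed (use assms in auto)
qed

lemma block_diag_carrier: "A \<in> carrier_mat p p \<Longrightarrow> B \<in> carrier_mat q q \<Longrightarrow> block_diag A B \<in> carrier_mat (p + q) (p + q)"
  by (auto simp: block_diag_def)

lemma block_diag_inj:
  assumes "A \<in> carrier_mat p p" "B \<in> carrier_mat q q" "A' \<in> carrier_mat p p" "B' \<in> carrier_mat q q"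
    and "block_diag A B = block_diag A' B'"
  shows "A = A'" "B = B'"
  using four_block_mat_inj[of A p "0\<^sub>m p q" q "0\<^sub>m q p" B A' "0\<^sub>m p q" "0\<^sub>m q p" B'] assms
  by (auto simp: block_diag_def)

lemma block_diag_ops:
  assumes "A \<in> carrier_mat p p" "B \<in> carrier_mat q q" "A' \<in> carrier_mat p p" "B' \<in> carrier_mat q q"
  shows "block_diag (A + A') (B + B') = block_diag A B + block_diag A' B'"
    "block_diag (A - A') (B - B') = block_diag A B - block_diag A' B'"
    "block_diag (A * A') (B * B') = block_diag A B * block_diag A' B'"
    "block_diag (map_mat (scaleR c) A) (map_mat (scaleR c) B) = map_mat (scaleR c) (block_diag A B)"
    "block_diag (- A) (- B) = - block_diag A B"
    "block_diag (transpose_mat A) (transpose_mat B) = transpose_mat (block_diag A B)"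
proof -
  show "block_diag (A * A') (B * B') = block_diag A B * block_diag A' B'"
    using assms mult_four_block_mat[of A p p "0\<^sub>m p q" q "0\<^sub>m q p" q B A' p "0\<^sub>m p q" q "0\<^sub>m q p" B']
    by (auto simp: block_diag_def)
qed (use assms in \<open>auto simp: block_diag_def intro!: eq_matI\<close>)

section \<open>The Lie algebra of skew-Hermitian matrices\<close>

context matrix_star_embedding
begin

lemma amp_bracket:
  assumes "C \<in> carrier_mat m m" "C' \<in> carrier_mat m m"
  shows "amp m (C * C' - C' * C) = amp m C * amp m C' - amp m C' * amp m C"
proof -
  have "C * C' - C' * C = C * C' + - (C' * C)" using assms by (auto intro!: eq_matI)
  then have "amp m (C * C' - C' * C) = amp m (C * C') + - amp m (C' * C)"
    using assms by (simp add: amp_add[of _ m] amp_uminus[of _ m])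
  also have "\<dots> = amp m C * amp m C' - amp m C' * amp m C"
    unfolding amp_mult[OF assms] amp_mult[OF assms(2,1)] by (auto intro!: eq_matI)
  finally show ?thesis .
qed

definition skew :: "nat \<Rightarrow> 'k mat set" where
  "skew m = {C \<in> carrier_mat m m. map_mat cj (transpose_mat C) = - C}"

lemma skew_iff: "C \<in> skew m \<longleftrightarrow> C \<in> carrier_mat m m \<and> transpose_mat (amp m C) = - amp m C"
  using amp_antisymmetric_iff by (auto simp: skew_def)

text \<open>Closure is checked on the amplified real matrices, where \<open>transpose_mat\<close>
  reverses products, and brought back by \<open>skew_iff\<close>.\<close>

lemma skew_closed:
  assumes "C \<in> skew m" "C' \<in> skew m"
  shows "C + C' \<in> skew m" "map_mat (scaleR c) C \<in> skew m" "C * C' - C' * C \<in> skew m"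
proof -
  have C: "C \<in> carrier_mat m m" "C' \<in> carrier_mat m m"
    and t: "transpose_mat (amp m C) = - amp m C" "transpose_mat (amp m C') = - amp m C'"
    using assms by (auto simp: skew_iff)
  note car = amp_carrier[of m C] amp_carrier[of m C']
  have "transpose_mat (amp m C + amp m C') = transpose_mat (amp m C) + transpose_mat (amp m C')"
    using car by (intro transpose_add)
  also have "\<dots> = - (amp m C + amp m C')" unfolding t by (auto intro!: eq_matI)
  finally show "C + C' \<in> skew m" using C by (simp add: skew_iff amp_add[of _ m])
  have "transpose_mat (map_mat (scaleR c) (amp m C)) = map_mat (scaleR c) (transpose_mat (amp m C))"
    by (auto intro!: eq_matI)
  also have "\<dots> = - map_mat (scaleR c) (amp m C)" unfolding t by (auto intro!: eq_matI)
  finally show "map_mat (scaleR c) C \<in> skew m" using C by (simp add: skew_iff amp_scale[of _ m])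
  have "transpose_mat (amp m C * amp m C' - amp m C' * amp m C)
    = transpose_mat (amp m C * amp m C') - transpose_mat (amp m C' * amp m C)"
    by (auto intro!: eq_matI)
  also have "\<dots> = transpose_mat (amp m C') * transpose_mat (amp m C) - transpose_mat (amp m C) * transpose_mat (amp m C')"
    using transpose_mult[OF car(1,2)] transpose_mult[OF car(2,1)] by simp
  also have "\<dots> = - (amp m C * amp m C' - amp m C' * amp m C)" unfolding t by (auto intro!: eq_matI)
  finally show "C * C' - C' * C \<in> skew m"
    using C minus_carrier_mat[OF mult_carrier_mat[OF C(2) C(1)]] by (simp add: skew_iff amp_bracket)
qed

end

text \<open>Block by block, commuting means intertwining: in the diagonal blocks a representation
  with itself, in the off-diagonal ones the two representations with each other.\<close>

lemma spin_hat_commuting_iff: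
  assumes hp: "half_spin r 1 \<rho>p" and hm: "half_spin r (- 1) \<rho>m"
    and M: "M \<in> carrier_mat (half_spin_dim r * m1 + half_spin_dim r * m2) (half_spin_dim r * m1 + half_spin_dim r * m2)"
  shows "(\<forall>Y\<in>spin_hat r m1 m2 \<rho>p \<rho>m. M * Y = Y * M) \<longleftrightarrow>
    (\<exists>A B. A \<in> carrier_mat (half_spin_dim r * m1) (half_spin_dim r * m1) \<and>
      B \<in> carrier_mat (half_spin_dim r * m2) (half_spin_dim r * m2) \<and> M = block_diag A B \<and>
      (\<forall>a<m1. \<forall>b<m1. slice (half_spin_dim r) m1 m1 A a b \<in> commutant r (half_spin_dim r) \<rho>p) \<and>
      (\<forall>a<m2. \<forall>b<m2. slice (half_spin_dim r) m2 m2 B a b \<in> commutant r (half_spin_dim r) \<rho>m))"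
    (is "?comm \<longleftrightarrow> ?blocks")
proof -
  interpret P: half_spin r 1 \<rho>p by fact
  interpret Q: half_spin r "- 1" \<rho>m by fact
  let ?d = "half_spin_dim r"
  let ?p = "?d * m1" and ?q = "?d * m2"
  let ?kp = "\<lambda>x. kronecker (\<rho>p x) (1\<^sub>m m1)" and ?km = "\<lambda>x. kronecker (\<rho>m x) (1\<^sub>m m2)"
  have kp: "?kp x \<in> carrier_mat ?p ?p" and km: "?km x \<in> carrier_mat ?q ?q" if "x \<in> spin r" for x
    using that P.spin_carrier Q.spin_carrier kronecker_one_carrier by auto
  have hat: "spin_hat r m1 m2 \<rho>p \<rho>m = (\<lambda>x. block_diag (?kp x) (?km x)) ` spin r"
    unfolding spin_hat_def using kp[THEN carrier_matD(1)] kp[THEN carrier_matD(2)]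
      km[THEN carrier_matD(1)] km[THEN carrier_matD(2)]
    by (intro image_cong refl) (simp add: block_diag_def)
  have slices: "(\<forall>x\<in>spin r. A * kronecker (\<sigma> x) (1\<^sub>m m) = kronecker (\<sigma> x) (1\<^sub>m m) * A) \<longleftrightarrow>
      (\<forall>a<m. \<forall>b<m. slice ?d m m A a b \<in> commutant r ?d \<sigma>)"
    if "half_spin r s \<sigma>" "A \<in> carrier_mat (?d * m) (?d * m)" for \<sigma> s A m
  proof -
    interpret half_spin r s \<sigma> by fact
    show ?thesis
      using kronecker_one_intertwiner_iff[OF that(2) spin_carrier spin_carrier]
      by (auto simp: commutant_def)
  qed
  \<comment> \<open>General signs \<open>s\<close> and \<open>t\<close> make both off-diagonal
    blocks instances. Intertwining is known on \<open>spin r\<close> and is first extended to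
    \<open>Cl0 r\<close> in order to reach the volume element, where it reads
    \<open>s X = t X\<close> for every slice \<open>X\<close>.\<close>
  have off: "A = 0\<^sub>m (?d * m) (?d * m')"
    if \<sigma>: "half_spin r s \<sigma>" and \<tau>: "half_spin r t \<tau>" and "s \<noteq> t" and A: "A \<in> carrier_mat (?d * m) (?d * m')"
      and comm: "\<And>x. x \<in> spin r \<Longrightarrow> A * kronecker (\<sigma> x) (1\<^sub>m m') = kronecker (\<tau> x) (1\<^sub>m m) * A"
    for \<sigma> \<tau> s t A m m'
  proof (rule slice_eqI[OF A])
    interpret S: half_spin r s \<sigma> by fact
    interpret T: half_spin r t \<tau> by fact
    fix a b assume ab: "a < m" "b < m'"
    let ?X = "slice ?d m m' A a b"
    have inter: "?X * \<sigma> x = \<tau> x * ?X" if x: "x \<in> spin r" for x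
      using kronecker_one_intertwiner_iff[OF A S.spin_carrier[OF x] T.spin_carrier[OF x]] comm[OF x] ab by blast
    have volume: "cliff_volume r \<in> Cl0 r"
      unfolding cliff_volume_def by (rule Cl0_word) (use S.r_even in auto)
    have "?X * \<sigma> (cliff_volume r) = \<tau> (cliff_volume r) * ?X"
      by (rule intertwiner_Cl0[OF S.Cl0_rep_axioms T.Cl0_rep_axioms slice_carrier inter[OF spin_pair] volume])
    then have eq: "s \<cdot>\<^sub>m ?X = t \<cdot>\<^sub>m ?X"
      using right_mult_one_mat[OF slice_carrier, of ?d m m' A a b] left_mult_one_mat[OF slice_carrier, of ?d m m' A a b]
      unfolding S.volume T.volume
      by (simp add: mult_smult_distrib[of _ ?d ?d _ ?d] mult_smult_assoc_mat[of _ ?d ?d _ ?d])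
    have "?X $$ (i, j) = 0" if ij: "i < ?d" "j < ?d" for i j
    proof -
      have "(s \<cdot>\<^sub>m ?X) $$ (i, j) = (t \<cdot>\<^sub>m ?X) $$ (i, j)" by (simp only: eq)
      then show ?thesis using ij \<open>s \<noteq> t\<close> by (simp del: slice_index)
    qed
    then show "?X = slice ?d m m' (0\<^sub>m (?d * m) (?d * m')) a b"
      using ab kron_index_less by (intro eq_matI) auto
  qed simp
  show ?thesis
  proof
    assume comm: ?comm
    define A where "A = mat ?p ?p (\<lambda>(i, j). M $$ (i, j))"
    define B where "B = mat ?p ?q (\<lambda>(i, j). M $$ (i, j + ?p))"
    define C where "C = mat ?q ?p (\<lambda>(i, j). M $$ (i + ?p, j))"
    define E where "E = mat ?q ?q (\<lambda>(i, j). M $$ (i + ?p, j + ?p))"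
    have car: "A \<in> carrier_mat ?p ?p" "B \<in> carrier_mat ?p ?q" "C \<in> carrier_mat ?q ?p" "E \<in> carrier_mat ?q ?q"
      by (simp_all add: A_def B_def C_def E_def)
    have Meq: "M = four_block_mat A B C E"
      using M by (intro eq_matI) (auto simp: A_def B_def C_def E_def)
    have eqs: "A * ?kp x = ?kp x * A" "B * ?km x = ?kp x * B" "C * ?kp x = ?km x * C" "E * ?km x = ?km x * E"
      if x: "x \<in> spin r" for x
    proof -
      note k = kp[OF x] km[OF x]
      let ?Y = "four_block_mat (?kp x) (0\<^sub>m ?p ?q) (0\<^sub>m ?q ?p) (?km x)"
      have Y: "block_diag (?kp x) (?km x) = ?Y" using k by (simp add: block_diag_def)
      have 1: "M * ?Y = four_block_mat (A * ?kp x) (B * ?km x) (C * ?kp x) (E * ?km x)"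
        unfolding Meq using car k
        by (subst mult_four_block_mat[of _ ?p ?p _ ?q _ ?q _ _ ?p _ ?q]) auto
      have 2: "?Y * M = four_block_mat (?kp x * A) (?kp x * B) (?km x * C) (?km x * E)"
        unfolding Meq using car k
        by (subst mult_four_block_mat[of _ ?p ?p _ ?q _ ?q _ _ ?p _ ?q]) auto
      have "M * ?Y = ?Y * M" using comm x unfolding hat Y[symmetric] by blast
      then have "four_block_mat (A * ?kp x) (B * ?km x) (C * ?kp x) (E * ?km x)
        = four_block_mat (?kp x * A) (?kp x * B) (?km x * C) (?km x * E)" unfolding 1 2 .
      from four_block_mat_inj[OF mult_carrier_mat[OF car(1) k(1)] mult_carrier_mat[OF car(2) k(2)]
          mult_carrier_mat[OF car(3) k(1)] mult_carrier_mat[OF car(4) k(2)]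
          mult_carrier_mat[OF k(1) car(1)] mult_carrier_mat[OF k(1) car(2)]
          mult_carrier_mat[OF k(2) car(3)] mult_carrier_mat[OF k(2) car(4)] this]
      show "A * ?kp x = ?kp x * A" "B * ?km x = ?kp x * B" "C * ?kp x = ?km x * C" "E * ?km x = ?km x * E"
        by blast+
    qed
    have "B = 0\<^sub>m ?p ?q" by (rule off[OF hm hp _ car(2)]) (use eqs in auto)
    moreover have "C = 0\<^sub>m ?q ?p" by (rule off[OF hp hm _ car(3)]) (use eqs in auto)
    ultimately have "M = block_diag A E" using car unfolding Meq by (simp add: block_diag_def)
    then show ?blocks
      using car(1,4) eqs slices[OF hp car(1)] slices[OF hm car(4)] by blast
  next
    assume ?blocks
    then obtain A B where AB: "A \<in> carrier_mat ?p ?p" "B \<in> carrier_mat ?q ?q" "M = block_diag A B"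
      and s: "\<forall>a<m1. \<forall>b<m1. slice ?d m1 m1 A a b \<in> commutant r ?d \<rho>p"
        "\<forall>a<m2. \<forall>b<m2. slice ?d m2 m2 B a b \<in> commutant r ?d \<rho>m" by blast
    show ?comm
    proof
      fix Y assume "Y \<in> spin_hat r m1 m2 \<rho>p \<rho>m"
      then obtain x where x: "x \<in> spin r" "Y = block_diag (?kp x) (?km x)" unfolding hat by blast
      have eq: "A * ?kp x = ?kp x * A" "B * ?km x = ?km x * B"
        using slices[OF hp AB(1)] slices[OF hm AB(2)] s x(1) by blast+
      show "M * Y = Y * M"
        unfolding AB(3) x(2) block_diag_ops(3)[OF AB(1,2) kp[OF x(1)] km[OF x(1)], symmetric]
          block_diag_ops(3)[OF kp[OF x(1)] km[OF x(1)] AB(1,2), symmetric] eq ..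
    qed
  qed
qed

text \<open>The algebra \<open>'k\<close> and its conjugation are shared, but \<open>\<phi>p\<close>
  and \<open>\<phi>m\<close> are independent: with the off-diagonal blocks zero, the two commutants
  never interact, and their units may be chosen separately.\<close>

lemma centralizer_isomorphic:
  fixes cj :: "'k::real_algebra_1 \<Rightarrow> 'k"
  assumes hp: "half_spin r 1 \<rho>p" and hm: "half_spin r (- 1) \<rho>m"
    and ep: "matrix_star_embedding (half_spin_dim r) \<phi>p cj" "range \<phi>p = commutant r (half_spin_dim r) \<rho>p"
    and em: "matrix_star_embedding (half_spin_dim r) \<phi>m cj" "range \<phi>m = commutant r (half_spin_dim r) \<rho>m"
  defines "L \<equiv> \<lambda>m. matrix_lie_algebra m {C \<in> carrier_mat m m. map_mat cj (transpose_mat C) = - C}"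
  shows "lie_isomorphic
    (lie_centralizer (so_lie (half_spin_dim r * m1 + half_spin_dim r * m2)) (spin_hat r m1 m2 \<rho>p \<rho>m))
    (lie_direct_sum (L m1) (L m2))"
proof -
  interpret P: matrix_star_embedding "half_spin_dim r" \<phi>p cj by fact
  interpret Q: matrix_star_embedding "half_spin_dim r" \<phi>m cj by fact
  let ?d = "half_spin_dim r"
  let ?n = "?d * m1 + ?d * m2"
  let ?H = "spin_hat r m1 m2 \<rho>p \<rho>m"
  let ?Z = "lie_centralizer (so_lie ?n) ?H" and ?M = "lie_direct_sum (L m1) (L m2)"
  define g where "g = (\<lambda>(C, C'). block_diag (P.amp m1 C) (Q.amp m2 C'))"
  have carM: "carrier ?M = P.skew m1 \<times> Q.skew m2"
    by (simp add: lie_direct_sum_def L_def matrix_lie_algebra_def P.skew_def Q.skew_def)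
  have H: "Y \<in> carrier_mat ?n ?n" if "Y \<in> ?H" for Y
    using that spin_hat_subset_so[of r \<rho>p \<rho>m m1 m2] half_spin.half_spin[OF hp] half_spin.half_spin[OF hm]
    by (auto simp: so_lie_def matrix_lie_algebra_def)
  have carZ: "carrier ?Z = {X \<in> carrier_mat ?n ?n. transpose_mat X = - X \<and> (\<forall>Y\<in>?H. X * Y = Y * X)}"
  proof -
    have "X * Y - Y * X = 0\<^sub>m ?n ?n \<longleftrightarrow> X * Y = Y * X"
      if "X \<in> carrier_mat ?n ?n" "Y \<in> carrier_mat ?n ?n" for X Y :: "real mat"
    proof
      assume eq: "X * Y - Y * X = 0\<^sub>m ?n ?n"
      show "X * Y = Y * X"
      proof (rule eq_matI)
        fix i j assume ij: "i < dim_row (Y * X)" "j < dim_col (Y * X)"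
        have "(X * Y - Y * X) $$ (i, j) = 0\<^sub>m ?n ?n $$ (i, j)" by (simp only: eq)
        then show "(X * Y) $$ (i, j) = (Y * X) $$ (i, j)"
          using ij that by (simp del: index_mult_mat(1))
      qed (use that in auto)
    qed (use that in auto)
    then show ?thesis
      using H by (auto simp: lie_centralizer_def so_lie_def matrix_lie_algebra_def)
  qed
  have skewP: "C \<in> carrier_mat m1 m1" if "C \<in> P.skew m1" for C using that by (simp add: P.skew_def)
  have skewQ: "C \<in> carrier_mat m2 m2" if "C \<in> Q.skew m2" for C using that by (simp add: Q.skew_def)
  have anti_iff: "transpose_mat (block_diag A B) = - block_diag A B \<longleftrightarrow> transpose_mat A = - A \<and> transpose_mat B = - B"
    if "A \<in> carrier_mat (?d * m1) (?d * m1)" "B \<in> carrier_mat (?d * m2) (?d * m2)" for A B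
  proof -
    have "block_diag (transpose_mat A) (transpose_mat B) = block_diag (- A) (- B) \<longleftrightarrow> transpose_mat A = - A \<and> transpose_mat B = - B"
      using block_diag_inj[of "transpose_mat A" "?d * m1" "transpose_mat B" "?d * m2" "- A" "- B"] that by auto
    then show ?thesis using block_diag_ops(5,6)[OF that that] by simp
  qed
  show ?thesis
  proof (rule lie_isomorphic_inverse[where g = g])
    show "bij_betw g (carrier ?M) (carrier ?Z)"
      unfolding bij_betw_def
    proof
      show "inj_on g (carrier ?M)"
      proof (rule inj_onI, unfold carM, elim SigmaE, simp only: g_def prod.case)
        fix C E C' E'
        assume s: "C \<in> P.skew m1" "E \<in> Q.skew m2" "C' \<in> P.skew m1" "E' \<in> Q.skew m2"
          and "block_diag (P.amp m1 C) (Q.amp m2 E) = block_diag (P.amp m1 C') (Q.amp m2 E')"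
        then have "P.amp m1 C = P.amp m1 C'" "Q.amp m2 E = Q.amp m2 E'"
          using block_diag_inj[OF P.amp_carrier Q.amp_carrier P.amp_carrier Q.amp_carrier] by blast+
        then show "(C, E) = (C', E')" using P.amp_inj Q.amp_inj s skewP skewQ by blast
      qed
      show "g ` carrier ?M = carrier ?Z"
      proof
        show "g ` carrier ?M \<subseteq> carrier ?Z"
        proof
          fix X assume "X \<in> g ` carrier ?M"
          then obtain C E where CE: "C \<in> P.skew m1" "E \<in> Q.skew m2" "X = block_diag (P.amp m1 C) (Q.amp m2 E)"
            by (auto simp: carM g_def)
          have X: "X \<in> carrier_mat ?n ?n" unfolding CE(3) by (intro block_diag_carrier P.amp_carrier Q.amp_carrier)
          have "transpose_mat X = - X"
            unfolding CE(3) using anti_iff[OF P.amp_carrier Q.amp_carrier] CE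
            by (simp add: P.skew_iff[of C] Q.skew_iff[of E])
          moreover have "\<forall>Y\<in>?H. X * Y = Y * X"
            unfolding spin_hat_commuting_iff[OF hp hm X]
            using CE(3) P.amp_carrier[of m1 C] Q.amp_carrier[of m2 E] ep(2) em(2)
            by (intro exI[of _ "P.amp m1 C"] exI[of _ "Q.amp m2 E"]) (auto simp: P.slice_amp Q.slice_amp)
          ultimately show "X \<in> carrier ?Z" unfolding carZ using X by blast
        qed
        show "carrier ?Z \<subseteq> g ` carrier ?M"
        proof
          fix X assume "X \<in> carrier ?Z"
          then have X: "X \<in> carrier_mat ?n ?n" "transpose_mat X = - X" "\<forall>Y\<in>?H. X * Y = Y * X"
            by (auto simp: carZ)
          then obtain A B where AB: "A \<in> carrier_mat (?d * m1) (?d * m1)" "B \<in> carrier_mat (?d * m2) (?d * m2)"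
              "X = block_diag A B"
            and s: "\<And>a b. a < m1 \<Longrightarrow> b < m1 \<Longrightarrow> slice ?d m1 m1 A a b \<in> range \<phi>p"
              "\<And>a b. a < m2 \<Longrightarrow> b < m2 \<Longrightarrow> slice ?d m2 m2 B a b \<in> range \<phi>m"
            unfolding spin_hat_commuting_iff[OF hp hm X(1)] ep(2) em(2) by blast
          obtain C where C: "C \<in> carrier_mat m1 m1" "P.amp m1 C = A" using P.amp_surj[OF AB(1) s(1)] by blast
          obtain E where E: "E \<in> carrier_mat m2 m2" "Q.amp m2 E = B" using Q.amp_surj[OF AB(2) s(2)] by blast
          have "transpose_mat A = - A" "transpose_mat B = - B" using X(2) anti_iff[OF AB(1,2)] AB(3) by auto
          then have "(C, E) \<in> carrier ?M" using C E by (simp add: carM P.skew_iff[of C] Q.skew_iff[of E])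
          then show "X \<in> g ` carrier ?M"
            by (intro image_eqI[of _ _ "(C, E)"]) (simp_all add: g_def C E AB)
        qed
      qed
    qed
    note defs = lie_direct_sum_def L_def matrix_lie_algebra_def lie_centralizer_def so_lie_def
    fix x assume "x \<in> carrier ?M"
    then obtain C E where x: "x = (C, E)" and s: "C \<in> P.skew m1" "E \<in> Q.skew m2" unfolding carM by blast
    note c = skewP[OF s(1)] skewQ[OF s(2)]
    note ac = P.amp_carrier[of m1 C] Q.amp_carrier[of m2 E]
    show "lie_scale ?M c x \<in> carrier ?M" for c
      unfolding carM using P.skew_closed(2)[OF s(1,1)] Q.skew_closed(2)[OF s(2,2)] by (simp add: x defs)
    show "g (lie_scale ?M c x) = lie_scale ?Z c (g x)" for c
      using block_diag_ops(4)[OF ac ac]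
      by (simp add: x g_def defs P.amp_scale[OF c(1)] Q.amp_scale[OF c(2)])
    fix y assume "y \<in> carrier ?M"
    then obtain C' E' where y: "y = (C', E')" and s': "C' \<in> P.skew m1" "E' \<in> Q.skew m2" unfolding carM by blast
    note c' = skewP[OF s'(1)] skewQ[OF s'(2)]
    note ac' = P.amp_carrier[of m1 C'] Q.amp_carrier[of m2 E']
    show "lie_add ?M x y \<in> carrier ?M" "lie_bracket ?M x y \<in> carrier ?M"
      unfolding carM using P.skew_closed[OF s(1) s'(1)] Q.skew_closed[OF s(2) s'(2)]
      by (simp_all add: x y defs)
    show "g (lie_add ?M x y) = lie_add ?Z (g x) (g y)"
      using block_diag_ops(1)[OF ac ac']
      by (simp add: x y g_def defs P.amp_add[OF c(1) c'(1)] Q.amp_add[OF c(2) c'(2)])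
    show "g (lie_bracket ?M x y) = lie_bracket ?Z (g x) (g y)"
    proof -
      have "g (lie_bracket ?M x y) = block_diag (P.amp m1 C * P.amp m1 C' - P.amp m1 C' * P.amp m1 C)
          (Q.amp m2 E * Q.amp m2 E' - Q.amp m2 E' * Q.amp m2 E)"
        by (simp add: x y g_def defs P.amp_bracket[OF c(1) c'(1)] Q.amp_bracket[OF c(2) c'(2)])
      also have "\<dots> = block_diag (P.amp m1 C * P.amp m1 C') (Q.amp m2 E * Q.amp m2 E') -
          block_diag (P.amp m1 C' * P.amp m1 C) (Q.amp m2 E' * Q.amp m2 E)"
        by (rule block_diag_ops(2)[OF mult_carrier_mat[OF ac(1) ac'(1)] mult_carrier_mat[OF ac(2) ac'(2)]
              mult_carrier_mat[OF ac'(1) ac(1)] mult_carrier_mat[OF ac'(2) ac(2)]])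
      also have "\<dots> = lie_bracket ?Z (g x) (g y)"
        unfolding block_diag_ops(3)[OF ac ac'] block_diag_ops(3)[OF ac' ac] by (simp add: x y g_def defs)
      finally show ?thesis .
    qed
  qed
qed

theorem theorem3p2:
  fixes r m1 m2 :: nat and \<rho>p \<rho>m :: "clifford \<Rightarrow> real mat"
  assumes "r \<ge> 1" and "r mod 4 = 0"
    and "\<not> (m1 = 0 \<and> m2 = 0)"
    and "half_spin_representation r 1 \<rho>p"
    and "half_spin_representation r (-1) \<rho>m"
  shows "(r mod 8 = 0 \<longrightarrow>
      lie_isomorphic
        (lie_centralizer (so_lie (half_spin_dim r * m1 + half_spin_dim r * m2))
          (spin_hat r m1 m2 \<rho>p \<rho>m))
        (lie_direct_sum (so_lie m1) (so_lie m2))) \<and>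
    (r mod 8 = 4 \<longrightarrow>
      lie_isomorphic
        (lie_centralizer (so_lie (half_spin_dim r * m1 + half_spin_dim r * m2))
          (spin_hat r m1 m2 \<rho>p \<rho>m))
        (lie_direct_sum (sp_lie m1) (sp_lie m2)))"
proof -
  have "even r" using assms(2) by presburger
  then have hp: "half_spin r 1 \<rho>p" and hm: "half_spin r (- 1) \<rho>m"
    using assms by (auto intro!: half_spin.intro)
  interpret P: half_spin r 1 \<rho>p by fact
  interpret Q: half_spin r "- 1" \<rho>m by fact
  show ?thesis
  proof (intro conjI impI)
    assume r8: "r mod 8 = 0"
    \<comment> \<open>Trivial conjugation reduces the general skew-Hermitian condition to the
      antisymmetry in \<open>so_lie\<close>.\<close>
    have "map_mat (\<lambda>x. x) A = A" for A :: "real mat" by (auto intro!: eq_matI)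
    then show "lie_isomorphic (lie_centralizer (so_lie (half_spin_dim r * m1 + half_spin_dim r * m2))
        (spin_hat r m1 m2 \<rho>p \<rho>m)) (lie_direct_sum (so_lie m1) (so_lie m2))"
      using centralizer_isomorphic[OF hp hm P.real_embedding[OF r8] Q.real_embedding[OF r8], of m1 m2]
      by (simp add: so_lie_def)
  next
    assume r4: "r mod 8 = 4"
    obtain I J where p: "P.quaternion_units I J" using P.commutant_quaternionic[OF r4] .
    obtain I' J' where m: "Q.quaternion_units I' J'" using Q.commutant_quaternionic[OF r4] .
    show "lie_isomorphic (lie_centralizer (so_lie (half_spin_dim r * m1 + half_spin_dim r * m2))
        (spin_hat r m1 m2 \<rho>p \<rho>m)) (lie_direct_sum (sp_lie m1) (sp_lie m2))"
      unfolding sp_lie_def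
      by (rule centralizer_isomorphic[OF hp hm P.quaternion_embedding[OF p] Q.quaternion_embedding[OF m]])
  qed
qed

end
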